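(* Let $p,n$ be positive integers and let $X\sim N_p(\theta,\eta^{-1}I_p)$ and $S\sim \eta^{-1}\chi^2_n$ be independent, with $\theta\in\mathbb{R}^p$ and $\eta=1/\sigma^2\in(0,\infty)$ both unknown. Consider estimation of $\theta$ under the loss $L(d;\{\theta,\sigma^2\})=\|d-\theta\|^2/\sigma^2=\eta\|d-\theta\|^2$. Let $\delta_\pi(X,S)$ be the generalized Bayes estimator of $\theta$ with respect to the hierarchical prior $\pi(\theta,\eta)$ given by $$\theta\mid\{\eta,\lambda\}\sim N_p\Big(0,\frac1\eta\frac{1-\lambda}{\lambda}I_p\Big),\quad \lambda\sim\frac{\lambda^a(1-\lambda)^b}{B(a+1,b+1)}\ (0<\lambda<1),\quad \eta\sim\frac1\eta\ (0<\eta<\infty).$$ Suppose $n\ge 3$ and $p>4n/(n-2)$. If $$-1<a\le \xi(p,n):=-2+\frac{(p-2)(n+2)}{2(2p+n-2)}\quad\text{and}\quad b\ge 0,$$ then $\delta_\pi$ is minimax and admissible.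
   Context: An estimator is a measurable map $\delta:\mathbb{R}^p\times(0,\infty)\to\mathbb{R}^p$ with risk $R(\theta,\eta,\delta)=E_{\theta,\eta}[\eta\|\delta(X,S)-\theta\|^2]$. $\delta$ is admissible if there is no estimator $\delta'$ with $R(\theta,\eta,\delta')\le R(\theta,\eta,\delta)$ for all $(\theta,\eta)\in\mathbb{R}^p\times(0,\infty)$ and strict inequality for some $(\theta,\eta)$. $\delta$ is minimax if $\sup_{\theta,\eta}R(\theta,\eta,\delta)=\inf_{\delta'}\sup_{\theta,\eta}R(\theta,\eta,\delta')$, the infimum being over all estimators. The prior density is explicitly $$\pi(\theta,\eta)=\eta^{-1}\eta^{p/2}\int_0^1\frac{1}{(2\pi)^{p/2}}\Big(\frac{\lambda}{1-\lambda}\Big)^{p/2}\exp\Big(-\frac{\lambda}{1-\lambda}\frac{\eta\|\theta\|^2}{2}\Big)\frac{\lambda^a(1-\lambda)^b}{B(a+1,b+1)}\,d\lambda,$$ where $B$ is the Beta function. The generalized Bayes estimator is $$\delta_\pi(x,s)=\frac{\int_{\mathbb{R}^p}\int_0^\infty\theta\,\eta f_x(x\mid\theta,\eta)f_s(s\mid\eta)\pi(\theta,\eta)\,d\eta\,d\theta}{\int_{\mathbb{R}^p}\int_0^\infty\eta f_x(x\mid\theta,\eta)f_s(s\mid\eta)\pi(\theta,\eta)\,d\eta\,d\theta},$$ where $f_x(x\mid\theta,\eta)=\frac{\eta^{p/2}}{(2\pi)^{p/2}}\exp(-\frac\eta2\|x-\theta\|^2)$ and $f_s(s\mid\eta)=\frac{\eta^{n/2}}{\Gamma(n/2)2^{n/2}}s^{n/2-1}\exp(-\frac{\eta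 s}{2})$. *)

theory Defs
  imports "HOL-Probability.Probability"
begin

text \<open>The dimension $p$ is \<open>CARD('p)\<close>. The observation is a pair \<open>(x, s)\<close> with \<open>s > 0\<close>.\<close>

definition normal_dens :: "real ^ 'p::finite \<Rightarrow> real \<Rightarrow> real ^ 'p \<Rightarrow> real" where
  \<comment> \<open>the mean is \<open>\<mu>\<close>; the second parameter is the precision: the covariance matrix is
     $\tau^{-1} I_p$\<close>
  "normal_dens \<mu> \<tau> x =
     \<tau> powr (real CARD('p) / 2) / (2 * pi) powr (real CARD('p) / 2)
       * exp (- (\<tau> / 2) * (norm (x - \<mu>))\<^sup>2)"

definition scaled_chisq_dens :: "nat \<Rightarrow> real \<Rightarrow> real \<Rightarrow> real" where
  "scaled_chisq_dens n \<eta> s =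
     \<eta> powr (real n / 2) / (Gamma (real n / 2) * 2 powr (real n / 2))
       * s powr (real n / 2 - 1) * exp (- (\<eta> * s / 2))"

definition sample_law :: "nat \<Rightarrow> real ^ 'p::finite \<Rightarrow> real \<Rightarrow> ((real ^ 'p) \<times> real) measure" where
  \<comment> \<open>joint law of the independent pair \<open>(X, S)\<close>, on the sample space \<open>UNIV \<times> {0<..}\<close>\<close>
  "sample_law n \<theta> \<eta> =
     density lborel (\<lambda>x. ennreal (normal_dens \<theta> \<eta> x))
     \<Otimes>\<^sub>M density (restrict_space lborel {0<..}) (\<lambda>s. ennreal (scaled_chisq_dens n \<eta> s))"

definition estimator :: "((real ^ 'p::finite) \<times> real \<Rightarrow> real ^ 'p) \<Rightarrow> bool" where
  "estimator \<delta> \<longleftrightarrow> \<delta> \<in> borel \<Otimes>\<^sub>M restrict_space borel {0<..} \<rightarrow>\<^sub>M borel"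

definition risk :: "nat \<Rightarrow> ((real ^ 'p::finite) \<times> real \<Rightarrow> real ^ 'p) \<Rightarrow> real ^ 'p \<Rightarrow> real \<Rightarrow> ennreal" where
  "risk n \<delta> \<theta> \<eta> = (\<integral>\<^sup>+ z. ennreal (\<eta> * (norm (\<delta> z - \<theta>))\<^sup>2) \<partial>sample_law n \<theta> \<eta>)"

definition sup_risk :: "nat \<Rightarrow> ((real ^ 'p::finite) \<times> real \<Rightarrow> real ^ 'p) \<Rightarrow> ennreal" where
  "sup_risk n \<delta> = (SUP (\<theta>, \<eta>) \<in> UNIV \<times> {0<..}. risk n \<delta> \<theta> \<eta>)"

definition minimax :: "nat \<Rightarrow> ((real ^ 'p::finite) \<times> real \<Rightarrow> real ^ 'p) \<Rightarrow> bool" where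
  "minimax n \<delta> \<longleftrightarrow> estimator \<delta> \<and>
     sup_risk n \<delta> =
       (INF \<delta>' \<in> {\<delta>' :: (real ^ 'p) \<times> real \<Rightarrow> real ^ 'p. estimator \<delta>'}. sup_risk n \<delta>')"

definition admissible :: "nat \<Rightarrow> ((real ^ 'p::finite) \<times> real \<Rightarrow> real ^ 'p) \<Rightarrow> bool" where
  "admissible n \<delta> \<longleftrightarrow> estimator \<delta> \<and>
     \<not> (\<exists>\<delta>' :: (real ^ 'p) \<times> real \<Rightarrow> real ^ 'p. estimator \<delta>' \<and>
           (\<forall>\<theta>. \<forall>\<eta>>0. risk n \<delta>' \<theta> \<eta> \<le> risk n \<delta> \<theta> \<eta>) \<and>
           (\<exists>\<theta>. \<exists>\<eta>>0. risk n \<delta>' \<theta> \<eta> < risk n \<delta> \<theta> \<eta>))"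

definition mixing_dens :: "real \<Rightarrow> real \<Rightarrow> real \<Rightarrow> real" where
  "mixing_dens a b l = l powr a * (1 - l) powr b / Beta (a + 1) (b + 1)"

definition prior_dens :: "real \<Rightarrow> real \<Rightarrow> real ^ 'p::finite \<Rightarrow> real \<Rightarrow> real" where
  \<comment> \<open>For \<open>\<theta> = 0\<close> the integral may diverge (if \<open>b \<le> p/2 - 1\<close>), and the Lebesgue integral is
     then 0 by convention. This is a Lebesgue-null set of parameters, so it does not affect
     the generalized Bayes estimator.\<close>
  "prior_dens a b \<theta> \<eta> =
     inverse \<eta> * \<eta> powr (real CARD('p) / 2)
       * (LBINT l:{0<..<1}.
            1 / (2 * pi) powr (real CARD('p) / 2) * (l / (1 - l)) powr (real CARD('p) / 2)
              * exp (- (l / (1 - l)) * (\<eta> * (norm \<theta>)\<^sup>2 / 2)) * mixing_dens a b l)"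

text \<open>The prior density is that of the hierarchy: $\theta$ given $(\eta,\lambda)$ is normal with
  covariance $\eta^{-1}\frac{1-\lambda}{\lambda} I_p$, $\lambda$ has the density
  \<open>mixing_dens a b\<close>, and $\eta$ has the improper density $1/\eta$.\<close>

lemma prior_dens_hierarchical:
  fixes \<theta> :: "real ^ 'p::finite"
  assumes "\<eta> > 0"
  shows "prior_dens a b \<theta> \<eta> =
    (LBINT l:{0<..<1}.
       normal_dens 0 (inverse (1 / \<eta> * ((1 - l) / l))) \<theta> * mixing_dens a b l * (1 / \<eta>))"
proof -
  have "inverse \<eta> * \<eta> powr (real CARD('p) / 2)
       * (1 / (2 * pi) powr (real CARD('p) / 2) * (l / (1 - l)) powr (real CARD('p) / 2)
              * exp (- (l / (1 - l)) * (\<eta> * (norm \<theta>)\<^sup>2 / 2)) * mixing_dens a b l)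
     = normal_dens 0 (inverse (1 / \<eta> * ((1 - l) / l))) \<theta> * mixing_dens a b l * (1 / \<eta>)"
    if l: "l \<in> {0<..<1}" for l
  proof -
    have e: "inverse (1 / \<eta> * ((1 - l) / l)) = \<eta> * (l / (1 - l))"
      using l assms by (simp add: field_simps)
    have q: "(\<eta> * (l / (1 - l))) powr (real CARD('p) / 2)
        = \<eta> powr (real CARD('p) / 2) * (l / (1 - l)) powr (real CARD('p) / 2)"
      by (rule powr_mult)
    have x: "- (\<eta> * (l / (1 - l)) / 2) * (norm (\<theta> - 0))\<^sup>2
        = - (l / (1 - l)) * (\<eta> * (norm \<theta>)\<^sup>2 / 2)"
      by simp
    show ?thesis
      unfolding e normal_dens_def q x
      by (simp only: divide_inverse mult_ac mult_1_left mult_1_right)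
  qed
  then have "(LBINT l:{0<..<1}. inverse \<eta> * \<eta> powr (real CARD('p) / 2)
       * (1 / (2 * pi) powr (real CARD('p) / 2) * (l / (1 - l)) powr (real CARD('p) / 2)
              * exp (- (l / (1 - l)) * (\<eta> * (norm \<theta>)\<^sup>2 / 2)) * mixing_dens a b l))
     = (LBINT l:{0<..<1}.
       normal_dens 0 (inverse (1 / \<eta> * ((1 - l) / l))) \<theta> * mixing_dens a b l * (1 / \<eta>))"
    by (intro set_lebesgue_integral_cong) auto
  then show ?thesis
    by (simp only: prior_dens_def set_integral_mult_right)
qed

definition gen_bayes :: "nat \<Rightarrow> real \<Rightarrow> real \<Rightarrow> (real ^ 'p::finite) \<times> real \<Rightarrow> real ^ 'p" where
  "gen_bayes n a b = (\<lambda>(x, s).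
     (LBINT \<theta>. LBINT \<eta>:{0<..}.
        (\<eta> * normal_dens \<theta> \<eta> x * scaled_chisq_dens n \<eta> s * prior_dens a b \<theta> \<eta>) *\<^sub>R \<theta>)
     /\<^sub>R (LBINT \<theta>. LBINT \<eta>:{0<..}.
        \<eta> * normal_dens \<theta> \<eta> x * scaled_chisq_dens n \<eta> s * prior_dens a b \<theta> \<eta>))"

definition xi :: "nat \<Rightarrow> nat \<Rightarrow> real" where
  "xi p n = -2 + (real p - 2) * (real n + 2) / (2 * (2 * real p + real n - 2))"

end

theory Submission
  imports Defs
begin

text \<open>
  Given \<open>\<eta>\<close>, \<open>\<lambda>\<close> and \<open>x\<close> the parameter \<open>\<theta>\<close> is normal with mean \<open>(1 - \<lambda>) x\<close>. Hence the generalized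
  Bayes estimator is \<open>\<delta>(x, s) = (1 - \<psi>) x\<close>, where \<open>\<psi>\<close> is the posterior mean of \<open>\<lambda>\<close> (\<open>gen_bayes_eq\<close>).
  Integrating \<open>\<eta>\<close> out shows that \<open>\<psi>\<close> depends only on \<open>w = |x|\<^sup>2 / s\<close>: it is a quotient \<open>\<Psi>(w)\<close> of two
  integrals over \<open>\<lambda>\<close> (\<open>post_mean_eq_shrink\<close>).

  Minimaxity. For \<open>\<eta> = 1\<close> and prior \<open>\<theta> \<sim> N(0, I/t)\<close> no estimator has average risk below \<open>p / (1 + t)\<close>;
  letting \<open>t\<close> tend to \<open>0\<close>, no estimator has worst-case risk below \<open>p\<close> (\<open>sup_risk_lower_bound\<close>).
  The risk of \<open>\<delta>\<close> is at most \<open>p\<close> by Baranchik's criterion (\<open>baranchik_risk_bound\<close>): \<open>w \<Psi>(w)\<close> is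
  nondecreasing, by a likelihood ratio argument that uses \<open>b \<ge> 0\<close> (\<open>tilt_ratio_mono\<close>), and it is at
  most \<open>2 (p - 2) / (n + 2)\<close>. An integration by parts in \<open>\<lambda>\<close> bounds it by
  \<open>(p/2 + a + 1) / (n/2 - a - 1)\<close> (\<open>tilt_ratio_bound\<close>), and \<open>a \<le> \<xi>(p, n)\<close> says exactly that this is at
  most \<open>2 (p - 2) / (n + 2)\<close>. Baranchik's criterion is usually proved from Stein's identity and
  the analogous chi-square identity, which differentiate \<open>\<Psi>\<close>. Here both are replaced by
  inequalities that need monotonicity only: \<open>stein_inequality\<close> compares an integral with its image
  under a dilation of \<open>x\<close>, and \<open>chi_antimono_inequality\<close> is a single-crossing argument in \<open>s\<close>.

  Admissibility. This is Blyth's method. Damping the improper prior \<open>1/\<eta>\<close> to \<open>H\<^sub>i(\<eta>)/\<eta>\<close> with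
  \<open>H\<^sub>i(\<eta>) = i\<^sup>2 / (i\<^sup>2 + ln\<^sup>2 \<eta>)\<close> gives a finite prior of mass \<open>i \<pi>\<close>, under which \<open>\<delta>\<close> has finite Bayes
  risk. The posterior mean of \<open>\<lambda> - \<psi>\<close> under the undamped prior is \<open>0\<close>, so in the comparison of \<open>\<delta>\<close>
  with a competitor \<open>\<delta>'\<close> the weight \<open>H\<^sub>i(\<eta>)\<close> may be replaced by \<open>H\<^sub>i(\<eta>) - H\<^sub>i(1/s)\<close>, which is at most
  \<open>(2/i) |ln (\<eta> s)|\<close> times the geometric mean of \<open>H\<^sub>i(\<eta>)\<close> and \<open>H\<^sub>i(1/s)\<close>. The resulting loss
  (\<open>posterior_excess_inequality\<close>) is of order \<open>1/i\<^sup>2\<close> times the mass \<open>i \<pi>\<close>, hence \<open>O(1/i)\<close>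
  (\<open>total_excess_bound\<close>). If \<open>\<delta>'\<close> is nowhere worse than \<open>\<delta>\<close>, the weighted integral of \<open>|\<delta> - \<delta>'|\<^sup>2\<close> is
  therefore \<open>O(1/i)\<close>; as it increases with \<open>i\<close> it vanishes, so \<open>\<delta>' = \<delta>\<close> almost everywhere.

  Integrals over observations and hyperparameters are taken over Lebesgue measure on full Euclidean
  spaces, with indicators for \<open>s > 0\<close>, \<open>\<eta> > 0\<close> and \<open>0 < \<lambda> < 1\<close>. In the formal text \<open>l\<close> stands for \<open>\<lambda>\<close>,
  \<open>z\<close> for an observation \<open>(x, s)\<close> and \<open>\<omega>\<close> for a pair \<open>(\<eta>, \<lambda>)\<close>.
\<close>

section \<open>Spherical normal laws\<close>

lemma borel_measurable_fst_snd [measurable (raw)]: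
  fixes f :: "'b \<Rightarrow> 'c::second_countable_topology \<times> 'd::second_countable_topology"
  assumes "f \<in> borel_measurable M"
  shows "(\<lambda>z. fst (f z)) \<in> borel_measurable M" "(\<lambda>z. snd (f z)) \<in> borel_measurable M"
  using assms measurable_compose[OF _ measurable_fst, of f M borel borel]
    measurable_compose[OF _ measurable_snd, of f M borel borel]
  by (simp_all add: borel_prod)

lemma normal_dens_measurable [measurable]:
  fixes f h :: "'b \<Rightarrow> real ^ 'p::finite"
  assumes [measurable]: "f \<in> borel_measurable M" "g \<in> borel_measurable M" "h \<in> borel_measurable M"
  shows "(\<lambda>z. normal_dens (f z) (g z) (h z)) \<in> borel_measurable M"
  unfolding normal_dens_def by measurable

lemma mixing_dens_measurable [measurable]:
  assumes [measurable]: "f \<in> borel_measurable M"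
  shows "(\<lambda>z. mixing_dens a b (f z)) \<in> borel_measurable M"
  unfolding mixing_dens_def by measurable

lemma scaled_chisq_dens_measurable [measurable]:
  assumes [measurable]: "f \<in> borel_measurable M" "g \<in> borel_measurable M"
  shows "(\<lambda>z. scaled_chisq_dens n (f z) (g z)) \<in> borel_measurable M"
  unfolding scaled_chisq_dens_def by measurable

lemma normal_dens_nonneg [simp]: "0 \<le> normal_dens \<mu> \<tau> x"
  by (simp add: normal_dens_def)

lemma normal_dens_prod:
  fixes x \<mu> :: "real ^ 'p::finite"
  assumes "0 < \<tau>"
  shows "normal_dens \<mu> \<tau> x = (\<Prod>b\<in>Basis. normal_density (\<mu> \<bullet> b) (1 / sqrt \<tau>) (x \<bullet> b))"
proof -
  have 1: "normal_density m (1 / sqrt \<tau>) t = sqrt (\<tau> / (2 * pi)) * exp (- (\<tau> / 2) * (t - m)\<^sup>2)" for m t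
  proof -
    have "1 / sqrt (2 * pi * (1 / sqrt \<tau>)\<^sup>2) = sqrt (\<tau> / (2 * pi))"
      using assms by (simp add: power_divide real_sqrt_divide)
    moreover have "- (t - m)\<^sup>2 / (2 * (1 / sqrt \<tau>)\<^sup>2) = - (\<tau> / 2) * (t - m)\<^sup>2"
      using assms by (simp add: power_divide)
    ultimately show ?thesis by (simp only: normal_density_def)
  qed
  have "(\<Prod>b\<in>(Basis::(real^'p) set). normal_density (\<mu> \<bullet> b) (1 / sqrt \<tau>) (x \<bullet> b)) =
     (\<Prod>b\<in>(Basis::(real^'p) set). sqrt (\<tau> / (2 * pi)) * exp (- (\<tau> / 2) * ((x - \<mu>) \<bullet> b)\<^sup>2))"
    by (simp only: 1 inner_diff_left)
  also have "\<dots> = sqrt (\<tau> / (2 * pi)) ^ CARD('p) * exp (- (\<tau> / 2) * (\<Sum>b\<in>Basis. ((x - \<mu>) \<bullet> b)\<^sup>2))"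
    by (simp only: prod.distrib prod_constant exp_sum[symmetric] finite_Basis sum_distrib_left) simp
  also have "sqrt (\<tau> / (2 * pi)) ^ CARD('p) = (\<tau> / (2 * pi)) powr (real CARD('p) / 2)"
    using assms by (simp add: powr_half_sqrt[symmetric] powr_realpow[symmetric] powr_powr)
  also have "(\<Sum>b\<in>Basis. ((x - \<mu>) \<bullet> b)\<^sup>2) = (norm (x - \<mu>))\<^sup>2"
    unfolding power2_norm_eq_inner by (subst euclidean_inner) (simp add: power2_eq_square)
  finally show ?thesis
    using assms by (simp add: normal_dens_def powr_divide)
qed

lemma nn_integral_normal_density:
  "0 < \<sigma> \<Longrightarrow> (\<integral>\<^sup>+t. ennreal (normal_density \<mu> \<sigma> t) \<partial>lborel) = 1"
  by (simp add: nn_integral_eq_integral)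

lemma nn_integral_normal_density_sq:
  assumes "0 < \<sigma>"
  shows "(\<integral>\<^sup>+t. ennreal ((d - t)\<^sup>2 * normal_density \<mu> \<sigma> t) \<partial>lborel) = ennreal ((d - \<mu>)\<^sup>2 + \<sigma>\<^sup>2)"
proof -
  have 2: "has_bochner_integral lborel (\<lambda>t. normal_density \<mu> \<sigma> t * (t - \<mu>)\<^sup>2) (\<sigma>\<^sup>2)"
    using normal_moment_even[OF assms, of \<mu> 1] by (simp add: power2_eq_square)
  have 1: "has_bochner_integral lborel (\<lambda>t. normal_density \<mu> \<sigma> t * (t - \<mu>)) 0"
    using normal_moment_odd[OF assms, of \<mu> 0] by simp
  have 0: "has_bochner_integral lborel (normal_density \<mu> \<sigma>) 1"
    using assms by (simp add: has_bochner_integral_iff)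
  have "has_bochner_integral lborel
     (\<lambda>t. normal_density \<mu> \<sigma> t * (t - \<mu>)\<^sup>2 + (- 2 * (d - \<mu>)) * (normal_density \<mu> \<sigma> t * (t - \<mu>))
        + (d - \<mu>)\<^sup>2 * normal_density \<mu> \<sigma> t)
     (\<sigma>\<^sup>2 + (- 2 * (d - \<mu>)) * 0 + (d - \<mu>)\<^sup>2 * 1)"
    by (intro has_bochner_integral_add has_bochner_integral_mult_right 0 1 2)
  moreover have "(\<lambda>t. normal_density \<mu> \<sigma> t * (t - \<mu>)\<^sup>2 + (- 2 * (d - \<mu>)) * (normal_density \<mu> \<sigma> t * (t - \<mu>))
        + (d - \<mu>)\<^sup>2 * normal_density \<mu> \<sigma> t) = (\<lambda>t. (d - t)\<^sup>2 * normal_density \<mu> \<sigma> t)"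
    by (intro ext) algebra
  ultimately have "has_bochner_integral lborel (\<lambda>t. (d - t)\<^sup>2 * normal_density \<mu> \<sigma> t) ((d - \<mu>)\<^sup>2 + \<sigma>\<^sup>2)"
    by (simp add: add.commute)
  then show ?thesis
    by (subst nn_integral_eq_integral) (auto simp: has_bochner_integral_iff)
qed

lemma nn_integral_normal_dens:
  fixes \<mu> :: "real ^ 'p::finite"
  assumes "0 < \<tau>"
  shows "(\<integral>\<^sup>+x. ennreal (normal_dens \<mu> \<tau> x) \<partial>lborel) = 1"
proof -
  have "(\<integral>\<^sup>+x. ennreal (normal_dens \<mu> \<tau> x) \<partial>lborel)
     = (\<integral>\<^sup>+x. (\<Prod>b\<in>(Basis :: (real^'p) set). ennreal (normal_density (\<mu> \<bullet> b) (1 / sqrt \<tau>) (x \<bullet> b))) \<partial>lborel)"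
    using assms by (simp add: normal_dens_prod prod_ennreal)
  also have "\<dots> = (\<Prod>b\<in>(Basis :: (real^'p) set). \<integral>\<^sup>+t. ennreal (normal_density (\<mu> \<bullet> b) (1 / sqrt \<tau>) t) \<partial>lborel)"
    by (rule nn_integral_lborel_prod) auto
  finally show ?thesis using assms by (simp add: nn_integral_normal_density)
qed

text \<open>The squared norm is a sum over coordinates, and each summand times the density is again a
  product of one-dimensional factors.\<close>

lemma nn_integral_normal_dens_sq:
  fixes \<mu> d :: "real ^ 'p::finite"
  assumes "0 < \<tau>"
  shows "(\<integral>\<^sup>+x. ennreal ((norm (d - x))\<^sup>2 * normal_dens \<mu> \<tau> x) \<partial>lborel)
    = ennreal ((norm (d - \<mu>))\<^sup>2 + real CARD('p) / \<tau>)"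
proof -
  let ?B = "Basis :: (real ^ 'p) set"
  let ?s = "1 / sqrt \<tau>"
  have s: "0 < ?s" using assms by simp
  have nrm: "(norm v)\<^sup>2 = (\<Sum>b\<in>Basis. (v \<bullet> b)\<^sup>2)" for v :: "real ^ 'p"
    unfolding power2_norm_eq_inner by (subst euclidean_inner) (simp add: power2_eq_square)
  have "(\<integral>\<^sup>+x. ennreal ((norm (d - x))\<^sup>2 * normal_dens \<mu> \<tau> x) \<partial>lborel)
     = (\<integral>\<^sup>+x. (\<Sum>c\<in>?B. \<Prod>b\<in>?B. ennreal ((if b = c then (d \<bullet> b - x \<bullet> b)\<^sup>2 else 1)
            * normal_density (\<mu> \<bullet> b) ?s (x \<bullet> b))) \<partial>lborel)"
  proof (intro nn_integral_cong)
    fix x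
    have "(norm (d - x))\<^sup>2 * normal_dens \<mu> \<tau> x
      = (\<Sum>c\<in>?B. ((d - x) \<bullet> c)\<^sup>2 * (\<Prod>b\<in>?B. normal_density (\<mu> \<bullet> b) ?s (x \<bullet> b)))"
      by (simp only: nrm normal_dens_prod[OF assms] sum_distrib_right)
    also have "\<dots> = (\<Sum>c\<in>?B. \<Prod>b\<in>?B. (if b = c then (d \<bullet> b - x \<bullet> b)\<^sup>2 else 1)
            * normal_density (\<mu> \<bullet> b) ?s (x \<bullet> b))"
      by (intro sum.cong refl) (simp add: prod.distrib inner_diff_left)
    finally show "ennreal ((norm (d - x))\<^sup>2 * normal_dens \<mu> \<tau> x) =
       (\<Sum>c\<in>?B. \<Prod>b\<in>?B. ennreal ((if b = c then (d \<bullet> b - x \<bullet> b)\<^sup>2 else 1)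
            * normal_density (\<mu> \<bullet> b) ?s (x \<bullet> b)))"
      by (simp add: prod_nonneg prod_ennreal)
  qed
  also have "\<dots> = (\<Sum>c\<in>?B. \<integral>\<^sup>+x. (\<Prod>b\<in>?B. ennreal ((if b = c then (d \<bullet> b - x \<bullet> b)\<^sup>2 else 1)
            * normal_density (\<mu> \<bullet> b) ?s (x \<bullet> b))) \<partial>lborel)"
    by (intro nn_integral_sum) measurable
  also have "\<dots> = (\<Sum>c\<in>?B. ennreal ((d \<bullet> c - \<mu> \<bullet> c)\<^sup>2 + 1 / \<tau>))"
  proof (intro sum.cong refl)
    fix c assume c: "c \<in> ?B"
    have "(\<integral>\<^sup>+x. (\<Prod>b\<in>?B. ennreal ((if b = c then (d \<bullet> b - x \<bullet> b)\<^sup>2 else 1)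
            * normal_density (\<mu> \<bullet> b) ?s (x \<bullet> b))) \<partial>lborel)
        = (\<Prod>b\<in>?B. \<integral>\<^sup>+t. ennreal ((if b = c then (d \<bullet> b - t)\<^sup>2 else 1)
            * normal_density (\<mu> \<bullet> b) ?s t) \<partial>lborel)"
      by (rule nn_integral_lborel_prod[where f = "\<lambda>b t. ennreal ((if b = c then (d \<bullet> b - t)\<^sup>2 else 1)
            * normal_density (\<mu> \<bullet> b) ?s t)"]) auto
    also have "\<dots> = (\<Prod>b\<in>?B. if b = c then ennreal ((d \<bullet> c - \<mu> \<bullet> c)\<^sup>2 + 1 / \<tau>) else 1)"
      using s assms nn_integral_normal_density_sq[OF s] nn_integral_normal_density[OF s]
      by (intro prod.cong refl) (simp add: power_divide)
    also have "\<dots> = ennreal ((d \<bullet> c - \<mu> \<bullet> c)\<^sup>2 + 1 / \<tau>)"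
      using c by simp
    finally show "(\<integral>\<^sup>+x. (\<Prod>b\<in>?B. ennreal ((if b = c then (d \<bullet> b - x \<bullet> b)\<^sup>2 else 1)
            * normal_density (\<mu> \<bullet> b) ?s (x \<bullet> b))) \<partial>lborel) = ennreal ((d \<bullet> c - \<mu> \<bullet> c)\<^sup>2 + 1 / \<tau>)" .
  qed
  also have "\<dots> = ennreal (\<Sum>c\<in>?B. (d \<bullet> c - \<mu> \<bullet> c)\<^sup>2 + 1 / \<tau>)"
    using assms by (intro sum_ennreal) auto
  also have "(\<Sum>c\<in>?B. (d \<bullet> c - \<mu> \<bullet> c)\<^sup>2 + 1 / \<tau>) = (norm (d - \<mu>))\<^sup>2 + real CARD('p) / \<tau>"
    by (simp add: nrm sum.distrib inner_diff_left)
  finally show ?thesis .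
qed

lemma integrable_normal_dens:
  fixes \<mu> :: "real ^ 'p::finite"
  assumes "0 < \<tau>"
  shows "integrable lborel (normal_dens \<mu> \<tau>)" "integral\<^sup>L lborel (normal_dens \<mu> \<tau>) = 1"
proof -
  have "has_bochner_integral lborel (normal_dens \<mu> \<tau>) 1"
    using nn_integral_normal_dens[OF assms, of \<mu>]
    by (intro has_bochner_integral_nn_integral) (auto intro: normal_dens_measurable)
  then show "integrable lborel (normal_dens \<mu> \<tau>)" "integral\<^sup>L lborel (normal_dens \<mu> \<tau>) = 1"
    by (auto simp: has_bochner_integral_iff)
qed

lemma has_bochner_integral_normal_dens_sq:
  fixes \<mu> d :: "real ^ 'p::finite"
  assumes "0 < \<tau>"
  shows "has_bochner_integral lborel (\<lambda>x. (norm (d - x))\<^sup>2 * normal_dens \<mu> \<tau> x)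
     ((norm (d - \<mu>))\<^sup>2 + real CARD('p) / \<tau>)"
  using nn_integral_normal_dens_sq[OF assms, of d \<mu>] assms
  by (intro has_bochner_integral_nn_integral) auto

text \<open>Polarisation, \<open>2 (x \<bullet> v) = |x|\<^sup>2 + |v|\<^sup>2 - |v - x|\<^sup>2\<close>, reduces the mean to the second moments
  about \<open>0\<close> and about \<open>v\<close>.\<close>

lemma has_bochner_integral_normal_dens_inner:
  fixes \<mu> v :: "real ^ 'p::finite"
  assumes "0 < \<tau>"
  shows "has_bochner_integral lborel (\<lambda>x. (x \<bullet> v) * normal_dens \<mu> \<tau> x) (\<mu> \<bullet> v)"
proof -
  have 0: "has_bochner_integral lborel (normal_dens \<mu> \<tau>) 1"
    using integrable_normal_dens[OF assms, of \<mu>] by (simp add: has_bochner_integral_iff)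
  have "has_bochner_integral lborel
     (\<lambda>x. 1/2 * ((norm (0 - x))\<^sup>2 * normal_dens \<mu> \<tau> x + (norm v)\<^sup>2 * normal_dens \<mu> \<tau> x
            - (norm (v - x))\<^sup>2 * normal_dens \<mu> \<tau> x))
     (1/2 * (((norm (0 - \<mu>))\<^sup>2 + real CARD('p) / \<tau>) + (norm v)\<^sup>2 * 1
            - ((norm (v - \<mu>))\<^sup>2 + real CARD('p) / \<tau>)))"
    by (intro has_bochner_integral_mult_right has_bochner_integral_add has_bochner_integral_diff
       has_bochner_integral_normal_dens_sq 0 assms)
  moreover have "1/2 * ((norm (0 - x))\<^sup>2 * N + (norm v)\<^sup>2 * N - (norm (v - x))\<^sup>2 * N) = (x \<bullet> v) * N"
    for x :: "real ^ 'p" and N :: real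
    unfolding power2_norm_eq_inner by (simp add: inner_diff inner_commute algebra_simps)
  moreover have "1/2 * (((norm (0 - \<mu>))\<^sup>2 + real CARD('p) / \<tau>) + (norm v)\<^sup>2 * 1
            - ((norm (v - \<mu>))\<^sup>2 + real CARD('p) / \<tau>)) = \<mu> \<bullet> v"
    unfolding power2_norm_eq_inner by (simp add: inner_diff inner_commute algebra_simps)
  ultimately show ?thesis by simp
qed

lemma norm_le_one_plus_square: "norm x \<le> 1 + (norm x)\<^sup>2" for x :: "'a::real_normed_vector"
proof -
  have "0 \<le> (norm x - 1)\<^sup>2" "0 \<le> norm x" by auto
  then have "2 * norm x \<le> 1 + (norm x)\<^sup>2" by (simp add: power2_diff)
  with \<open>0 \<le> norm x\<close> show ?thesis by linarith
qed

lemma normal_mean: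
  fixes \<mu> :: "real ^ 'p::finite"
  assumes "0 < \<tau>"
  shows "integral\<^sup>L lborel (\<lambda>x. normal_dens \<mu> \<tau> x *\<^sub>R x) = \<mu>"
proof -
  have i: "integrable lborel (\<lambda>x. normal_dens \<mu> \<tau> x *\<^sub>R x)"
  proof (rule Bochner_Integration.integrable_bound)
    show "integrable lborel (\<lambda>x. normal_dens \<mu> \<tau> x + (norm (0 - x))\<^sup>2 * normal_dens \<mu> \<tau> x)"
      using integrable_normal_dens(1)[OF assms, of \<mu>] has_bochner_integral_normal_dens_sq[OF assms, of 0 \<mu>]
      by (auto simp: has_bochner_integral_iff)
    show "AE x in lborel. norm (normal_dens \<mu> \<tau> x *\<^sub>R x)
        \<le> norm (normal_dens \<mu> \<tau> x + (norm (0 - x))\<^sup>2 * normal_dens \<mu> \<tau> x)"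
    proof (intro AE_I2)
      fix x :: "real ^ 'p"
      have "normal_dens \<mu> \<tau> x * norm x \<le> normal_dens \<mu> \<tau> x * (1 + (norm x)\<^sup>2)"
        by (intro mult_left_mono norm_le_one_plus_square) simp
      then show "norm (normal_dens \<mu> \<tau> x *\<^sub>R x)
        \<le> norm (normal_dens \<mu> \<tau> x + (norm (0 - x))\<^sup>2 * normal_dens \<mu> \<tau> x)"
        by (simp add: algebra_simps)
    qed
  qed measurable
  have "integral\<^sup>L lborel (\<lambda>x. normal_dens \<mu> \<tau> x *\<^sub>R x) \<bullet> v = \<mu> \<bullet> v" for v
  proof -
    have "integral\<^sup>L lborel (\<lambda>x. normal_dens \<mu> \<tau> x *\<^sub>R x) \<bullet> v
        = integral\<^sup>L lborel (\<lambda>x. (normal_dens \<mu> \<tau> x *\<^sub>R x) \<bullet> v)"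
      by (subst integral_inner_left) (use i in auto)
    also have "\<dots> = integral\<^sup>L lborel (\<lambda>x. (x \<bullet> v) * normal_dens \<mu> \<tau> x)"
      by (intro Bochner_Integration.integral_cong) (auto simp: mult.commute)
    also have "\<dots> = \<mu> \<bullet> v"
      using has_bochner_integral_normal_dens_inner[OF assms, where \<mu> = \<mu> and v = v] by (simp add: has_bochner_integral_iff)
    finally show ?thesis .
  qed
  then show ?thesis by (metis vector_eq_rdot)
qed

text \<open>Completing the square: prior times likelihood equals marginal times posterior.\<close>

lemma normal_dens_times_normal_dens:
  fixes x \<theta> :: "real ^ 'p::finite"
  assumes "0 < \<alpha>" "0 < \<beta>"
  shows "normal_dens \<theta> \<beta> x * normal_dens 0 \<alpha> \<theta>
    = normal_dens 0 (\<alpha> * \<beta> / (\<alpha> + \<beta>)) x * normal_dens ((\<beta> / (\<alpha> + \<beta>)) *\<^sub>R x) (\<alpha> + \<beta>) \<theta>"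
proof -
  let ?p = "real CARD('p) / 2"
  define c where "c = \<alpha> + \<beta>"
  have c: "0 < c" "c \<noteq> 0" using assms by (auto simp: c_def)
  have e: "\<beta> * (norm (x - \<theta>))\<^sup>2 + \<alpha> * (norm (\<theta> - 0))\<^sup>2
      = (\<alpha> * \<beta> / c) * (norm (x - 0))\<^sup>2 + c * (norm (\<theta> - (\<beta> / c) *\<^sub>R x))\<^sup>2"
  proof -
    have "c * (\<beta> * (x \<bullet> x - 2 * (x \<bullet> \<theta>) + \<theta> \<bullet> \<theta>) + \<alpha> * (\<theta> \<bullet> \<theta>))
      = \<alpha> * \<beta> * (x \<bullet> x) + (c * c * (\<theta> \<bullet> \<theta>) - 2 * \<beta> * c * (x \<bullet> \<theta>) + \<beta> * \<beta> * (x \<bullet> x))"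
      unfolding c_def by algebra
    then have "\<beta> * (x \<bullet> x - 2 * (x \<bullet> \<theta>) + \<theta> \<bullet> \<theta>) + \<alpha> * (\<theta> \<bullet> \<theta>)
      = (\<alpha> * \<beta> / c) * (x \<bullet> x) + c * (\<theta> \<bullet> \<theta> - 2 * (\<beta> / c) * (x \<bullet> \<theta>) + (\<beta> / c) * (\<beta> / c) * (x \<bullet> x))"
      using c by (simp add: field_simps)
    then show ?thesis
      unfolding power2_norm_eq_inner
      by (simp add: inner_diff_left inner_diff_right inner_commute algebra_simps)
  qed
  have "exp (- (\<beta> / 2) * (norm (x - \<theta>))\<^sup>2) * exp (- (\<alpha> / 2) * (norm (\<theta> - 0))\<^sup>2)
     = exp (- (1/2) * (\<beta> * (norm (x - \<theta>))\<^sup>2 + \<alpha> * (norm (\<theta> - 0))\<^sup>2))"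
    by (subst mult_exp_exp) (simp add: algebra_simps)
  also have "\<dots> = exp (- (\<alpha> * \<beta> / c / 2) * (norm (x - 0))\<^sup>2) * exp (- (c / 2) * (norm (\<theta> - (\<beta> / c) *\<^sub>R x))\<^sup>2)"
    unfolding e by (subst mult_exp_exp) (simp add: algebra_simps)
  finally have E: "exp (- (\<beta> / 2) * (norm (x - \<theta>))\<^sup>2) * exp (- (\<alpha> / 2) * (norm (\<theta> - 0))\<^sup>2)
     = exp (- (\<alpha> * \<beta> / c / 2) * (norm (x - 0))\<^sup>2) * exp (- (c / 2) * (norm (\<theta> - (\<beta> / c) *\<^sub>R x))\<^sup>2)" .
  have P: "\<beta> powr ?p * \<alpha> powr ?p = (\<alpha> * \<beta> / c) powr ?p * c powr ?p"
    using assms c by (simp add: powr_mult powr_divide)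
  have "(B / K * E1) * (A / K * E2) = (B * A) * (E1 * E2) / (K * K)"
    and "(G / K * E1) * (D / K * E2) = (G * D) * (E1 * E2) / (K * K)" for A B G D K E1 E2 :: real
    by simp_all
  note rearrange = this
  show ?thesis
    unfolding normal_dens_def c_def[symmetric] rearrange E P ..
qed

section \<open>Gamma integrals and the scaled chi-square law\<close>

lemma nn_integral_gamma:
  assumes "0 < k" "0 < q"
  shows "(\<integral>\<^sup>+t. ennreal (indicator {0<..} t * (t powr (k - 1) * exp (- (q * t)))) \<partial>lborel)
    = ennreal (Gamma k / q powr k)"
proof -
  let ?f = "\<lambda>t::real. indicator {0<..} t * (t powr (k - 1) * exp (- t))"
  have g: "(\<integral>\<^sup>+t. ennreal (?f t) \<partial>lborel) = ennreal (Gamma k)"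
    unfolding Gamma_conv_nn_integral_real[OF assms(1)]
    by (intro nn_integral_cong) (auto simp: indicator_def exp_minus field_simps)
  have "ennreal (Gamma k) = ennreal q * (\<integral>\<^sup>+t. ennreal (?f (0 + q * t)) \<partial>lborel)"
    unfolding g[symmetric] using assms by (subst nn_integral_real_affine[where c = q and t = 0]) auto
  also have "(\<integral>\<^sup>+t. ennreal (?f (0 + q * t)) \<partial>lborel)
     = (\<integral>\<^sup>+t. ennreal (q powr (k - 1)) * ennreal (indicator {0<..} t * (t powr (k - 1) * exp (- (q * t)))) \<partial>lborel)"
    using assms
    by (intro nn_integral_cong)
       (auto simp: indicator_def powr_mult zero_less_mult_iff ennreal_mult[symmetric])
  also have "\<dots> = ennreal (q powr (k - 1)) * (\<integral>\<^sup>+t. ennreal (indicator {0<..} t * (t powr (k - 1) * exp (- (q * t)))) \<partial>lborel)"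
    by (rule nn_integral_cmult) measurable
  also have "ennreal q * (ennreal (q powr (k - 1)) * X) = ennreal (q powr k) * X" for X
  proof -
    have "q * q powr (k - 1) = q powr k" using assms powr_mult_base[of q "k - 1"] by simp
    then have "ennreal q * ennreal (q powr (k - 1)) = ennreal (q powr k)"
      using assms by (metis ennreal_mult less_imp_le powr_ge_zero)
    then show ?thesis by (simp add: mult.assoc[symmetric])
  qed
  finally have "ennreal (q powr k) * (\<integral>\<^sup>+t. ennreal (indicator {0<..} t * (t powr (k - 1) * exp (- (q * t)))) \<partial>lborel)
     = ennreal (Gamma k)" by simp
  then have "ennreal (1 / q powr k) * (ennreal (q powr k) * (\<integral>\<^sup>+t. ennreal (indicator {0<..} t * (t powr (k - 1) * exp (- (q * t)))) \<partial>lborel))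
     = ennreal (1 / q powr k) * ennreal (Gamma k)" by simp
  moreover have "ennreal (1 / q powr k) * (ennreal (q powr k) * X) = X" for X
    using assms by (simp add: mult.assoc[symmetric] ennreal_mult[symmetric])
  ultimately show ?thesis using assms by (simp add: ennreal_mult[symmetric])
qed

lemma has_bochner_integral_gamma:
  fixes k q :: real
  assumes "0 < k" "0 < q"
  shows "has_bochner_integral lborel
     (\<lambda>t. indicator {0<..} t * (t powr (k - 1) * exp (- (q * t)))) (Gamma k / q powr k)"
  using nn_integral_gamma[OF assms] assms Gamma_real_pos[of k]
  by (intro has_bochner_integral_nn_integral) (auto simp: indicator_def)

text \<open>The density extended by \<open>0\<close> to the whole line: for negative \<open>s\<close> the factor \<open>s powr c\<close> need not
  vanish.\<close>

definition chi :: "nat \<Rightarrow> real \<Rightarrow> real \<Rightarrow> real" where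
  "chi n \<eta> s = indicator {0<..} s * scaled_chisq_dens n \<eta> s"

lemma chi_measurable [measurable]:
  assumes [measurable]: "f \<in> borel_measurable M" "g \<in> borel_measurable M"
  shows "(\<lambda>z. chi n (f z) (g z)) \<in> borel_measurable M"
  unfolding chi_def by measurable

lemma scaled_chisq_dens_nonneg [simp]: "0 < n \<Longrightarrow> 0 \<le> scaled_chisq_dens n \<eta> s"
  unfolding scaled_chisq_dens_def by (simp add: Gamma_real_pos less_imp_le)

lemma chi_nonneg [simp]: "0 < n \<Longrightarrow> 0 \<le> chi n \<eta> s"
  by (simp add: chi_def)

lemma chi_moment:
  assumes "0 < n" "0 < \<eta>" "0 \<le> j"
  shows "has_bochner_integral lborel (\<lambda>s. s powr j * chi n \<eta> s)
     (Gamma (n / 2 + j) * 2 powr j / (Gamma (n / 2) * \<eta> powr j))"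
proof -
  let ?c = "\<eta> powr (real n / 2) / (Gamma (real n / 2) * 2 powr (real n / 2))"
  have G: "Gamma (real n / 2) > 0" using assms by (simp add: Gamma_real_pos)
  have "has_bochner_integral lborel
     (\<lambda>s. ?c * (indicator {0<..} s * (s powr ((n / 2 + j) - 1) * exp (- (\<eta> / 2 * s)))))
     (?c * (Gamma (n / 2 + j) / (\<eta> / 2) powr (n / 2 + j)))"
    using assms by (intro has_bochner_integral_mult_right has_bochner_integral_gamma) auto
  moreover have "?c * (indicator {0<..} s * (s powr ((n / 2 + j) - 1) * exp (- (\<eta> / 2 * s))))
     = s powr j * chi n \<eta> s" for s :: real
    using powr_add[of s j "n / 2 - 1"]
    by (simp add: chi_def scaled_chisq_dens_def indicator_def add.commute add_diff_eq)
  moreover have "?c * (Gamma (n / 2 + j) / (\<eta> / 2) powr (n / 2 + j))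
      = Gamma (n / 2 + j) * 2 powr j / (Gamma (n / 2) * \<eta> powr j)"
    using assms G by (simp add: powr_divide powr_add)
  ultimately show ?thesis by simp
qed

lemma chi_integral:
  assumes "0 < n" "0 < \<eta>"
  shows "has_bochner_integral lborel (chi n \<eta>) 1"
proof -
  have "(\<lambda>s. s powr 0 * chi n \<eta> s) = chi n \<eta>" by (auto simp: chi_def indicator_def)
  moreover have "0 < Gamma (real n / 2)" using assms by (simp add: Gamma_real_pos)
  then have "Gamma (real n / 2) \<noteq> 0" by (rule less_imp_neq[THEN not_sym])
  ultimately show ?thesis using chi_moment[OF assms, of 0] assms by simp
qed

lemma nn_integral_chi: "0 < n \<Longrightarrow> 0 < \<eta> \<Longrightarrow> (\<integral>\<^sup>+s. ennreal (chi n \<eta> s) \<partial>lborel) = 1"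
  using chi_integral[of n \<eta>] by (simp add: nn_integral_eq_integral has_bochner_integral_iff)

text \<open>Equivalent to \<open>\<eta> E[S\<^sup>2] = (n + 2) E[S]\<close>.\<close>

lemma chi_moment_identity:
  assumes "0 < n" "0 < \<eta>"
  shows "has_bochner_integral lborel (\<lambda>s::real. (\<eta> * s\<^sup>2 - (real n + 2) * s) * chi n \<eta> s) 0"
proof -
  have p: "s powr 2 * chi n \<eta> s = s\<^sup>2 * chi n \<eta> s" "s powr 1 * chi n \<eta> s = s * chi n \<eta> s" for s
    by (auto simp: chi_def indicator_def powr_numeral)
  have gp: "Gamma (x + 1) = x * Gamma x" if "0 < x" for x :: real
    using that by (intro Gamma_plus1) (auto dest: nonpos_Ints_nonpos)
  have G1: "Gamma (real n / 2 + 1) = (n / 2) * Gamma (real n / 2)"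
    using assms by (intro gp) simp
  have "Gamma (real n / 2 + 1 + 1) = (n / 2 + 1) * Gamma (real n / 2 + 1)"
    using assms by (intro gp) simp
  then have G2: "Gamma (real n / 2 + 2) = (n / 2 + 1) * ((n / 2) * Gamma (real n / 2))"
    unfolding G1 by (simp add: add.assoc)
  have P: "Gamma (real n / 2) > 0" using assms by (simp add: Gamma_real_pos)
  have "has_bochner_integral lborel (\<lambda>s. \<eta> * (s powr 2 * chi n \<eta> s) - (real n + 2) * (s powr 1 * chi n \<eta> s))
    (\<eta> * (Gamma (n / 2 + 2) * 2 powr 2 / (Gamma (n / 2) * \<eta> powr 2))
     - (real n + 2) * (Gamma (n / 2 + 1) * 2 powr 1 / (Gamma (n / 2) * \<eta> powr 1)))"
    using assms by (intro has_bochner_integral_diff has_bochner_integral_mult_right chi_moment) auto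
  moreover have "\<eta> * (Gamma (n / 2 + 2) * 2 powr 2 / (Gamma (n / 2) * \<eta> powr 2))
     - (real n + 2) * (Gamma (n / 2 + 1) * 2 powr 1 / (Gamma (n / 2) * \<eta> powr 1)) = 0"
    using assms P unfolding G1 G2 by (simp add: powr_numeral field_simps power2_eq_square)
  ultimately show ?thesis unfolding p by (simp add: algebra_simps)
qed

text \<open>The factor \<open>\<eta> s\<^sup>2 - (n + 2) s\<close> has integral \<open>0\<close> and changes sign once, from negative to positive, at
  \<open>s = (n + 2) / \<eta>\<close>. Replacing \<open>u s\<close> by its value at that point can therefore only increase the
  integral. For differentiable \<open>u\<close> the same follows from the chi-square identity
  \<open>E[\<eta> S h(S)] = E[n h(S) + 2 S h'(S)]\<close>.\<close>

lemma chi_antimono_inequality: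
  assumes "0 < n" "0 < \<eta>"
    and anti: "\<And>s t. 0 < s \<Longrightarrow> s \<le> t \<Longrightarrow> u t \<le> u s"
    and int: "integrable lborel (\<lambda>s. u s * ((\<eta> * s\<^sup>2 - (real n + 2) * s) * chi n \<eta> s))"
  shows "(LBINT s. u s * ((\<eta> * s\<^sup>2 - (real n + 2) * s) * chi n \<eta> s)) \<le> 0"
proof -
  let ?m = "\<lambda>s::real. (\<eta> * s\<^sup>2 - (real n + 2) * s) * chi n \<eta> s"
  let ?t = "(real n + 2) / \<eta>"
  have m: "has_bochner_integral lborel ?m 0" by (rule chi_moment_identity[OF assms(1,2)])
  have t: "0 < ?t" using assms by simp
  have "u s * ?m s \<le> u ?t * ?m s" for s
  proof (cases "0 < s")
    case s: True
    have eq: "?m s = (\<eta> * s * chi n \<eta> s) * (s - ?t)"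
      using assms by (simp add: field_simps power2_eq_square)
    have pos: "0 \<le> \<eta> * s * chi n \<eta> s" using assms s by simp
    have "0 \<le> (u ?t - u s) * (s - ?t)"
    proof (cases "s \<le> ?t")
      case True
      then show ?thesis using anti[OF s True] by (intro mult_nonpos_nonpos) auto
    next
      case False
      then show ?thesis using anti[OF t, of s] by (intro mult_nonneg_nonneg) auto
    qed
    then have "0 \<le> (\<eta> * s * chi n \<eta> s) * ((u ?t - u s) * (s - ?t))" using pos by (rule mult_nonneg_nonneg[rotated])
    then show ?thesis unfolding eq by (simp add: algebra_simps)
  qed (simp add: chi_def)
  then have "(LBINT s. u s * ?m s) \<le> (LBINT s. u ?t * ?m s)"
    using int m by (intro integral_mono) (auto simp: has_bochner_integral_iff)
  also have "\<dots> = u ?t * (LBINT s. ?m s)" by (rule integral_mult_right_zero)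
  also have "\<dots> = 0" using m by (simp add: has_bochner_integral_iff)
  finally show ?thesis .
qed

section \<open>Risk as a Lebesgue integral\<close>

lemma nn_integral_sample_law:
  fixes f :: "(real ^ 'p::finite) \<times> real \<Rightarrow> ennreal"
  assumes n: "0 < n" and \<eta>: "0 < \<eta>" and [measurable]: "f \<in> borel_measurable borel"
  shows "(\<integral>\<^sup>+z. f z \<partial>sample_law n \<theta> \<eta>)
    = (\<integral>\<^sup>+z. f z * ennreal (normal_dens \<theta> \<eta> (fst z) * chi n \<eta> (snd z)) \<partial>lborel)"
proof -
  let ?R = "restrict_space lborel {0<..} :: real measure"
  let ?S = "density ?R (\<lambda>s. ennreal (scaled_chisq_dens n \<eta> s))"
  let ?X = "density lborel (\<lambda>x. ennreal (normal_dens \<theta> \<eta> x))"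
  have m[measurable]: "(\<lambda>s. ennreal (scaled_chisq_dens n \<eta> s)) \<in> borel_measurable ?R"
    by (rule measurable_restrict_space1) measurable
  have S: "(\<integral>\<^sup>+s. g s \<partial>?S) = (\<integral>\<^sup>+s. g s * ennreal (chi n \<eta> s) \<partial>lborel)"
    if [measurable]: "g \<in> borel_measurable borel" for g
  proof -
    have "(\<integral>\<^sup>+s. g s \<partial>?S) = (\<integral>\<^sup>+s. ennreal (scaled_chisq_dens n \<eta> s) * g s \<partial>?R)"
      by (rule nn_integral_density) (auto intro!: measurable_restrict_space1)
    also have "\<dots> = (\<integral>\<^sup>+s. ennreal (scaled_chisq_dens n \<eta> s) * g s * indicator {0<..} s \<partial>lborel)"
      by (rule nn_integral_restrict_space) simp
    also have "\<dots> = (\<integral>\<^sup>+s. g s * ennreal (chi n \<eta> s) \<partial>lborel)"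
      by (intro nn_integral_cong) (auto simp: chi_def indicator_def mult.commute)
    finally show ?thesis .
  qed
  interpret S: prob_space ?S
  proof
    have "emeasure ?S (space ?S) = (\<integral>\<^sup>+s. 1 \<partial>?S)" by simp
    also have "\<dots> = 1" using nn_integral_chi[OF n \<eta>] by (subst S) auto
    finally show "emeasure ?S (space ?S) = 1" .
  qed
  have ident: "(\<lambda>z. z) \<in> ?X \<Otimes>\<^sub>M ?S \<rightarrow>\<^sub>M borel \<Otimes>\<^sub>M borel"
  proof -
    have "snd \<in> ?X \<Otimes>\<^sub>M ?S \<rightarrow>\<^sub>M borel"
    proof (rule measurable_compose[OF measurable_snd])
      show "(\<lambda>x. x) \<in> borel_measurable ?S"
        by (simp add: measurable_restrict_space1)
    qed
    moreover have "fst \<in> ?X \<Otimes>\<^sub>M ?S \<rightarrow>\<^sub>M borel"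
      by (rule measurable_compose[OF measurable_fst]) simp
    ultimately have "(\<lambda>z. (fst z, snd z)) \<in> ?X \<Otimes>\<^sub>M ?S \<rightarrow>\<^sub>M borel \<Otimes>\<^sub>M borel"
      by (intro measurable_Pair) (auto simp: comp_def)
    then show ?thesis by simp
  qed
  have fb[measurable]: "f \<in> borel_measurable (borel \<Otimes>\<^sub>M borel)" by (simp add: borel_prod)
  have "(\<integral>\<^sup>+z. f z \<partial>sample_law n \<theta> \<eta>) = (\<integral>\<^sup>+x. \<integral>\<^sup>+s. f (x, s) \<partial>?S \<partial>?X)"
    unfolding sample_law_def
    by (rule S.nn_integral_fst[symmetric]) (use measurable_compose[OF ident fb] in simp)
  also have "\<dots> = (\<integral>\<^sup>+x. \<integral>\<^sup>+s. f (x, s) * ennreal (chi n \<eta> s) \<partial>lborel \<partial>?X)"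
    by (intro nn_integral_cong S) measurable
  also have "\<dots> = (\<integral>\<^sup>+x. ennreal (normal_dens \<theta> \<eta> x) * (\<integral>\<^sup>+s. f (x, s) * ennreal (chi n \<eta> s) \<partial>lborel) \<partial>lborel)"
    by (rule nn_integral_density) measurable
  also have "\<dots> = (\<integral>\<^sup>+x. \<integral>\<^sup>+s. f (x, s) * ennreal (normal_dens \<theta> \<eta> x * chi n \<eta> s) \<partial>lborel \<partial>lborel)"
    using n by (intro nn_integral_cong, subst nn_integral_cmult[symmetric])
      (auto simp: ennreal_mult mult_ac)
  also have "\<dots> = (\<integral>\<^sup>+z. f z * ennreal (normal_dens \<theta> \<eta> (fst z) * chi n \<eta> (snd z)) \<partial>(lborel \<Otimes>\<^sub>M lborel))"
    by (subst lborel.nn_integral_fst[symmetric]) auto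
  finally show ?thesis by (simp only: lborel_prod)
qed

lemma risk_eq:
  fixes \<delta> :: "(real ^ 'p::finite) \<times> real \<Rightarrow> real ^ 'p"
  assumes n: "0 < n" and \<eta>: "0 < \<eta>" and [measurable]: "\<delta> \<in> borel_measurable borel"
  shows "risk n \<delta> \<theta> \<eta>
    = (\<integral>\<^sup>+z. ennreal (\<eta> * (norm (\<delta> z - \<theta>))\<^sup>2 * (normal_dens \<theta> \<eta> (fst z) * chi n \<eta> (snd z))) \<partial>lborel)"
  unfolding risk_def using assms
  by (subst nn_integral_sample_law) (auto simp: ennreal_mult)

lemma nn_integral_lborel_pair:
  fixes f :: "'a::euclidean_space \<times> 'b::euclidean_space \<Rightarrow> ennreal"
  assumes "f \<in> borel_measurable borel"
  shows "(\<integral>\<^sup>+z. f z \<partial>lborel) = (\<integral>\<^sup>+x. \<integral>\<^sup>+y. f (x, y) \<partial>lborel \<partial>lborel)"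
    and "(\<integral>\<^sup>+z. f z \<partial>lborel) = (\<integral>\<^sup>+y. \<integral>\<^sup>+x. f (x, y) \<partial>lborel \<partial>lborel)"
proof -
  have m: "f \<in> borel_measurable (lborel \<Otimes>\<^sub>M lborel)" using assms by (simp add: lborel_prod)
  show "(\<integral>\<^sup>+z. f z \<partial>lborel) = (\<integral>\<^sup>+x. \<integral>\<^sup>+y. f (x, y) \<partial>lborel \<partial>lborel)"
    unfolding lborel_prod[symmetric] by (rule lborel.nn_integral_fst[symmetric]) fact
  show "(\<integral>\<^sup>+z. f z \<partial>lborel) = (\<integral>\<^sup>+y. \<integral>\<^sup>+x. f (x, y) \<partial>lborel \<partial>lborel)"
    unfolding lborel_prod[symmetric] by (rule lborel_pair.nn_integral_snd[symmetric]) fact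
qed

lemma integrable_lborel_pair_mult:
  fixes f :: "'a::euclidean_space \<Rightarrow> real" and g :: "'b::euclidean_space \<Rightarrow> real"
  assumes f: "integrable lborel f" and g: "integrable lborel g"
  shows "integrable lborel (\<lambda>z. f (fst z) * g (snd z))"
    and "integral\<^sup>L lborel (\<lambda>z. f (fst z) * g (snd z)) = integral\<^sup>L lborel f * integral\<^sup>L lborel g"
proof -
  have [measurable]: "f \<in> borel_measurable borel" "g \<in> borel_measurable borel"
    using borel_measurable_integrable[OF f] borel_measurable_integrable[OF g] by simp_all
  have i: "integrable (lborel \<Otimes>\<^sub>M lborel) (\<lambda>z. f (fst z) * g (snd z))"
  proof (rule lborel_pair.Fubini_integrable)
    have "integrable lborel (\<lambda>x. \<bar>f x\<bar> * (LBINT y. \<bar>g y\<bar>))" using f by (intro integrable_mult_left) auto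
    then show "integrable lborel (\<lambda>x. LBINT y. norm (f (fst (x, y)) * g (snd (x, y))))"
      by (simp add: abs_mult)
  qed (use g in auto)
  then show "integrable lborel (\<lambda>z. f (fst z) * g (snd z))" by (simp add: lborel_prod)
  have "integral\<^sup>L (lborel \<Otimes>\<^sub>M lborel) (\<lambda>z. f (fst z) * g (snd z)) = (LBINT x. LBINT y. f x * g y)"
    using lborel_pair.integral_fst'[OF i] by simp
  then show "integral\<^sup>L lborel (\<lambda>z. f (fst z) * g (snd z)) = integral\<^sup>L lborel f * integral\<^sup>L lborel g"
    by (simp add: lborel_prod)
qed

lemma space_sample_law: "space (sample_law n \<theta> \<eta> :: ((real ^ 'p::finite) \<times> real) measure) = UNIV \<times> {0<..}"
  by (simp add: sample_law_def space_pair_measure)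

lemma risk_cong:
  "(\<And>x s. 0 < s \<Longrightarrow> \<delta> (x, s) = \<delta>' (x, s)) \<Longrightarrow> risk n \<delta> = risk n \<delta>'"
  unfolding risk_def by (intro ext nn_integral_cong) (auto simp: space_sample_law)

lemma estimator_cong:
  assumes "\<And>x s. 0 < s \<Longrightarrow> \<delta> (x, s) = \<delta>' (x, s)"
  shows "estimator \<delta> \<longleftrightarrow> estimator \<delta>'"
  unfolding estimator_def
  by (rule measurable_cong) (use assms in \<open>auto simp: space_pair_measure\<close>)

lemma estimator_borel:
  assumes "\<delta> \<in> borel_measurable borel"
  shows "estimator \<delta>"
proof -
  have "(\<lambda>z. (fst z, snd z)) \<in> (borel :: (real ^ 'p::finite) measure) \<Otimes>\<^sub>M restrict_space borel {0<..} \<rightarrow>\<^sub>M (borel \<Otimes>\<^sub>M (borel :: real measure))"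
  proof (rule measurable_Pair)
    show "(\<lambda>z. snd z) \<in> (borel :: (real ^ 'p) measure) \<Otimes>\<^sub>M restrict_space borel {0<..} \<rightarrow>\<^sub>M (borel :: real measure)"
      by (rule measurable_compose[OF measurable_snd]) (simp add: measurable_restrict_space1)
  qed measurable
  from measurable_compose[OF this, of \<delta> borel] assms show ?thesis
    by (simp add: estimator_def borel_prod)
qed

text \<open>Estimators are only constrained on the sample space. Redefining them for \<open>s \<le> 0\<close> by their value
  at \<open>s = 1\<close> gives a Borel function on the whole product.\<close>

lemma estimator_borel_version:
  fixes \<delta> :: "(real ^ 'p::finite) \<times> real \<Rightarrow> real ^ 'p"
  assumes "estimator \<delta>"
  obtains \<delta>' where "\<delta>' \<in> borel_measurable borel" "\<And>x s. 0 < s \<Longrightarrow> \<delta> (x, s) = \<delta>' (x, s)"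
proof
  let ?r = "\<lambda>z::(real ^ 'p) \<times> real. (fst z, if 0 < snd z then snd z else 1)"
  have "?r \<in> borel \<Otimes>\<^sub>M borel \<rightarrow>\<^sub>M borel \<Otimes>\<^sub>M restrict_space borel {0<..}"
    by (intro measurable_Pair measurable_restrict_space2) auto
  from measurable_compose[OF this assms[unfolded estimator_def]]
  show "(\<lambda>z. \<delta> (?r z)) \<in> borel_measurable borel" by (simp add: borel_prod)
qed auto

section \<open>Every estimator has worst-case risk at least the dimension\<close>

lemma nn_integral_sample_law_mass:
  fixes \<theta> :: "real ^ 'p::finite"
  assumes "0 < n" "0 < \<eta>" "0 < \<tau>"
  shows "(\<integral>\<^sup>+z. ennreal (normal_dens \<theta> \<tau> (fst z) * chi n \<eta> (snd z)) \<partial>lborel) = 1"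
proof -
  have "(\<integral>\<^sup>+z. ennreal (normal_dens \<theta> \<tau> (fst z) * chi n \<eta> (snd z)) \<partial>lborel)
     = (\<integral>\<^sup>+x. \<integral>\<^sup>+s. ennreal (normal_dens \<theta> \<tau> x) * ennreal (chi n \<eta> s) \<partial>lborel \<partial>lborel)"
    using assms by (subst nn_integral_lborel_pair(1)) (auto simp: ennreal_mult)
  also have "\<dots> = 1"
    using assms by (simp add: nn_integral_cmult nn_integral_chi nn_integral_normal_dens)
  finally show ?thesis .
qed

text \<open>With \<open>\<eta> = 1\<close> known, \<open>S\<close> is uninformative, and the prior \<open>N(0, I/t)\<close> leaves a posterior of precision
  \<open>1 + t\<close>, whose total variance \<open>p / (1 + t)\<close> bounds the posterior expected loss of any decision.\<close>

lemma bayes_risk_lower_bound: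
  fixes \<delta> :: "(real ^ 'p::finite) \<times> real \<Rightarrow> real ^ 'p"
  assumes n: "0 < n" and t: "0 < t" and [measurable]: "\<delta> \<in> borel_measurable borel"
  shows "ennreal (CARD('p) / (1 + t)) \<le> sup_risk n \<delta>"
proof -
  let ?k = "t / (t + 1)"
  let ?I = "\<lambda>\<theta> z. ennreal ((norm (\<delta> z - \<theta>))\<^sup>2 * (normal_dens \<theta> 1 (fst z) * chi n 1 (snd z))
      * normal_dens 0 t \<theta>)"
  have k: "0 < ?k" using t by simp
  have "ennreal (CARD('p) / (1 + t))
     = ennreal (CARD('p) / (1 + t)) * (\<integral>\<^sup>+z. ennreal (normal_dens (0::real^'p) ?k (fst z) * chi n 1 (snd z)) \<partial>lborel)"
    using nn_integral_sample_law_mass[OF n, of 1 ?k "0::real^'p"] k by simp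
  also have "\<dots> = (\<integral>\<^sup>+z. ennreal (CARD('p) / (1 + t)) * ennreal (normal_dens (0::real^'p) ?k (fst z) * chi n 1 (snd z)) \<partial>lborel)"
    by (rule nn_integral_cmult[symmetric]) measurable
  also have "\<dots> \<le> (\<integral>\<^sup>+z. (\<integral>\<^sup>+\<theta>. ?I \<theta> z \<partial>lborel) \<partial>lborel)"
  proof (rule nn_integral_mono)
    fix z :: "(real ^ 'p) \<times> real"
    let ?m = "(1 / (t + 1)) *\<^sub>R fst z"
    let ?w = "normal_dens 0 ?k (fst z) * chi n 1 (snd z)"
    have w: "0 \<le> ?w" using n by simp
    have "(\<integral>\<^sup>+\<theta>. ?I \<theta> z \<partial>lborel)
       = (\<integral>\<^sup>+\<theta>. ennreal ?w * ennreal ((norm (\<delta> z - \<theta>))\<^sup>2 * normal_dens ?m (t + 1) \<theta>) \<partial>lborel)"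
    proof (rule nn_integral_cong)
      fix \<theta> :: "real ^ 'p"
      have "(norm (\<delta> z - \<theta>))\<^sup>2 * (normal_dens \<theta> 1 (fst z) * chi n 1 (snd z)) * normal_dens 0 t \<theta>
        = (norm (\<delta> z - \<theta>))\<^sup>2 * chi n 1 (snd z) * (normal_dens \<theta> 1 (fst z) * normal_dens 0 t \<theta>)"
        by simp
      also have "normal_dens \<theta> 1 (fst z) * normal_dens 0 t \<theta> = normal_dens 0 ?k (fst z) * normal_dens ?m (t + 1) \<theta>"
        using normal_dens_times_normal_dens[OF t, of 1 \<theta> "fst z"] by simp
      finally have e: "(norm (\<delta> z - \<theta>))\<^sup>2 * (normal_dens \<theta> 1 (fst z) * chi n 1 (snd z)) * normal_dens 0 t \<theta>
          = ?w * ((norm (\<delta> z - \<theta>))\<^sup>2 * normal_dens ?m (t + 1) \<theta>)"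
        by (simp only: mult_ac)
      show "?I \<theta> z = ennreal ?w * ennreal ((norm (\<delta> z - \<theta>))\<^sup>2 * normal_dens ?m (t + 1) \<theta>)"
        unfolding e by (rule ennreal_mult[OF w]) simp
    qed
    also have "\<dots> = ennreal ?w * ennreal ((norm (\<delta> z - ?m))\<^sup>2 + CARD('p) / (t + 1))"
      using t by (subst nn_integral_cmult) (auto simp: nn_integral_normal_dens_sq)
    also have "\<dots> \<ge> ennreal ?w * ennreal (CARD('p) / (t + 1))"
      by (intro mult_left_mono ennreal_leI) auto
    finally show "ennreal (CARD('p) / (1 + t)) * ennreal ?w \<le> (\<integral>\<^sup>+\<theta>. ?I \<theta> z \<partial>lborel)"
      by (simp add: mult.commute add.commute)
  qed
  also have "\<dots> = (\<integral>\<^sup>+\<theta>. (\<integral>\<^sup>+z. ?I \<theta> z \<partial>lborel) \<partial>lborel)"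
    by (rule lborel_pair.Fubini') (simp add: lborel_prod)
  also have "\<dots> = (\<integral>\<^sup>+\<theta>. risk n \<delta> \<theta> 1 * ennreal (normal_dens 0 t \<theta>) \<partial>lborel)"
    using n by (intro nn_integral_cong, subst risk_eq)
       (auto simp: nn_integral_multc[symmetric] ennreal_mult)
  also have "\<dots> \<le> (\<integral>\<^sup>+\<theta>. sup_risk n \<delta> * ennreal (normal_dens (0::real^'p) t \<theta>) \<partial>lborel)"
    unfolding sup_risk_def
    by (intro nn_integral_mono mult_right_mono SUP_upper2[where i = "(\<theta>, 1)" for \<theta>]) auto
  also have "\<dots> = sup_risk n \<delta>"
    using t by (subst nn_integral_cmult) (auto simp: nn_integral_normal_dens)
  finally show ?thesis .
qed

lemma sup_risk_lower_bound:
  fixes \<delta> :: "(real ^ 'p::finite) \<times> real \<Rightarrow> real ^ 'p"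
  assumes "0 < n" "estimator \<delta>"
  shows "ennreal (CARD('p)) \<le> sup_risk n \<delta>"
proof -
  obtain \<delta>' where d: "\<delta>' \<in> borel_measurable borel" "\<And>x s. 0 < s \<Longrightarrow> \<delta> (x, s) = \<delta>' (x, s)"
    using estimator_borel_version[OF assms(2)] by metis
  have "sup_risk n \<delta> = sup_risk n \<delta>'"
    using risk_cong[of \<delta> \<delta>' n] d(2) by (simp add: sup_risk_def)
  moreover have "ennreal (CARD('p)) \<le> sup_risk n \<delta>'"
  proof (rule LIMSEQ_le_const2)
    have "(\<lambda>k. CARD('p) / (1 + inverse (real (Suc k)))) \<longlonglongrightarrow> CARD('p) / (1 + 0)"
      by (intro tendsto_intros LIMSEQ_inverse_real_of_nat) auto
    then show "(\<lambda>k. ennreal (CARD('p) / (1 + inverse (real (Suc k))))) \<longlonglongrightarrow> ennreal (CARD('p))"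
      by (intro tendsto_ennrealI) simp
    show "\<exists>N. \<forall>k\<ge>N. ennreal (CARD('p) / (1 + inverse (real (Suc k)))) \<le> sup_risk n \<delta>'"
      using bayes_risk_lower_bound[OF assms(1) _ d(1)] by simp
  qed
  ultimately show ?thesis by simp
qed

section \<open>An integrated Stein inequality\<close>

lemma lborel_integral_scale:
  fixes f :: "'a::euclidean_space \<Rightarrow> real"
  assumes [measurable]: "f \<in> borel_measurable borel" and c: "0 < c"
  shows "integral\<^sup>L lborel f = c ^ DIM('a) * integral\<^sup>L lborel (\<lambda>x. f (c *\<^sub>R x))"
proof -
  have "integral\<^sup>L lborel f = integral\<^sup>L (density (distr lborel borel (\<lambda>x. 0 + c *\<^sub>R x)) (\<lambda>_. \<bar>c\<bar> ^ DIM('a))) f"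
    using lborel_affine[of c "0::'a"] c by simp
  also have "\<dots> = c ^ DIM('a) * integral\<^sup>L lborel (\<lambda>x. f (c *\<^sub>R x))"
    using c by (subst integral_density) (auto simp: integral_distr)
  finally show ?thesis .
qed

lemma integrable_normal_dens_quadratic:
  fixes f :: "real ^ 'p::finite \<Rightarrow> real"
  assumes [measurable]: "f \<in> borel_measurable borel" and \<tau>: "0 < \<tau>"
    and bound: "\<And>x. \<bar>f x\<bar> \<le> A + B * (norm x)\<^sup>2"
  shows "integrable lborel (\<lambda>x. f x * normal_dens \<mu> \<tau> x)"
proof (rule Bochner_Integration.integrable_bound)
  show "integrable lborel (\<lambda>x. A * normal_dens \<mu> \<tau> x + B * ((norm (0 - x))\<^sup>2 * normal_dens \<mu> \<tau> x))"
    using integrable_normal_dens(1)[OF \<tau>, of \<mu>] has_bochner_integral_normal_dens_sq[OF \<tau>, of 0 \<mu>]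
    by (auto simp: has_bochner_integral_iff)
  show "AE x in lborel. norm (f x * normal_dens \<mu> \<tau> x)
      \<le> norm (A * normal_dens \<mu> \<tau> x + B * ((norm (0 - x))\<^sup>2 * normal_dens \<mu> \<tau> x))"
  proof (intro AE_I2)
    fix x :: "real ^ 'p"
    have "\<bar>f x\<bar> * normal_dens \<mu> \<tau> x \<le> (A + B * (norm x)\<^sup>2) * normal_dens \<mu> \<tau> x"
      by (intro mult_right_mono bound) simp
    then show "norm (f x * normal_dens \<mu> \<tau> x)
        \<le> norm (A * normal_dens \<mu> \<tau> x + B * ((norm (0 - x))\<^sup>2 * normal_dens \<mu> \<tau> x))"
      by (simp add: abs_mult algebra_simps)
  qed
qed measurable

lemma abs_inner_le_quadratic:
  fixes x \<theta> :: "'a::real_inner"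
  shows "\<bar>x \<bullet> (x - \<theta>)\<bar> \<le> (norm \<theta>)\<^sup>2 + 2 * (norm x)\<^sup>2"
proof -
  have "\<bar>x \<bullet> (x - \<theta>)\<bar> \<le> norm x * norm (x - \<theta>)" by (rule Cauchy_Schwarz_ineq2)
  also have "\<dots> \<le> norm x * (norm x + norm \<theta>)" by (intro mult_left_mono norm_triangle_ineq4) auto
  also have "\<dots> \<le> (norm \<theta>)\<^sup>2 + 2 * (norm x)\<^sup>2"
  proof -
    have "0 \<le> (norm x - norm \<theta>)\<^sup>2" "0 \<le> norm x * norm \<theta>" "0 \<le> (norm x)\<^sup>2" by auto
    moreover have "norm x * (norm x + norm \<theta>) = (norm x)\<^sup>2 + norm x * norm \<theta>"
      "(norm x - norm \<theta>)\<^sup>2 = (norm x)\<^sup>2 + (norm \<theta>)\<^sup>2 - 2 * (norm x * norm \<theta>)"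
      by (simp_all add: power2_eq_square algebra_simps)
    ultimately show ?thesis by linarith
  qed
  finally show ?thesis .
qed

lemma abs_shrunk_inner_le:
  fixes x \<theta> :: "'a::real_inner"
  assumes "0 < \<eta>" "0 \<le> t" "t \<le> 1"
  shows "\<bar>\<eta> * t * (x \<bullet> (x - \<theta>))\<bar> \<le> \<eta> * (norm \<theta>)\<^sup>2 + \<eta> * 2 * (norm x)\<^sup>2"
proof -
  have "\<bar>\<eta> * t * (x \<bullet> (x - \<theta>))\<bar> = \<eta> * (t * \<bar>x \<bullet> (x - \<theta>)\<bar>)"
    using assms by (simp add: abs_mult)
  also have "\<dots> \<le> \<eta> * (1 * ((norm \<theta>)\<^sup>2 + 2 * (norm x)\<^sup>2))"
    using assms by (intro mult_left_mono mult_mono abs_inner_le_quadratic) auto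
  finally show ?thesis by (simp add: algebra_simps)
qed

text \<open>Think of \<open>\<psi> y\<close> as \<open>r(|y|) / |y|\<^sup>2\<close> with \<open>r\<close> nondecreasing, which is what \<open>mono\<close> expresses. For \<open>c > 1\<close>
  the dilation \<open>x = c y\<close> gives \<open>c\<^sup>p\<^sup>-\<^sup>2 \<integral>\<psi>(y) f(c y) dy \<le> \<integral>\<psi>(y) f(y) dy\<close> for the normal density
  \<open>f\<close>, so the derivative of the left-hand side at \<open>c = 1\<close> is at most \<open>0\<close>; this is the claim. The limit
  \<open>c \<rightarrow> 1\<close> can be taken outside the integral on writing \<open>c\<^sup>p\<^sup>-\<^sup>2 f(c y) = f(y) e\<^sup>z\<close> and using \<open>e\<^sup>z \<ge> 1 + z\<close>, since
  \<open>z\<close> is a quadratic polynomial in \<open>c - 1\<close> plus a multiple of \<open>ln c\<close>.\<close>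

lemma stein_inequality:
  fixes \<psi> :: "real ^ 'p::finite \<Rightarrow> real" and \<theta> :: "real ^ 'p"
  assumes [measurable]: "\<psi> \<in> borel_measurable borel" and \<eta>: "0 < \<eta>" and p: "2 \<le> CARD('p)"
    and bound: "\<And>y. 0 \<le> \<psi> y" "\<And>y. \<psi> y \<le> 1"
    and mono: "\<And>y c. 1 < c \<Longrightarrow> \<psi> y \<le> c\<^sup>2 * \<psi> (c *\<^sub>R y)"
  shows "0 \<le> (LBINT y. (\<eta> * \<psi> y * (y \<bullet> (y - \<theta>)) - (real CARD('p) - 2) * \<psi> y) * normal_dens \<theta> \<eta> y)"
proof -
  let ?p = "CARD('p)"
  let ?N = "normal_dens \<theta> \<eta>"
  let ?A = "LBINT y. \<psi> y * ?N y"
  let ?B = "LBINT y. \<eta> * \<psi> y * (y \<bullet> (y - \<theta>)) * ?N y"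
  let ?D = "LBINT y. \<eta> / 2 * \<psi> y * (norm y)\<^sup>2 * ?N y"
  have iA: "integrable lborel (\<lambda>y. \<psi> y * ?N y)"
    by (rule integrable_normal_dens_quadratic[where A = 1 and B = 0]) (use \<eta> bound in auto)
  have iB: "integrable lborel (\<lambda>y. \<eta> * \<psi> y * (y \<bullet> (y - \<theta>)) * ?N y)"
    by (rule integrable_normal_dens_quadratic[where A = "\<eta> * (norm \<theta>)\<^sup>2" and B = "\<eta> * 2"])
       (auto intro!: abs_shrunk_inner_le simp: \<eta> bound)
  have iD: "integrable lborel (\<lambda>y. \<eta> / 2 * \<psi> y * (norm y)\<^sup>2 * ?N y)"
  proof (rule integrable_normal_dens_quadratic[where A = 0 and B = "\<eta> / 2"])
    fix y
    have "\<eta> / 2 * (\<psi> y * (norm y)\<^sup>2) \<le> \<eta> / 2 * (1 * (norm y)\<^sup>2)"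
      using \<eta> bound[of y] by (intro mult_left_mono mult_right_mono) auto
    then show "\<bar>\<eta> / 2 * \<psi> y * (norm y)\<^sup>2\<bar> \<le> 0 + \<eta> / 2 * (norm y)\<^sup>2"
      using \<eta> bound[of y] by (simp add: abs_mult)
  qed (use \<eta> in auto)
  have A0: "0 \<le> ?A" using bound by (intro integral_nonneg_AE) auto
  have key: "(real ?p - 2) * ?A \<le> c * ?B + c * (c - 1) * ?D" if c: "1 < c" for c
  proof -
    have e: "c powr (real ?p - 2) * ?N (c *\<^sub>R y)
       \<ge> ?N y * (1 + (real ?p - 2) * ln c - (c - 1) * (\<eta> * (y \<bullet> (y - \<theta>))) - (c - 1)\<^sup>2 * (\<eta> / 2 * (norm y)\<^sup>2))" for y
    proof -
      let ?z = "(real ?p - 2) * ln c - (c - 1) * (\<eta> * (y \<bullet> (y - \<theta>))) - (c - 1)\<^sup>2 * (\<eta> / 2 * (norm y)\<^sup>2)"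
      have q: "(norm (c *\<^sub>R y - \<theta>))\<^sup>2 = (norm (y - \<theta>))\<^sup>2 + 2 * (c - 1) * (y \<bullet> (y - \<theta>)) + (c - 1)\<^sup>2 * (norm y)\<^sup>2"
        unfolding power2_norm_eq_inner
        by (simp add: inner_diff_left inner_diff_right inner_commute power2_eq_square algebra_simps)
      have "?N (c *\<^sub>R y) * c powr (real ?p - 2) = ?N y * exp ?z"
      proof -
        have cp: "c powr (real ?p - 2) = exp ((real ?p - 2) * ln c)" using c by (simp add: powr_def)
        have "- (\<eta> / 2) * (norm (c *\<^sub>R y - \<theta>))\<^sup>2 + (real ?p - 2) * ln c = - (\<eta> / 2) * (norm (y - \<theta>))\<^sup>2 + ?z"
          unfolding q by (simp add: algebra_simps)
        then show ?thesis unfolding normal_dens_def cp by (simp only: mult.assoc mult_exp_exp)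
      qed
      moreover have "?N y * (1 + ?z) \<le> ?N y * exp ?z"
        by (intro mult_left_mono exp_ge_add_one_self) simp
      ultimately show ?thesis by (simp add: algebra_simps)
    qed
    have iS: "integrable lborel (\<lambda>y. \<psi> (inverse c *\<^sub>R y) * ?N y)"
      by (rule integrable_normal_dens_quadratic[where A = 1 and B = 0]) (use \<eta> bound in auto)
    have iT: "integrable lborel (\<lambda>y. \<psi> y * (c powr (real ?p - 2) * ?N (c *\<^sub>R y)))"
    proof -
      have "integrable (density (distr lborel borel (\<lambda>x. 0 + c *\<^sub>R x)) (\<lambda>_. \<bar>c\<bar> ^ DIM(real^'p))) (\<lambda>y. \<psi> (inverse c *\<^sub>R y) * ?N y)"
        using iS lborel_affine[of c "0::real^'p"] c by simp
      then have "integrable lborel (\<lambda>y. c ^ ?p * (\<psi> y * ?N (c *\<^sub>R y)))"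
        using c by (subst (asm) integrable_density) (auto simp: integrable_distr_eq)
      then have "integrable lborel (\<lambda>y. (c powr (real ?p - 2) / c ^ ?p) * (c ^ ?p * (\<psi> y * ?N (c *\<^sub>R y))))"
        by (rule integrable_mult_right)
      then show ?thesis using c by (simp add: mult_ac)
    qed
    have "?A + (real ?p - 2) * ln c * ?A - (c - 1) * ?B - (c - 1)\<^sup>2 * ?D
        = (LBINT y. \<psi> y * ?N y + (real ?p - 2) * ln c * (\<psi> y * ?N y) - (c - 1) * (\<eta> * \<psi> y * (y \<bullet> (y - \<theta>)) * ?N y)
             - (c - 1)\<^sup>2 * (\<eta> / 2 * \<psi> y * (norm y)\<^sup>2 * ?N y))"
      by (intro has_bochner_integral_integral_eq[symmetric] has_bochner_integral_add has_bochner_integral_diff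
         has_bochner_integral_mult_right has_bochner_integral_integrable iA iB iD)
    also have "\<dots> \<le> (LBINT y. \<psi> y * (c powr (real ?p - 2) * ?N (c *\<^sub>R y)))"
    proof (rule integral_mono)
      fix y
      have "\<psi> y * (?N y * (1 + (real ?p - 2) * ln c - (c - 1) * (\<eta> * (y \<bullet> (y - \<theta>))) - (c - 1)\<^sup>2 * (\<eta> / 2 * (norm y)\<^sup>2)))
         \<le> \<psi> y * (c powr (real ?p - 2) * ?N (c *\<^sub>R y))"
        by (intro mult_left_mono e bound)
      then show "\<psi> y * ?N y + (real ?p - 2) * ln c * (\<psi> y * ?N y) - (c - 1) * (\<eta> * \<psi> y * (y \<bullet> (y - \<theta>)) * ?N y)
             - (c - 1)\<^sup>2 * (\<eta> / 2 * \<psi> y * (norm y)\<^sup>2 * ?N y) \<le> \<psi> y * (c powr (real ?p - 2) * ?N (c *\<^sub>R y))"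
        by (simp add: algebra_simps)
    qed (intro Bochner_Integration.integrable_add Bochner_Integration.integrable_diff integrable_mult_right iA iB iD iT)+
    also have "\<dots> \<le> ?A"
    proof -
      have "(LBINT y. \<psi> (inverse c *\<^sub>R y) * ?N y) = c ^ ?p * (LBINT y. \<psi> y * ?N (c *\<^sub>R y))"
        using c by (subst lborel_integral_scale[where c = c]) auto
      moreover have "(LBINT y. \<psi> y * (c powr (real ?p - 2) * ?N (c *\<^sub>R y)))
          = c powr (real ?p - 2) * (LBINT y. \<psi> y * ?N (c *\<^sub>R y))"
        by (subst integral_mult_right_zero[symmetric]) (simp add: mult_ac)
      moreover have "c ^ ?p = c\<^sup>2 * c powr (real ?p - 2)"
        using c by (simp add: powr_diff powr_realpow powr_numeral)
      moreover have "(LBINT y. \<psi> (inverse c *\<^sub>R y) * ?N y) \<le> (LBINT y. c\<^sup>2 * (\<psi> y * ?N y))"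
      proof (rule integral_mono)
        fix y
        have "\<psi> (inverse c *\<^sub>R y) \<le> c\<^sup>2 * \<psi> y" using mono[OF c, of "inverse c *\<^sub>R y"] c by simp
        then have "\<psi> (inverse c *\<^sub>R y) * ?N y \<le> (c\<^sup>2 * \<psi> y) * ?N y" by (intro mult_right_mono) auto
        then show "\<psi> (inverse c *\<^sub>R y) * ?N y \<le> c\<^sup>2 * (\<psi> y * ?N y)" by simp
      qed (use iS iA in auto)
      ultimately have "c\<^sup>2 * (LBINT y. \<psi> y * (c powr (real ?p - 2) * ?N (c *\<^sub>R y))) \<le> c\<^sup>2 * ?A"
        by simp
      then show ?thesis using c by simp
    qed
    finally have l: "(real ?p - 2) * ?A * ln c \<le> (c - 1) * ?B + (c - 1)\<^sup>2 * ?D" by (simp add: mult_ac)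
    \<comment> \<open>Dividing by \<open>c - 1\<close> after this estimate leaves a bound that is continuous at \<open>c = 1\<close>.\<close>
    have "(c - 1) / c \<le> ln c"
    proof -
      have "ln (inverse c) = - ln c" using c by (intro ln_inverse)
      moreover have "ln (inverse c) \<le> inverse c - 1" using c by (intro ln_le_minus_one) simp
      moreover have "(c - 1) / c = 1 - inverse c" using c by (simp add: field_simps)
      ultimately show ?thesis by linarith
    qed
    then have "(real ?p - 2) * ?A * ((c - 1) / c) \<le> (real ?p - 2) * ?A * ln c"
      using p A0 by (intro mult_left_mono mult_nonneg_nonneg) auto
    with l have "(real ?p - 2) * ?A * ((c - 1) / c) \<le> (c - 1) * ?B + (c - 1)\<^sup>2 * ?D" by linarith
    then have "(c / (c - 1)) * ((real ?p - 2) * ?A * ((c - 1) / c)) \<le> (c / (c - 1)) * ((c - 1) * ?B + (c - 1)\<^sup>2 * ?D)"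
      using c by (intro mult_left_mono) auto
    moreover have "(c / (c - 1)) * (A * ((c - 1) / c)) = A"
      "(c / (c - 1)) * ((c - 1) * B + (c - 1)\<^sup>2 * E) = c * B + c * (c - 1) * E" for A B E :: real
      using c by (simp_all add: field_simps power2_eq_square)
    ultimately show ?thesis by (simp only:)
  qed
  have "(real ?p - 2) * ?A \<le> ?B"
  proof (rule LIMSEQ_le_const)
    have "(\<lambda>k. (1 + inverse (real (Suc k))) * ?B + (1 + inverse (real (Suc k))) * ((1 + inverse (real (Suc k))) - 1) * ?D)
       \<longlonglongrightarrow> (1 + 0) * ?B + (1 + 0) * ((1 + 0) - 1) * ?D"
      by (intro tendsto_intros LIMSEQ_inverse_real_of_nat)
    then show "(\<lambda>k. (1 + inverse (real (Suc k))) * ?B + (1 + inverse (real (Suc k))) * ((1 + inverse (real (Suc k))) - 1) * ?D)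
       \<longlonglongrightarrow> ?B" by simp
    show "\<exists>N. \<forall>k\<ge>N. (real ?p - 2) * ?A \<le> (1 + inverse (real (Suc k))) * ?B
        + (1 + inverse (real (Suc k))) * ((1 + inverse (real (Suc k))) - 1) * ?D"
      by (intro exI allI impI key) simp
  qed
  moreover have scale: "(u - v * t) * N = u * N - v * (t * N)" for u v t N :: real
    by (simp add: algebra_simps)
  moreover have "(LBINT y. (\<eta> * \<psi> y * (y \<bullet> (y - \<theta>)) - (real ?p - 2) * \<psi> y) * ?N y) = ?B - (real ?p - 2) * ?A"
    unfolding scale
    by (intro has_bochner_integral_integral_eq has_bochner_integral_diff
       has_bochner_integral_mult_right has_bochner_integral_integrable iA iB)
  ultimately show ?thesis by (simp only: diff_ge_0_iff_ge)
qed

section \<open>Risk of shrinkage estimators\<close>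

text \<open>With \<open>\<phi>(w) = w \<Psi>(w)\<close>, expanding the loss of \<open>(1 - \<psi>) x\<close> gives
  \<open>\<eta> |x - \<theta>|\<^sup>2 - 2 \<eta> \<psi> (x \<bullet> (x - \<theta>)) + \<eta> \<psi>\<^sup>2 |x|\<^sup>2\<close>. The first term has expectation \<open>p\<close>. In expectation the
  second is at most \<open>-2 (p - 2) \<psi>\<close>, by \<open>stein_inequality\<close> for fixed \<open>s\<close>, and the third is at most
  \<open>(n + 2) \<phi> \<psi>\<close>, by \<open>chi_antimono_inequality\<close> for fixed \<open>x\<close>. The upper bound on \<open>\<phi>\<close> makes the sum
  of the last two nonpositive.\<close>

theorem baranchik_risk_bound:
  fixes \<Psi> :: "real \<Rightarrow> real" and \<theta> :: "real ^ 'p::finite"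
  assumes n: "0 < n" and p: "2 \<le> CARD('p)" and \<eta>: "0 < \<eta>"
    and [measurable]: "\<Psi> \<in> borel_measurable borel"
    and bound: "\<And>w. 0 \<le> w \<Longrightarrow> 0 \<le> \<Psi> w" "\<And>w. 0 \<le> w \<Longrightarrow> \<Psi> w \<le> 1"
    and mono: "\<And>v w. 0 \<le> v \<Longrightarrow> v \<le> w \<Longrightarrow> v * \<Psi> v \<le> w * \<Psi> w"
    and upper: "\<And>w. 0 \<le> w \<Longrightarrow> (real n + 2) * (w * \<Psi> w) \<le> 2 * (real CARD('p) - 2)"
  shows "risk n (\<lambda>(x, s). (1 - \<Psi> ((norm x)\<^sup>2 / s)) *\<^sub>R x) \<theta> \<eta> \<le> ennreal (CARD('p))"
proof -
  let ?p = "real CARD('p)"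
  let ?\<delta> = "\<lambda>(x::real^'p, s). (1 - \<Psi> ((norm x)\<^sup>2 / s)) *\<^sub>R x"
  \<comment> \<open>\<open>max 0\<close> keeps the shrinkage factor within its bounds off the sample space\<close>
  define \<psi> where "\<psi> z = \<Psi> (max 0 ((norm (fst z))\<^sup>2 / snd z))" for z :: "(real ^ 'p) \<times> real"
  define D where "D z = normal_dens \<theta> \<eta> (fst z) * chi n \<eta> (snd z)" for z :: "(real ^ 'p) \<times> real"
  \<comment> \<open>The defects \<open>h1\<close> and \<open>h2\<close> of the two inequalities; \<open>w \<psi>\<^sup>2\<close> appears as \<open>\<psi>\<^sup>2 |x|\<^sup>2 / s\<close>.\<close>
  define h1 where "h1 z = (\<eta> * \<psi> z * (fst z \<bullet> (fst z - \<theta>)) - (?p - 2) * \<psi> z) * D z" for z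
  define h2 where "h2 z = (\<eta> * (\<psi> z)\<^sup>2 * (norm (fst z))\<^sup>2 - (real n + 2) * ((\<psi> z)\<^sup>2 * (norm (fst z))\<^sup>2 / snd z)) * D z" for z
  define g where "g z = \<eta> * (norm (fst z - \<theta>))\<^sup>2 * D z" for z
  have [measurable]: "\<psi> \<in> borel_measurable borel" unfolding \<psi>_def by measurable
  have [measurable]: "D \<in> borel_measurable borel" unfolding D_def by measurable
  have \<psi>: "0 \<le> \<psi> z" "\<psi> z \<le> 1" for z using bound by (auto simp: \<psi>_def)
  have D: "0 \<le> D z" for z using n by (simp add: D_def)
  have Ds: "snd z \<le> 0 \<Longrightarrow> D z = 0" for z by (simp add: D_def chi_def)
  have chi: "integrable lborel (chi n \<eta>)" "integral\<^sup>L lborel (chi n \<eta>) = 1"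
    using chi_integral[OF n \<eta>] by (auto simp: has_bochner_integral_iff)
  have iD: "integrable lborel D"
    unfolding D_def by (rule integrable_lborel_pair_mult(1)[OF integrable_normal_dens(1)[OF \<eta>] chi(1)])
  have iD2: "integrable lborel (\<lambda>z. (norm (d - fst z))\<^sup>2 * D z)"
    and ID2: "integral\<^sup>L lborel (\<lambda>z. (norm (\<theta> - fst z))\<^sup>2 * D z) = ?p / \<eta>" for d
    using integrable_lborel_pair_mult[OF _ chi(1), of "\<lambda>x. (norm (d - x))\<^sup>2 * normal_dens \<theta> \<eta> x"]
      integrable_lborel_pair_mult[OF _ chi(1), of "\<lambda>x. (norm (\<theta> - x))\<^sup>2 * normal_dens \<theta> \<eta> x"]
      has_bochner_integral_normal_dens_sq[OF \<eta>, of d \<theta>]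
      has_bochner_integral_normal_dens_sq[OF \<eta>, of \<theta> \<theta>] chi(2)
    by (simp_all add: D_def has_bochner_integral_iff mult.assoc)
  have dom: "integrable lborel (\<lambda>z. f z * D z)"
    if [measurable]: "f \<in> borel_measurable borel"
      and b: "\<And>z. 0 < snd z \<Longrightarrow> \<bar>f z\<bar> \<le> A + B * (norm (fst z))\<^sup>2" for f A B
  proof (rule Bochner_Integration.integrable_bound)
    show "integrable lborel (\<lambda>z. A * D z + B * ((norm (0 - fst z))\<^sup>2 * D z))"
      by (intro Bochner_Integration.integrable_add integrable_mult_right iD iD2)
    show "AE z in lborel. norm (f z * D z) \<le> norm (A * D z + B * ((norm (0 - fst z))\<^sup>2 * D z))"
    proof (intro AE_I2)
      fix z
      show "norm (f z * D z) \<le> norm (A * D z + B * ((norm (0 - fst z))\<^sup>2 * D z))"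
      proof (cases "0 < snd z")
        case True
        have "\<bar>f z\<bar> * D z \<le> (A + B * (norm (fst z))\<^sup>2) * D z"
          by (intro mult_right_mono b True D)
        then show ?thesis using D[of z] by (simp add: abs_mult algebra_simps)
      qed (simp add: Ds)
    qed
  qed measurable
  have sq1: "(\<psi> z)\<^sup>2 \<le> 1" for z using \<psi>[of z] by (simp add: power_le_one)
  have i1: "integrable lborel h1"
    unfolding h1_def
  proof (rule dom[where A = "\<eta> * (norm \<theta>)\<^sup>2 + (?p - 2)" and B = "\<eta> * 2"])
    fix z :: "(real ^ 'p) \<times> real"
    have gen: "\<bar>a - b\<bar> \<le> X + Y + Z" if "\<bar>a\<bar> \<le> X + Z" "\<bar>b\<bar> \<le> Y * 1" for a b X Y Z :: real
      using that by linarith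
    have "\<bar>\<eta> * \<psi> z * (fst z \<bullet> (fst z - \<theta>))\<bar> \<le> \<eta> * (norm \<theta>)\<^sup>2 + \<eta> * 2 * (norm (fst z))\<^sup>2"
      by (rule abs_shrunk_inner_le[OF \<eta> \<psi>])
    moreover have "\<bar>(?p - 2) * \<psi> z\<bar> \<le> (?p - 2) * 1"
      using p \<psi>[of z] by (simp add: abs_mult mult_left_le)
    ultimately show "\<bar>\<eta> * \<psi> z * (fst z \<bullet> (fst z - \<theta>)) - (?p - 2) * \<psi> z\<bar>
        \<le> \<eta> * (norm \<theta>)\<^sup>2 + (?p - 2) + \<eta> * 2 * (norm (fst z))\<^sup>2"
      by (rule gen)
  qed measurable
  have \<phi>: "0 \<le> (\<psi> z)\<^sup>2 * (norm (fst z))\<^sup>2 / snd z"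
      "(real n + 2) * ((\<psi> z)\<^sup>2 * (norm (fst z))\<^sup>2 / snd z) \<le> 2 * (?p - 2) * \<psi> z" if "0 < snd z" for z
  proof -
    let ?w = "(norm (fst z))\<^sup>2 / snd z"
    have w: "0 \<le> ?w" using that by simp
    then have e: "\<psi> z = \<Psi> ?w" by (simp add: \<psi>_def)
    show "0 \<le> (\<psi> z)\<^sup>2 * (norm (fst z))\<^sup>2 / snd z" using that by simp
    have "(real n + 2) * (?w * \<psi> z) * \<psi> z \<le> 2 * (?p - 2) * \<psi> z"
      using upper[OF w] \<psi>[of z] unfolding e by (intro mult_right_mono)
    then show "(real n + 2) * ((\<psi> z)\<^sup>2 * (norm (fst z))\<^sup>2 / snd z) \<le> 2 * (?p - 2) * \<psi> z"
      by (simp add: power2_eq_square mult_ac)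
  qed
  have i2: "integrable lborel h2"
    unfolding h2_def
  proof (rule dom[where A = "2 * (?p - 2)" and B = \<eta>])
    fix z :: "(real ^ 'p) \<times> real" assume z: "0 < snd z"
    have "(\<psi> z)\<^sup>2 * (norm (fst z))\<^sup>2 \<le> 1 * (norm (fst z))\<^sup>2" by (intro mult_right_mono sq1) auto
    then have "\<eta> * ((\<psi> z)\<^sup>2 * (norm (fst z))\<^sup>2) \<le> \<eta> * (1 * (norm (fst z))\<^sup>2)"
      using \<eta> by (intro mult_left_mono) auto
    moreover have "2 * (?p - 2) * \<psi> z \<le> 2 * (?p - 2)" using p \<psi>[of z] by (simp add: mult_left_le)
    moreover have "0 \<le> \<eta> * ((\<psi> z)\<^sup>2 * (norm (fst z))\<^sup>2)" using \<eta> by simp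
    moreover have "0 \<le> (real n + 2) * ((\<psi> z)\<^sup>2 * (norm (fst z))\<^sup>2 / snd z)"
      using \<phi>(1)[OF z] by (intro mult_nonneg_nonneg) auto
    ultimately show "\<bar>\<eta> * (\<psi> z)\<^sup>2 * (norm (fst z))\<^sup>2 - (real n + 2) * ((\<psi> z)\<^sup>2 * (norm (fst z))\<^sup>2 / snd z)\<bar>
        \<le> 2 * (?p - 2) + \<eta> * (norm (fst z))\<^sup>2"
      using \<phi>(2)[OF z] unfolding mult.assoc by linarith
  qed measurable
  have ig: "integrable lborel g" and Ig: "integral\<^sup>L lborel g = ?p"
  proof -
    have "g = (\<lambda>z. \<eta> * ((norm (\<theta> - fst z))\<^sup>2 * D z))"
      by (simp add: g_def fun_eq_iff norm_minus_commute mult.assoc)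
    then show "integrable lborel g" "integral\<^sup>L lborel g = ?p"
      using iD2[of \<theta>] ID2 \<eta> by simp_all
  qed
  \<comment> \<open>Stein inequality in \<open>x\<close> on each slice of constant \<open>s\<close>\<close>
  have I1: "0 \<le> integral\<^sup>L lborel h1"
  proof -
    have i: "integrable (lborel \<Otimes>\<^sub>M lborel) (case_prod (\<lambda>x s. h1 (x, s)))" using i1 by (simp add: lborel_prod)
    have "integral\<^sup>L lborel h1 = (LBINT s. LBINT x. h1 (x, s))"
      using lborel_pair.integral_snd[OF i] by (simp add: lborel_prod)
    also have "\<dots> \<ge> 0"
    proof (rule integral_nonneg_AE, rule AE_I2)
      fix s :: real
      show "0 \<le> (LBINT x. h1 (x, s))"
      proof (cases "0 < s")
        case s: True
        let ?f = "\<lambda>x. \<psi> (x, s)"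
        have st: "0 \<le> (LBINT y. (\<eta> * ?f y * (y \<bullet> (y - \<theta>)) - (?p - 2) * ?f y) * normal_dens \<theta> \<eta> y)"
        proof (rule stein_inequality)
          fix y :: "real ^ 'p" and c :: real assume c: "1 < c"
          let ?w = "(norm y)\<^sup>2 / s"
          have w: "0 \<le> ?w" using s by simp
          have c2: "1 \<le> c\<^sup>2" using c by (simp add: one_le_power)
          have cw: "?w \<le> c\<^sup>2 * ?w" using mult_right_mono[OF c2 w] by simp
          have e: "?f y = \<Psi> ?w" "?f (c *\<^sub>R y) = \<Psi> (c\<^sup>2 * ?w)"
            using s by (auto simp: \<psi>_def power_mult_distrib)
          show "?f y \<le> c\<^sup>2 * ?f (c *\<^sub>R y)"
          proof (cases "?w = 0")
            case True
            show ?thesis unfolding e True using mult_right_mono[OF c2 bound(1)[of 0]] by simp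
          next
            case False
            then have "0 < ?w" using w by linarith
            moreover have "?w * \<Psi> ?w \<le> ?w * (c\<^sup>2 * \<Psi> (c\<^sup>2 * ?w))"
              using mono[OF w cw] by (simp only: mult_ac)
            ultimately show ?thesis unfolding e by (rule mult_left_le_imp_le[rotated])
          qed
        qed (use \<psi> \<eta> p in auto)
        have "(LBINT x. h1 (x, s)) = chi n \<eta> s *
            (LBINT x. (\<eta> * ?f x * (x \<bullet> (x - \<theta>)) - (?p - 2) * ?f x) * normal_dens \<theta> \<eta> x)"
          by (subst integral_mult_right_zero[symmetric]) (simp add: h1_def D_def mult_ac)
        then show ?thesis using st n by simp
      qed (simp add: h1_def Ds)
    qed
    finally show ?thesis .
  qed
  \<comment> \<open>single crossing in \<open>s\<close> on each slice of constant \<open>x\<close>\<close>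
  have I2: "integral\<^sup>L lborel h2 \<le> 0"
  proof -
    have i: "integrable (lborel \<Otimes>\<^sub>M lborel) (case_prod (\<lambda>x s. h2 (x, s)))" using i2 by (simp add: lborel_prod)
    have "integral\<^sup>L lborel h2 = (LBINT x. LBINT s. h2 (x, s))"
      using lborel_pair.integral_fst[OF i] by (simp add: lborel_prod)
    also have "\<dots> \<le> (LBINT x::real^'p. 0)"
    proof (rule integral_mono_AE)
      show "AE x in lborel. (LBINT s. h2 (x, s)) \<le> 0"
        using lborel_pair.AE_integrable_fst[OF i]
      proof eventually_elim
        fix x :: "real ^ 'p" assume ix: "integrable lborel (\<lambda>s. h2 (x, s))"
        show "(LBINT s. h2 (x, s)) \<le> 0"
        proof (cases "x = 0")
          case False
          let ?c = "(norm x)\<^sup>2"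
          have c: "0 < ?c" using False by simp
          \<comment> \<open>The factor \<open>\<phi>(|x|\<^sup>2 / s)\<^sup>2\<close> decreases in \<open>s\<close>; the rest of \<open>h2\<close> is the sign-changing kernel.\<close>
          let ?u = "\<lambda>s. normal_dens \<theta> \<eta> x / ?c * (?c / s * \<Psi> (?c / s))\<^sup>2"
          have eq: "(\<lambda>s. h2 (x, s)) = (\<lambda>s. ?u s * ((\<eta> * s\<^sup>2 - (real n + 2) * s) * chi n \<eta> s))"
          proof
            fix s
            show "h2 (x, s) = ?u s * ((\<eta> * s\<^sup>2 - (real n + 2) * s) * chi n \<eta> s)"
            proof (cases "0 < s")
              case True
              then have "\<psi> (x, s) = \<Psi> (?c / s)" using c by (simp add: \<psi>_def)
              then show ?thesis using c True by (simp add: h2_def D_def field_simps power2_eq_square)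
            qed (simp add: h2_def D_def chi_def)
          qed
          show ?thesis
            unfolding eq
          proof (rule chi_antimono_inequality[OF n \<eta>])
            fix s t :: real assume st: "0 < s" "s \<le> t"
            have q: "?c / t \<le> ?c / s" using st c by (intro divide_left_mono) auto
            have "0 \<le> ?c / t * \<Psi> (?c / t)" using st c bound(1)[of "?c / t"] by simp
            then have "(?c / t * \<Psi> (?c / t))\<^sup>2 \<le> (?c / s * \<Psi> (?c / s))\<^sup>2"
              using mono[OF _ q] st c by (intro power_mono) auto
            then show "?u t \<le> ?u s" by (intro mult_left_mono) auto
          qed (use ix eq in simp)
        qed (simp add: h2_def)
      qed
    qed (use lborel_pair.integrable_fst[OF i] in auto)
    finally show ?thesis by simp
  qed
  have up: "\<eta> * (norm (?\<delta> z - \<theta>))\<^sup>2 * D z \<le> g z - 2 * h1 z + h2 z" for z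
  proof (cases "0 < snd z")
    case True
    obtain x s where z: "z = (x, s)" by (cases z)
    have s: "0 < s" using True z by simp
    have e: "?\<delta> z = (1 - \<psi> z) *\<^sub>R x" using s by (simp add: z \<psi>_def)
    have exp: "(norm ((1 - \<psi> z) *\<^sub>R x - \<theta>))\<^sup>2 = (norm (x - \<theta>))\<^sup>2 - 2 * \<psi> z * (x \<bullet> (x - \<theta>)) + (\<psi> z)\<^sup>2 * (norm x)\<^sup>2"
      unfolding power2_norm_eq_inner
      by (simp add: inner_diff_left inner_diff_right inner_commute power2_eq_square algebra_simps)
    have "g z - 2 * h1 z + h2 z - \<eta> * (norm (?\<delta> z - \<theta>))\<^sup>2 * D z
        = (2 * (?p - 2) * \<psi> z - (real n + 2) * ((\<psi> z)\<^sup>2 * (norm x)\<^sup>2 / s)) * D z"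
      unfolding e exp g_def h1_def h2_def by (simp add: z algebra_simps)
    also have "\<dots> \<ge> 0" using \<phi>(2)[OF True] D[of z] by (intro mult_nonneg_nonneg) (auto simp: z)
    finally show ?thesis by simp
  qed (simp add: Ds g_def h1_def h2_def)
  have m: "(\<lambda>z. (1 - \<Psi> ((norm (fst z))\<^sup>2 / snd z)) *\<^sub>R fst z) \<in> borel_measurable (borel :: ((real^'p) \<times> real) measure)"
    by measurable
  have dd: "?\<delta> = (\<lambda>z. (1 - \<Psi> ((norm (fst z))\<^sup>2 / snd z)) *\<^sub>R fst z)" by (auto simp: fun_eq_iff)
  have "risk n ?\<delta> \<theta> \<eta> = (\<integral>\<^sup>+z. ennreal (\<eta> * (norm (?\<delta> z - \<theta>))\<^sup>2 * D z) \<partial>lborel)"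
    unfolding D_def dd by (rule risk_eq[OF n \<eta> m])
  also have "\<dots> \<le> (\<integral>\<^sup>+z. ennreal (g z - 2 * h1 z + h2 z) \<partial>lborel)"
    by (intro nn_integral_mono ennreal_leI up)
  also have "\<dots> = ennreal (LBINT z. g z - 2 * h1 z + h2 z)"
  proof (rule nn_integral_eq_integral)
    show "AE z in lborel. 0 \<le> g z - 2 * h1 z + h2 z"
      using \<eta> D by (intro AE_I2 order_trans[OF _ up]) auto
  qed (use ig i1 i2 in simp)
  also have "(LBINT z. g z - 2 * h1 z + h2 z) = ?p - 2 * integral\<^sup>L lborel h1 + integral\<^sup>L lborel h2"
    using ig i1 i2 Ig by simp
  also have "ennreal \<dots> \<le> ennreal ?p" using I1 I2 by (intro ennreal_leI) simp
  finally show ?thesis .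
qed

section \<open>Tilted beta integrals\<close>

text \<open>The integrand in \<open>\<lambda>\<close> that remains of the posterior after \<open>\<theta>\<close> and \<open>\<eta>\<close> have been integrated out. Its
  integral is, up to a beta factor, the hypergeometric function \<open>F(q, \<alpha> + 1; \<alpha> + b + 2; -w)\<close>.\<close>

definition tilt_fun :: "real \<Rightarrow> real \<Rightarrow> real \<Rightarrow> real \<Rightarrow> real \<Rightarrow> real" where
  "tilt_fun \<alpha> b q w l = indicator {0<..<1} l * (l powr \<alpha> * (1 - l) powr b * (1 + l * w) powr (- q))"

definition tilt :: "real \<Rightarrow> real \<Rightarrow> real \<Rightarrow> real \<Rightarrow> real" where
  "tilt \<alpha> b q w = (LBINT l. tilt_fun \<alpha> b q w l)"

lemma tilt_fun_measurable [measurable]: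
  assumes [measurable]: "f \<in> borel_measurable M" "g \<in> borel_measurable M"
  shows "(\<lambda>z. tilt_fun \<alpha> b q (f z) (g z)) \<in> borel_measurable M"
  unfolding tilt_fun_def by measurable

lemma tilt_fun_nonneg [simp]: "0 \<le> tilt_fun \<alpha> b q w l"
  by (simp add: tilt_fun_def)

lemma beta_integrable:
  fixes \<alpha> b :: real
  assumes "-1 < \<alpha>" "-1 < b"
  shows "integrable lborel (\<lambda>l. indicator {0<..<1} l * (l powr \<alpha> * (1 - l) powr b))"
    and "(LBINT l. indicator {0<..<1} l * (l powr \<alpha> * (1 - l) powr b)) = Beta (\<alpha> + 1) (b + 1)"
proof -
  have s: "set_integrable lborel {0..1} (\<lambda>t. t powr (\<alpha> + 1 - 1) * (1 - t) powr (b + 1 - 1))"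
    using assms by (intro integrable_Beta) auto
  have e: "indicator {0..1} l * (l powr \<alpha> * (1 - l) powr b) = indicator {0<..<1} l * (l powr \<alpha> * (1 - l) powr b)"
    for l :: real by (auto simp: indicator_def)
  show "integrable lborel (\<lambda>l. indicator {0<..<1} l * (l powr \<alpha> * (1 - l) powr b))"
    using s by (simp add: set_integrable_def e)
  have "(LBINT l. indicator {0<..<1} l * (l powr \<alpha> * (1 - l) powr b))
     = integral {0..1} (\<lambda>t. t powr (\<alpha> + 1 - 1) * (1 - t) powr (b + 1 - 1))"
    using set_borel_integral_eq_integral(2)[OF s] by (simp add: set_lebesgue_integral_def e)
  also have "\<dots> = Beta (\<alpha> + 1) (b + 1)"
    using assms by (intro integral_unique has_integral_Beta_real) auto
  finally show "(LBINT l. indicator {0<..<1} l * (l powr \<alpha> * (1 - l) powr b)) = Beta (\<alpha> + 1) (b + 1)" .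
qed

lemma tilt_fun_integrable:
  assumes "-1 < \<alpha>" "-1 < b" "0 \<le> q" "0 \<le> w"
  shows "integrable lborel (tilt_fun \<alpha> b q w)"
proof (rule Bochner_Integration.integrable_bound[OF beta_integrable(1)[OF assms(1,2)]])
  show "AE l in lborel. norm (tilt_fun \<alpha> b q w l) \<le> norm (indicator {0<..<1} l * (l powr \<alpha> * (1 - l) powr b))"
  proof (intro AE_I2)
    fix l :: real
    have "(1 + l * w) powr (- q) \<le> 1" if "0 < l"
    proof -
      have "0 < 1 + l * w" using assms that by (simp add: add_pos_nonneg)
      then show ?thesis using powr_mono[of "- q" 0 "1 + l * w"] assms that by simp
    qed
    then show "norm (tilt_fun \<alpha> b q w l) \<le> norm (indicator {0<..<1} l * (l powr \<alpha> * (1 - l) powr b))"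
      by (auto simp: tilt_fun_def indicator_def abs_mult intro!: mult_left_le)
  qed
  show "tilt_fun \<alpha> b q w \<in> borel_measurable lborel"
    by (rule tilt_fun_measurable) auto
qed

lemma tilt_pos:
  assumes "-1 < \<alpha>" "-1 < b" "0 \<le> q" "0 \<le> w"
  shows "0 < tilt \<alpha> b q w"
proof -
  have "tilt \<alpha> b q w \<noteq> 0"
  proof
    assume "tilt \<alpha> b q w = 0"
    then have "AE l in lborel. tilt_fun \<alpha> b q w l = 0"
      using integral_nonneg_eq_0_iff_AE[OF tilt_fun_integrable[OF assms]] by (simp add: tilt_def)
    then have "AE l in lborel. l \<notin> {0<..<1::real}"
    proof eventually_elim
      fix l assume "tilt_fun \<alpha> b q w l = 0"
      moreover have "0 < 1 + l * w" if "0 < l" using that assms by (simp add: add_pos_nonneg)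
      ultimately show "l \<notin> {0<..<1}" by (auto simp: tilt_fun_def)
    qed
    then have "emeasure lborel {0<..<1::real} = 0"
      by (subst (asm) AE_iff_measurable[OF _ refl]) (auto simp: greaterThanLessThan_def greaterThan_def lessThan_def Collect_conj_eq)
    then show False by simp
  qed
  moreover have "0 \<le> tilt \<alpha> b q w" unfolding tilt_def by (intro integral_nonneg_AE) auto
  ultimately show ?thesis by simp
qed

lemma tilt_Suc_less:
  assumes "-1 < \<alpha>" "-1 < b" "0 \<le> q" "0 \<le> w"
  shows "tilt (\<alpha> + 1) b q w < tilt \<alpha> b q w"
proof -
  have "tilt \<alpha> (b + 1) q w = (LBINT l. tilt_fun \<alpha> b q w l - tilt_fun (\<alpha> + 1) b q w l)"
    unfolding tilt_def
    by (intro Bochner_Integration.integral_cong)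
       (auto simp: tilt_fun_def indicator_def powr_add algebra_simps)
  also have "\<dots> = tilt \<alpha> b q w - tilt (\<alpha> + 1) b q w"
    unfolding tilt_def using assms by (intro Bochner_Integration.integral_diff tilt_fun_integrable) auto
  finally show ?thesis using tilt_pos[of \<alpha> "b + 1" q w] assms by simp
qed

text \<open>The derivative of \<open>l powr (\<alpha> + 1) * (1 + l * w) powr (1 - q) * \<beta> l\<close> is the difference of the two
  integrands plus a term with the sign of \<open>\<beta>'\<close>, and its integral is the nonnegative boundary value at \<open>1\<close>.\<close>

lemma weighted_integration_by_parts:
  fixes \<beta> \<beta>' :: "real \<Rightarrow> real"
  assumes \<alpha>: "-1 < \<alpha>" and w: "0 \<le> w"
    and cont: "continuous_on {0..1} \<beta>" and nonneg: "0 \<le> \<beta> 1"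
    and deriv: "\<And>l. 0 < l \<Longrightarrow> l < 1 \<Longrightarrow> (\<beta> has_real_derivative \<beta>' l) (at l)"
    and anti: "\<And>l. 0 < l \<Longrightarrow> l < 1 \<Longrightarrow> \<beta>' l \<le> 0"
    and i0: "set_integrable lborel {0<..<1} (\<lambda>l. l powr \<alpha> * \<beta> l * (1 + l * w) powr (- q))"
    and i1: "set_integrable lborel {0<..<1} (\<lambda>l. l powr (\<alpha> + 1) * \<beta> l * (1 + l * w) powr (- q))"
  shows "(q - \<alpha> - 2) * (w * (LBINT l:{0<..<1}. l powr (\<alpha> + 1) * \<beta> l * (1 + l * w) powr (- q)))
    \<le> (\<alpha> + 1) * (LBINT l:{0<..<1}. l powr \<alpha> * \<beta> l * (1 + l * w) powr (- q))"
proof -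
  let ?F = "\<lambda>l. l powr (\<alpha> + 1) * (1 + l * w) powr (1 - q) * \<beta> l"
  let ?G = "\<lambda>l. (\<alpha> + 1) * (l powr \<alpha> * \<beta> l * (1 + l * w) powr (- q))
      - (q - \<alpha> - 2) * w * (l powr (\<alpha> + 1) * \<beta> l * (1 + l * w) powr (- q))"
  let ?F' = "\<lambda>l. ?G l + l powr (\<alpha> + 1) * (1 + l * w) powr (1 - q) * \<beta>' l"
  have pos: "0 < 1 + l * w" if "0 \<le> l" for l using that w by (simp add: add_pos_nonneg)
  have d: "(?F has_vector_derivative ?F' l) (at l)" if l: "l \<in> {0<..<1}" for l
  proof -
    have l0: "0 < l" "l < 1" using l by auto
    have p1: "(1 + l * w) powr (1 - q) = (1 + l * w) * (1 + l * w) powr (- q)"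
      using powr_mult_base[of "1 + l * w" "- q"] pos[of l] l0 by simp
    have p2: "l powr (\<alpha> + 1) = l * l powr \<alpha>" using powr_mult_base[of l \<alpha>] l0 by (simp add: add.commute)
    have "(?F has_real_derivative
        (((\<alpha> + 1) * l powr (\<alpha> + 1 - 1)) * (1 + l * w) powr (1 - q)
          + l powr (\<alpha> + 1) * ((1 - q) * (1 + l * w) powr (1 - q - 1) * w)) * \<beta> l
        + (l powr (\<alpha> + 1) * (1 + l * w) powr (1 - q)) * \<beta>' l) (at l)"
      using l0 pos[of l] by (auto intro!: derivative_eq_intros deriv)
    moreover have "(((\<alpha> + 1) * l powr (\<alpha> + 1 - 1)) * (1 + l * w) powr (1 - q)
          + l powr (\<alpha> + 1) * ((1 - q) * (1 + l * w) powr (1 - q - 1) * w)) * \<beta> l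
        + (l powr (\<alpha> + 1) * (1 + l * w) powr (1 - q)) * \<beta>' l = ?F' l"
      by (simp only: p1 p2 add_diff_cancel_right') (simp add: algebra_simps)
    ultimately show ?thesis by (simp add: has_real_derivative_iff_has_vector_derivative)
  qed
  have "(?F' has_integral ?F 1 - ?F 0) {0..1}"
  proof (rule fundamental_theorem_of_calculus_interior)
    show "continuous_on {0..1} ?F"
    proof (intro continuous_on_mult cont)
      show "continuous_on {0..1} (\<lambda>l::real. l powr (\<alpha> + 1))"
        using \<alpha> by (intro continuous_on_powr' continuous_intros) auto
      show "continuous_on {0..1} (\<lambda>l. (1 + l * w) powr (1 - q))"
        by (intro continuous_on_powr continuous_intros ballI less_imp_neq[THEN not_sym] pos) auto
    qed
  qed (use d in auto)
  then have F: "(?F' has_integral ?F 1 - ?F 0) {0<..<1}" by (simp only: has_integral_Icc_iff_Ioo)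
  let ?I0 = "LBINT l:{0<..<1}. l powr \<alpha> * \<beta> l * (1 + l * w) powr (- q)"
  let ?I1 = "LBINT l:{0<..<1}. l powr (\<alpha> + 1) * \<beta> l * (1 + l * w) powr (- q)"
  have h: "(f has_integral (LBINT l:{0<..<1}. f l)) {0<..<1}" if "set_integrable lborel {0<..<1} f" for f :: "real \<Rightarrow> real"
    using set_borel_integral_eq_integral[OF that] by (simp add: has_integral_iff)
  have "(?G has_integral ((\<alpha> + 1) * ?I0 - (q - \<alpha> - 2) * w * ?I1)) {0<..<1}"
    by (intro has_integral_diff has_integral_mult_right h i0 i1)
  then have "?F 1 - ?F 0 \<le> (\<alpha> + 1) * ?I0 - (q - \<alpha> - 2) * w * ?I1"
  proof (rule has_integral_le[OF F])
    fix l :: real assume "l \<in> {0<..<1}"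
    then have "l powr (\<alpha> + 1) * (1 + l * w) powr (1 - q) * \<beta>' l \<le> 0"
      by (intro mult_nonneg_nonpos anti) auto
    then show "?F' l \<le> ?G l" by linarith
  qed
  moreover have "0 \<le> ?F 1 - ?F 0" using nonneg \<alpha> by simp
  ultimately show ?thesis by (simp add: mult.assoc)
qed

lemma tilt_ratio_bound:
  assumes "-1 < \<alpha>" "0 \<le> b" "0 \<le> q" "0 \<le> w"
  shows "(q - \<alpha> - 2) * (w * tilt (\<alpha> + 1) b q w) \<le> (\<alpha> + 1) * tilt \<alpha> b q w"
proof -
  \<comment> \<open>For \<open>b = 0\<close> the weight must be \<open>1\<close> at the right end point too, whereas \<open>0 powr 0 = 0\<close>.\<close>
  define \<beta> where "\<beta> l = (if b = 0 then 1 else (1 - l) powr b)" for l :: real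
  have e: "indicator {0<..<1} l *\<^sub>R (l powr \<gamma> * \<beta> l * (1 + l * w) powr (- q)) = tilt_fun \<gamma> b q w l" for \<gamma> l
    by (auto simp: \<beta>_def tilt_fun_def indicator_def)
  have t: "(LBINT l:{0<..<1}. l powr \<gamma> * \<beta> l * (1 + l * w) powr (- q)) = tilt \<gamma> b q w" for \<gamma>
    unfolding set_lebesgue_integral_def e tilt_def ..
  have i: "set_integrable lborel {0<..<1} (\<lambda>l. l powr \<gamma> * \<beta> l * (1 + l * w) powr (- q))" if "-1 < \<gamma>" for \<gamma>
    unfolding set_integrable_def e using tilt_fun_integrable[OF that, of b q w] assms by simp
  have "(q - \<alpha> - 2) * (w * (LBINT l:{0<..<1}. l powr (\<alpha> + 1) * \<beta> l * (1 + l * w) powr (- q)))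
    \<le> (\<alpha> + 1) * (LBINT l:{0<..<1}. l powr \<alpha> * \<beta> l * (1 + l * w) powr (- q))"
  proof (rule weighted_integration_by_parts[OF assms(1,4)])
    show "continuous_on {0..1} \<beta>"
    proof (cases "b = 0")
      case False
      then show ?thesis unfolding \<beta>_def using assms
        by simp (intro continuous_intros continuous_on_powr', auto)
    qed (simp add: \<beta>_def)
    show "(\<beta> has_real_derivative (- b * (1 - l) powr (b - 1))) (at l)" if "0 < l" "l < 1" for l
    proof (cases "b = 0")
      case False
      then show ?thesis unfolding \<beta>_def using that by (auto intro!: derivative_eq_intros)
    next
      case True
      then have "\<beta> = (\<lambda>_. 1)" by (simp add: \<beta>_def fun_eq_iff)
      then show ?thesis using True by simp
    qed
    show "0 \<le> \<beta> 1" by (simp add: \<beta>_def)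
    show "- b * (1 - l) powr (b - 1) \<le> 0" for l using assms by simp
    show "set_integrable lborel {0<..<1} (\<lambda>l. l powr \<alpha> * \<beta> l * (1 + l * w) powr (- q))"
      "set_integrable lborel {0<..<1} (\<lambda>l. l powr (\<alpha> + 1) * \<beta> l * (1 + l * w) powr (- q))"
      using assms by (auto intro: i)
  qed
  then show ?thesis unfolding t .
qed

text \<open>The substitution \<open>u = w l\<close> moves the parameter \<open>w\<close> from the factor \<open>(1 + l w) powr (- q)\<close> into the
  factor \<open>(1 - u / w) powr b\<close> and the range of integration.\<close>

lemma tilt_rescaled:
  assumes "0 < w"
  shows "tilt \<alpha> b q w = w powr (- \<alpha> - 1) *
    (LBINT u. indicator {0<..<w} u * (u powr \<alpha> * (1 - u / w) powr b * (1 + u) powr (- q)))"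
proof -
  let ?g = "\<lambda>u. indicator {0<..<w} u * (u powr \<alpha> * (1 - u / w) powr b * (1 + u) powr (- q))"
  have "(LBINT u. ?g u) = w * (LBINT l. ?g (w * l))"
    using assms by (subst lborel_integral_scale[where c = w]) auto
  also have "(LBINT l. ?g (w * l)) = (LBINT l. w powr \<alpha> * tilt_fun \<alpha> b q w l)"
    using assms by (intro Bochner_Integration.integral_cong refl)
      (auto simp: tilt_fun_def indicator_def powr_mult mult.commute zero_less_mult_iff)
  also have "\<dots> = w powr \<alpha> * tilt \<alpha> b q w" by (simp add: tilt_def)
  also have "w * (w powr \<alpha> * tilt \<alpha> b q w) = w powr (\<alpha> + 1) * tilt \<alpha> b q w"
    using powr_mult_base[of w \<alpha>] assms by (simp add: add.commute)
  finally have "w powr (- \<alpha> - 1) * (LBINT u. ?g u) = w powr ((- \<alpha> - 1) + (\<alpha> + 1)) * tilt \<alpha> b q w"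
    by (simp only: powr_add mult.assoc)
  then show ?thesis using assms by simp
qed

text \<open>After rescaling, \<open>w\<close> times the quotient is the mean of \<open>u\<close> under the density proportional to
  \<open>u powr \<alpha> * (1 - u / w) powr b * (1 + u) powr (- q)\<close> on \<open>(0, w)\<close>. For \<open>b \<ge> 0\<close> these densities have monotone
  likelihood ratio in \<open>w\<close>. Comparing the two densities on either side of the smaller mean \<open>m\<close>, where
  \<open>u - m\<close> changes sign, gives the inequality between the means.\<close>

lemma tilt_ratio_mono:
  assumes \<alpha>: "-1 < \<alpha>" and b: "0 \<le> b" and q: "0 \<le> q" and v: "0 \<le> v" "v \<le> w"
  shows "v * (tilt (\<alpha> + 1) b q v / tilt \<alpha> b q v) \<le> w * (tilt (\<alpha> + 1) b q w / tilt \<alpha> b q w)"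
proof (cases "v = 0 \<or> v = w")
  case True
  then show ?thesis
    using tilt_pos[of "\<alpha> + 1" b q w] tilt_pos[of \<alpha> b q w] assms by auto
next
  case False
  then have vw: "0 < v" "v < w" "0 < w" using v by auto
  define g where "g y \<gamma> u = indicator {0<..<y} u * (u powr \<gamma> * (1 - u / y) powr b * (1 + u) powr (- q))" for y \<gamma> u :: real
  define E where "E y \<gamma> = (LBINT u. g y \<gamma> u)" for y \<gamma>
  have T: "tilt \<gamma> b q y = y powr (- \<gamma> - 1) * E y \<gamma>" if "0 < y" for y \<gamma>
    using tilt_rescaled[OF that] by (simp add: E_def g_def)
  have Epos: "0 < E y \<gamma>" if "0 < y" "-1 < \<gamma>" for y \<gamma>
    using tilt_pos[of \<gamma> b q y] T[OF that(1), of \<gamma>] that b q by (simp add: zero_less_mult_iff)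
  have int: "integrable lborel (g y \<gamma>)" if "0 < y" "-1 < \<gamma>" for y \<gamma>
    using Epos[OF that] not_integrable_integral_eq[of lborel "g y \<gamma>"] by (auto simp: E_def)
  have ratio: "y * (tilt (\<alpha> + 1) b q y / tilt \<alpha> b q y) = E y (\<alpha> + 1) / E y \<alpha>" if "0 < y" for y
  proof -
    have "y * y powr (- (\<alpha> + 1) - 1) = y powr (- \<alpha> - 1)"
    proof -
      have "y * y powr (- (\<alpha> + 1) - 1) = y powr (1 + (- (\<alpha> + 1) - 1))"
        using that by (intro powr_mult_base) simp
      also have "1 + (- (\<alpha> + 1) - 1) = - \<alpha> - 1" by simp
      finally show ?thesis .
    qed
    then have "y * tilt (\<alpha> + 1) b q y = y powr (- \<alpha> - 1) * E y (\<alpha> + 1)"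
      unfolding T[OF that] by (simp only: mult.assoc[symmetric])
    then show ?thesis using that unfolding T[OF that, of \<alpha>] by simp
  qed
  define m where "m = E v (\<alpha> + 1) / E v \<alpha>"
  have m: "0 < m" "m < v"
  proof -
    show "0 < m" using Epos[of v] vw \<alpha> by (simp add: m_def)
    have "v * (tilt (\<alpha> + 1) b q v / tilt \<alpha> b q v) < v * 1"
      using vw tilt_Suc_less[of \<alpha> b q v] tilt_pos[of \<alpha> b q v] assms
      by (intro mult_strict_left_mono) auto
    then show "m < v" using ratio[OF vw(1)] by (simp add: m_def)
  qed
  have gSuc: "g y (\<alpha> + 1) u = u * g y \<alpha> u" for y u
    using powr_mult_base[of u \<alpha>] by (auto simp: g_def indicator_def add.commute mult_ac)
  have sub: "(LBINT u. (u - m) * g y \<alpha> u) = E y (\<alpha> + 1) - m * E y \<alpha>" "integrable lborel (\<lambda>u. (u - m) * g y \<alpha> u)" if "0 < y" for y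
  proof -
    have eq: "(u - m) * g y \<alpha> u = g y (\<alpha> + 1) u - m * g y \<alpha> u" for u
      unfolding gSuc by (simp add: algebra_simps)
    show "(LBINT u. (u - m) * g y \<alpha> u) = E y (\<alpha> + 1) - m * E y \<alpha>"
      unfolding eq E_def using int[of y] that \<alpha> by (subst Bochner_Integration.integral_diff) auto
    show "integrable lborel (\<lambda>u. (u - m) * g y \<alpha> u)"
      unfolding eq using int[of y] that \<alpha> by auto
  qed
  have "(1 - m / w) powr b * (E v (\<alpha> + 1) - m * E v \<alpha>) \<le> (1 - m / v) powr b * (E w (\<alpha> + 1) - m * E w \<alpha>)"
  proof -
    have "(LBINT u. (1 - m / w) powr b * ((u - m) * g v \<alpha> u)) \<le> (LBINT u. (1 - m / v) powr b * ((u - m) * g w \<alpha> u))"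
    proof (rule integral_mono)
      fix u
      show "(1 - m / w) powr b * ((u - m) * g v \<alpha> u) \<le> (1 - m / v) powr b * ((u - m) * g w \<alpha> u)"
      proof (cases "0 < u \<and> u < v")
        case True
        have cross: "(1 - m / w) * (1 - u / v) - (1 - m / v) * (1 - u / w) = (m - u) * (1 / v - 1 / w)"
          using vw by (simp add: field_simps)
        have r: "0 \<le> 1 / v - 1 / w" using vw by (simp add: frac_le)
        have f0: "0 \<le> 1 - m / w" "0 \<le> 1 - m / v" "0 \<le> 1 - u / w" "0 \<le> 1 - u / v"
          using True vw m by (auto simp: divide_le_eq_1)
        have key: "(u - m) * ((1 - m / w) * (1 - u / v)) powr b \<le> (u - m) * ((1 - m / v) * (1 - u / w)) powr b"
        proof (cases "u \<le> m")
          case u: True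
          have "((1 - m / v) * (1 - u / w)) \<le> (1 - m / w) * (1 - u / v)"
            using cross mult_nonneg_nonneg[of "m - u", OF _ r] u by linarith
          then show ?thesis using u f0 b by (intro mult_left_mono_neg powr_mono2) auto
        next
          case u: False
          have "(1 - m / w) * (1 - u / v) \<le> (1 - m / v) * (1 - u / w)"
            using cross mult_nonpos_nonneg[of "m - u", OF _ r] u by linarith
          then show ?thesis using u f0 b by (intro mult_left_mono powr_mono2) auto
        qed
        have "u powr \<alpha> * (1 + u) powr (- q) * ((u - m) * ((1 - m / w) * (1 - u / v)) powr b)
           \<le> u powr \<alpha> * (1 + u) powr (- q) * ((u - m) * ((1 - m / v) * (1 - u / w)) powr b)"
          by (intro mult_left_mono key) auto
        then show ?thesis
          using True vw f0 by (simp add: g_def powr_mult mult_ac)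
      next
        case False
        have "0 \<le> (u - m) * g w \<alpha> u"
        proof (cases "0 < u")
          case True
          then show ?thesis using False m by (intro mult_nonneg_nonneg) (auto simp: g_def)
        qed (simp add: g_def)
        moreover have "g v \<alpha> u = 0" using False by (auto simp: g_def indicator_def)
        ultimately show ?thesis by simp
      qed
    qed (use sub vw in auto)
    then show ?thesis using sub vw by simp
  qed
  moreover have "E v (\<alpha> + 1) - m * E v \<alpha> = 0" using Epos[of v \<alpha>] vw \<alpha> by (simp add: m_def)
  moreover have "0 < (1 - m / v) powr b" using m vw by simp
  ultimately have "0 \<le> E w (\<alpha> + 1) - m * E w \<alpha>"
    using mult_pos_neg[of "(1 - m / v) powr b" "E w (\<alpha> + 1) - m * E w \<alpha>"]
    by (metis mult_zero_right not_le)
  then have "m \<le> E w (\<alpha> + 1) / E w \<alpha>" using Epos[of w \<alpha>] vw \<alpha> by (simp add: field_simps)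
  then show ?thesis unfolding ratio[OF vw(1)] ratio[OF vw(3)] m_def .
qed

section \<open>The posterior and the generalized Bayes estimator\<close>

lemma Beta_pos_real: "0 < x \<Longrightarrow> 0 < y \<Longrightarrow> 0 < Beta x (y::real)"
  by (simp add: Beta_def Gamma_real_pos)

lemma mixing_dens_nonneg: "-1 < a \<Longrightarrow> -1 < b \<Longrightarrow> 0 \<le> mixing_dens a b l"
  using Beta_pos_real[of "a + 1" "b + 1"] by (simp add: mixing_dens_def)

text \<open>The posterior of \<open>(\<eta>, \<lambda>)\<close> up to normalisation, \<open>\<theta>\<close> being integrated out. The weight \<open>\<eta>\<close> of the loss
  cancels the prior density \<open>1/\<eta>\<close>.\<close>

definition kern :: "nat \<Rightarrow> real \<Rightarrow> real \<Rightarrow> (real ^ 'p::finite) \<times> real \<Rightarrow> real \<times> real \<Rightarrow> real" where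
  "kern n a b z \<omega> = indicator {0<..} (fst \<omega>) * indicator {0<..<1} (snd \<omega>) *
     (mixing_dens a b (snd \<omega>) * normal_dens 0 (fst \<omega> * snd \<omega>) (fst z) * chi n (fst \<omega>) (snd z))"

lemma kern_measurable [measurable]:
  assumes [measurable]: "f \<in> borel_measurable M" "g \<in> borel_measurable M"
  shows "(\<lambda>u. kern n a b (f u) (g u)) \<in> borel_measurable M"
  unfolding kern_def by measurable

lemma kern_nonneg: "0 < n \<Longrightarrow> -1 < a \<Longrightarrow> -1 < b \<Longrightarrow> 0 \<le> kern n a b z \<omega>"
  by (simp add: kern_def mixing_dens_nonneg)

text \<open>For fixed \<open>\<lambda>\<close> the kernel is a gamma density in \<open>\<eta>\<close> with rate \<open>s (1 + \<lambda> w) / 2\<close>, \<open>w = |x|\<^sup>2 / s\<close>. A power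
  of \<open>\<eta>\<close> only shifts the exponent \<open>q\<close>.\<close>

lemma kern_moment:
  fixes x :: "real ^ 'p::finite" and n :: nat and a b j :: real and f :: "real \<Rightarrow> real"
  defines "q \<equiv> (real CARD('p) + real n) / 2 + 1 + j"
  assumes n: "0 < n" and a: "-1 < a" and b: "-1 < b" and s: "0 < s" and q: "0 < q"
  obtains C where "0 < C"
    "\<And>f. f \<in> borel_measurable borel \<Longrightarrow> (\<And>l. 0 \<le> f l) \<Longrightarrow>
      (\<integral>\<^sup>+\<omega>. ennreal (fst \<omega> powr j * f (snd \<omega>) * kern n a b (x, s) \<omega>) \<partial>lborel)
      = ennreal C * (\<integral>\<^sup>+l. ennreal (f l * tilt_fun (real CARD('p) / 2 + a) b q ((norm x)\<^sup>2 / s) l) \<partial>lborel)"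
proof
  let ?p = "real CARD('p)"
  let ?w = "(norm x)\<^sup>2 / s"
  define c where "c = s powr (real n / 2 - 1) / (Beta (a + 1) (b + 1) * ((2 * pi) powr (?p / 2) * (Gamma (real n / 2) * 2 powr (real n / 2))))"
  define C where "C = c * (Gamma q * (s / 2) powr (- q))"
  have c: "0 < c"
    using n a b s Beta_pos_real[of "a + 1" "b + 1"] by (simp add: c_def Gamma_real_pos)
  show "0 < C" using c q s by (simp add: C_def Gamma_real_pos)
  fix f :: "real \<Rightarrow> real" assume f[measurable]: "f \<in> borel_measurable borel" and f0: "\<And>l. 0 \<le> f l"
  have kern: "\<eta> powr j * f l * kern n a b (x, s) (\<eta>, l)
     = (f l * (indicator {0<..<1} l * (c * (l powr (?p / 2 + a) * (1 - l) powr b)))) *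
       (indicator {0<..} \<eta> * (\<eta> powr (q - 1) * exp (- (s / 2 * (1 + l * ?w) * \<eta>))))" for \<eta> l
  proof (cases "0 < \<eta> \<and> 0 < l \<and> l < 1")
    case True
    have e1: "exp (- (\<eta> * l / 2) * (norm (x - 0))\<^sup>2) * exp (- (\<eta> * s / 2)) = exp (- (s / 2 * (1 + l * ?w) * \<eta>))"
      using s by (subst mult_exp_exp) (simp add: field_simps)
    have e2: "\<eta> powr (q - 1) = \<eta> powr j * (\<eta> powr (?p / 2) * \<eta> powr (real n / 2))"
      unfolding q_def by (simp add: powr_add[symmetric] add_divide_distrib algebra_simps)
    have e3: "l powr (?p / 2 + a) = l powr (?p / 2) * l powr a" by (rule powr_add)
    show ?thesis
      unfolding e1[symmetric] e2 e3
      using True s by (simp add: kern_def mixing_dens_def normal_dens_def chi_def scaled_chisq_dens_def c_def powr_mult mult_ac)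
  qed (auto simp: kern_def)
  have "(\<integral>\<^sup>+\<omega>. ennreal (fst \<omega> powr j * f (snd \<omega>) * kern n a b (x, s) \<omega>) \<partial>lborel)
     = (\<integral>\<^sup>+l. \<integral>\<^sup>+\<eta>. ennreal (\<eta> powr j * f l * kern n a b (x, s) (\<eta>, l)) \<partial>lborel \<partial>lborel)"
    by (subst nn_integral_lborel_pair(2)) auto
  also have "\<dots> = (\<integral>\<^sup>+l. ennreal C * ennreal (f l * tilt_fun (?p / 2 + a) b q ?w l) \<partial>lborel)"
  proof (rule nn_integral_cong)
    fix l :: real
    let ?g = "f l * (indicator {0<..<1} l * (c * (l powr (?p / 2 + a) * (1 - l) powr b)))"
    have g0: "0 \<le> ?g" using f0[of l] c by simp
    show "(\<integral>\<^sup>+\<eta>. ennreal (\<eta> powr j * f l * kern n a b (x, s) (\<eta>, l)) \<partial>lborel)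
        = ennreal C * ennreal (f l * tilt_fun (?p / 2 + a) b q ?w l)"
    proof (cases "0 < l \<and> l < 1")
      case True
      have w: "0 < 1 + l * ?w" using True s by (simp add: add_pos_nonneg)
      have "(\<integral>\<^sup>+\<eta>. ennreal (\<eta> powr j * f l * kern n a b (x, s) (\<eta>, l)) \<partial>lborel)
        = (\<integral>\<^sup>+\<eta>. ennreal ?g * ennreal (indicator {0<..} \<eta> * (\<eta> powr (q - 1) * exp (- (s / 2 * (1 + l * ?w) * \<eta>)))) \<partial>lborel)"
        unfolding kern by (intro nn_integral_cong ennreal_mult g0) auto
      also have "\<dots> = ennreal ?g * ennreal (Gamma q / (s / 2 * (1 + l * ?w)) powr q)"
      proof -
        have "(\<integral>\<^sup>+\<eta>. ennreal (indicator {0<..} \<eta> * (\<eta> powr (q - 1) * exp (- (s / 2 * (1 + l * ?w) * \<eta>)))) \<partial>lborel)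
          = ennreal (Gamma q / (s / 2 * (1 + l * ?w)) powr q)"
          using s w q by (intro nn_integral_gamma) auto
        then show ?thesis by (subst nn_integral_cmult) auto
      qed
      also have "\<dots> = ennreal (?g * (Gamma q / (s / 2 * (1 + l * ?w)) powr q))"
        using q by (intro ennreal_mult[symmetric] g0) (simp add: Gamma_real_pos less_imp_le)
      also have "?g * (Gamma q / (s / 2 * (1 + l * ?w)) powr q) = C * (f l * tilt_fun (?p / 2 + a) b q ?w l)"
      proof -
        have "Gamma q / (s / 2 * (1 + l * ?w)) powr q = Gamma q * (s / 2) powr (- q) * (1 + l * ?w) powr (- q)"
          by (simp only: powr_mult powr_minus_divide) simp
        then show ?thesis by (simp only: C_def tilt_fun_def mult_ac)
      qed
      also have "ennreal \<dots> = ennreal C * ennreal (f l * tilt_fun (?p / 2 + a) b q ?w l)"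
        using c q f0[of l] by (intro ennreal_mult) (auto simp: C_def Gamma_real_pos less_imp_le)
      finally show ?thesis .
    qed (auto simp: kern_def tilt_fun_def)
  qed
  also have "\<dots> = ennreal C * (\<integral>\<^sup>+l. ennreal (f l * tilt_fun (?p / 2 + a) b q ?w l) \<partial>lborel)"
    by (rule nn_integral_cmult) measurable
  finally show "(\<integral>\<^sup>+\<omega>. ennreal (fst \<omega> powr j * f (snd \<omega>) * kern n a b (x, s) \<omega>) \<partial>lborel)
      = ennreal C * (\<integral>\<^sup>+l. ennreal (f l * tilt_fun (?p / 2 + a) b q ?w l) \<partial>lborel)" .
qed

lemma nn_integral_tilt_fun:
  assumes "-1 < \<alpha>" "-1 < b" "0 \<le> q" "0 \<le> w"
  shows "(\<integral>\<^sup>+l. ennreal (tilt_fun \<alpha> b q w l) \<partial>lborel) = ennreal (tilt \<alpha> b q w)"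
  unfolding tilt_def by (intro nn_integral_eq_integral tilt_fun_integrable assms) simp

lemma kern_integrals:
  fixes x :: "real ^ 'p::finite" and n :: nat and a b :: real
  defines "q \<equiv> (real CARD('p) + real n) / 2 + 1" and "\<alpha> \<equiv> real CARD('p) / 2 + a"
  assumes n: "0 < n" and a: "-1 < a" and b: "-1 < b" and s: "0 < s"
  obtains C where "0 < C"
    "has_bochner_integral lborel (kern n a b (x, s)) (C * tilt \<alpha> b q ((norm x)\<^sup>2 / s))"
    "has_bochner_integral lborel (\<lambda>\<omega>. snd \<omega> * kern n a b (x, s) \<omega>) (C * tilt (\<alpha> + 1) b q ((norm x)\<^sup>2 / s))"
    "integrable lborel (\<lambda>\<omega>. inverse (fst \<omega>) * kern n a b (x, s) \<omega>)"
proof -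
  let ?w = "(norm x)\<^sup>2 / s"
  have w: "0 \<le> ?w" using s by simp
  have p: "1 \<le> real CARD('p)" by (simp add: Suc_le_eq)
  have \<alpha>: "-1 < \<alpha>" using a p by (simp add: \<alpha>_def)
  have "0 < real n" using n by simp
  then have "0 < (real CARD('p) + real n) / 2"
    using p by (intro divide_pos_pos add_pos_pos) auto
  then have q: "0 < q + (-1)" "0 < q" unfolding q_def by (simp, intro add_pos_pos zero_less_one)
  have k0: "0 \<le> kern n a b (x, s) \<omega>" for \<omega> using kern_nonneg[OF n a b] .
  have q1: "0 < (real CARD('p) + real n) / 2 + 1 + 0" and q2: "0 < (real CARD('p) + real n) / 2 + 1 + (-1)"
    using q unfolding q_def by simp_all
  obtain C where C: "0 < C"
    "\<And>f. f \<in> borel_measurable borel \<Longrightarrow> (\<And>l. 0 \<le> f l) \<Longrightarrow>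
      (\<integral>\<^sup>+\<omega>. ennreal (fst \<omega> powr 0 * f (snd \<omega>) * kern n a b (x, s) \<omega>) \<partial>lborel)
      = ennreal C * (\<integral>\<^sup>+l. ennreal (f l * tilt_fun (real CARD('p) / 2 + a) b ((real CARD('p) + real n) / 2 + 1 + 0) ?w l) \<partial>lborel)"
    by (rule kern_moment[where x = x, OF n a b s q1], rule that) (assumption, blast)
  obtain C' where C': "0 < C'"
    "\<And>f. f \<in> borel_measurable borel \<Longrightarrow> (\<And>l. 0 \<le> f l) \<Longrightarrow>
      (\<integral>\<^sup>+\<omega>. ennreal (fst \<omega> powr (-1) * f (snd \<omega>) * kern n a b (x, s) \<omega>) \<partial>lborel)
      = ennreal C' * (\<integral>\<^sup>+l. ennreal (f l * tilt_fun (real CARD('p) / 2 + a) b ((real CARD('p) + real n) / 2 + 1 + (-1)) ?w l) \<partial>lborel)"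
    by (rule kern_moment[where x = x, OF n a b s q2], rule that) (assumption, blast)
  note C = C(1) C(2)[unfolded add_0_right, folded q_def \<alpha>_def]
  note C' = C'(2)[folded q_def \<alpha>_def]
  have z: "fst \<omega> powr 0 * g * kern n a b (x, s) \<omega> = g * kern n a b (x, s) \<omega>"
    "fst \<omega> powr (-1) * g * kern n a b (x, s) \<omega> = inverse (fst \<omega>) * g * kern n a b (x, s) \<omega>" for \<omega> g
    by (auto simp: kern_def indicator_def powr_minus)
  have "(\<integral>\<^sup>+\<omega>. ennreal (kern n a b (x, s) \<omega>) \<partial>lborel) = ennreal (C * tilt \<alpha> b q ?w)"
    using C(2)[of "\<lambda>_. 1"] C(1) \<alpha> b q w tilt_pos[OF \<alpha> b _ w, of q]
    unfolding z by (simp add: nn_integral_tilt_fun ennreal_mult)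
  moreover have "(\<integral>\<^sup>+\<omega>. ennreal (snd \<omega> * kern n a b (x, s) \<omega>) \<partial>lborel) = ennreal (C * tilt (\<alpha> + 1) b q ?w)"
  proof -
    have e1: "max 0 (snd \<omega>) * kern n a b (x, s) \<omega> = snd \<omega> * kern n a b (x, s) \<omega>" for \<omega>
      by (auto simp: kern_def indicator_def)
    have e2: "max 0 l * tilt_fun \<alpha> b q ?w l = tilt_fun (\<alpha> + 1) b q ?w l" for l
      using powr_mult_base[of l \<alpha>] by (auto simp: tilt_fun_def indicator_def add.commute)
    show ?thesis
      using C(2)[of "max 0"] C(1) \<alpha> b q w tilt_pos[of "\<alpha> + 1" b q ?w]
      unfolding z e1 e2 by (simp add: nn_integral_tilt_fun ennreal_mult)
  qed
  moreover have "integrable lborel (\<lambda>\<omega>. inverse (fst \<omega>) * kern n a b (x, s) \<omega>)"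
  proof (rule integrableI_nonneg)
    show "AE \<omega> in lborel. 0 \<le> inverse (fst \<omega>) * kern n a b (x, s) \<omega>"
    proof (intro AE_I2)
      fix \<omega> :: "real \<times> real"
      show "0 \<le> inverse (fst \<omega>) * kern n a b (x, s) \<omega>"
        using k0[of \<omega>] by (cases "0 < fst \<omega>") (simp, simp add: kern_def)
    qed
    show "(\<integral>\<^sup>+\<omega>. ennreal (inverse (fst \<omega>) * kern n a b (x, s) \<omega>) \<partial>lborel) < \<infinity>"
      using C'[of "\<lambda>_. 1"] \<alpha> b q w
      unfolding z by (simp add: nn_integral_tilt_fun ennreal_mult_less_top)
  qed measurable
  moreover have "0 \<le> C * tilt \<alpha> b q ?w" "0 \<le> C * tilt (\<alpha> + 1) b q ?w"
    using C(1) tilt_pos[of \<alpha> b q ?w] tilt_pos[of "\<alpha> + 1" b q ?w] \<alpha> b q w by (auto simp: less_imp_le)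
  moreover have "AE \<omega> in lborel. 0 \<le> snd \<omega> * kern n a b (x, s) \<omega>"
  proof (intro AE_I2)
    fix \<omega> :: "real \<times> real"
    show "0 \<le> snd \<omega> * kern n a b (x, s) \<omega>"
      using k0[of \<omega>] by (cases "0 < snd \<omega>") (simp, simp add: kern_def)
  qed
  ultimately show thesis
    using C(1) k0 by (intro that[of C] has_bochner_integral_nn_integral) auto
qed

lemma kern_integral_pos:
  fixes x :: "real ^ 'p::finite"
  assumes n: "0 < n" and a: "-1 < a" and b: "-1 < b" and s: "0 < s"
  shows "0 < integral\<^sup>L lborel (kern n a b (x, s))"
proof (rule kern_integrals[OF assms, of x])
  have p: "1 \<le> real CARD('p)" by (simp add: Suc_le_eq)
  fix C assume "0 < C" "has_bochner_integral lborel (kern n a b (x, s))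
    (C * tilt (real CARD('p) / 2 + a) b ((real CARD('p) + real n) / 2 + 1) ((norm x)\<^sup>2 / s))"
  moreover have "0 < tilt (real CARD('p) / 2 + a) b ((real CARD('p) + real n) / 2 + 1) ((norm x)\<^sup>2 / s)"
    using a b s p by (intro tilt_pos) auto
  ultimately show ?thesis by (simp add: has_bochner_integral_iff)
qed

lemma kern_integrable:
  fixes x :: "real ^ 'p::finite"
  assumes "0 < n" "-1 < a" "-1 < b" "0 < s"
  shows "integrable lborel (kern n a b (x, s))"
    and "integrable lborel (\<lambda>\<omega>. snd \<omega> * kern n a b (x, s) \<omega>)"
    and "integrable lborel (\<lambda>\<omega>. inverse (fst \<omega>) * kern n a b (x, s) \<omega>)"
  by (rule kern_integrals[OF assms, of x]; simp add: has_bochner_integral_iff)+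

definition post_mean :: "nat \<Rightarrow> real \<Rightarrow> real \<Rightarrow> (real ^ 'p::finite) \<times> real \<Rightarrow> real" where
  "post_mean n a b z = (LBINT \<omega>. snd \<omega> * kern n a b z \<omega>) / (LBINT \<omega>. kern n a b z \<omega>)"

lemma post_mean_measurable [measurable]: "post_mean n a b \<in> borel_measurable borel"
  unfolding post_mean_def[abs_def] by measurable

definition shrink :: "nat \<Rightarrow> nat \<Rightarrow> real \<Rightarrow> real \<Rightarrow> real \<Rightarrow> real" where
  "shrink p n a b w = tilt (real p / 2 + a + 1) b ((real p + real n) / 2 + 1) w
     / tilt (real p / 2 + a) b ((real p + real n) / 2 + 1) w"

lemma post_mean_eq_shrink:
  fixes x :: "real ^ 'p::finite"
  assumes "0 < n" "-1 < a" "-1 < b" "0 < s"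
  shows "post_mean n a b (x, s) = shrink CARD('p) n a b ((norm x)\<^sup>2 / s)"
  by (rule kern_integrals[OF assms, of x])
     (simp add: post_mean_def shrink_def has_bochner_integral_iff)

text \<open>Scaling by a nonzero vector is injective, so for nonintegrable \<open>f\<close> the left integrand is
  nonintegrable too and both sides are \<open>0\<close>.\<close>

lemma integral_scaleR_left_all:
  fixes c :: "'b::euclidean_space"
  shows "(\<integral>x. f x *\<^sub>R c \<partial>M) = integral\<^sup>L M f *\<^sub>R c"
proof (cases "c = 0")
  case False
  have T': "bounded_linear (\<lambda>v. 1 / (c \<bullet> c) * (v \<bullet> c))"
    by (rule bounded_linear_const_mult[OF bounded_linear_inner_left])
  show ?thesis
    by (rule integral_bounded_linear'[OF bounded_linear_scaleR_left T']) (use False in auto)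
qed simp

lemma hierarchical_joint_density:
  fixes x \<theta> :: "real ^ 'p::finite"
  assumes \<eta>: "0 < \<eta>" and l: "0 < l" "l < 1"
  shows "normal_dens \<theta> \<eta> x * normal_dens 0 (\<eta> * (l / (1 - l))) \<theta>
    = normal_dens 0 (\<eta> * l) x * normal_dens ((1 - l) *\<^sub>R x) (\<eta> / (1 - l)) \<theta>"
proof -
  let ?\<alpha> = "\<eta> * (l / (1 - l))"
  have "?\<alpha> + \<eta> = \<eta> / (1 - l)" using l by (simp add: field_simps)
  moreover have "?\<alpha> * \<eta> / (\<eta> / (1 - l)) = \<eta> * l" "\<eta> / (\<eta> / (1 - l)) = 1 - l"
    using l \<eta> by (simp_all add: field_simps)
  ultimately show ?thesis
    using normal_dens_times_normal_dens[of ?\<alpha> \<eta> \<theta> x] \<eta> l by simp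
qed

text \<open>The integrals in \<open>gen_bayes\<close> are interchanged so that \<open>\<theta>\<close> is integrated first; for fixed \<open>(\<eta>, \<lambda>)\<close> it
  is then normal with mean \<open>(1 - \<lambda>) x\<close>. Fubini's theorem needs \<open>|\<theta>|\<close> times the joint density \<open>F\<close> to be
  integrable, which holds because \<open>|\<theta>| \<le> 1 + |\<theta>|\<^sup>2\<close> and \<open>\<theta>\<close> has a second moment of order \<open>1 + 1/\<eta>\<close>.\<close>

lemma gen_bayes_eq:
  fixes x :: "real ^ 'p::finite"
  assumes n: "0 < n" and a: "-1 < a" and b: "-1 < b" and s: "0 < s"
  shows "gen_bayes n a b (x, s) = (1 - post_mean n a b (x, s)) *\<^sub>R x"
proof -
  let ?k = "kern n a b (x, s)"
  define F where "F \<theta> \<omega> = ?k \<omega> * normal_dens ((1 - snd \<omega>) *\<^sub>R x) (fst \<omega> / (1 - snd \<omega>)) \<theta>" for \<theta> \<omega>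
  have k0: "0 \<le> ?k \<omega>" for \<omega> using kern_nonneg[OF n a b] .
  have kz: "?k \<omega> = 0" if "\<not> (0 < fst \<omega> \<and> 0 < snd \<omega> \<and> snd \<omega> < 1)" for \<omega>
    using that by (auto simp: kern_def)
  have ik: "integrable lborel ?k" "integrable lborel (\<lambda>\<omega>. snd \<omega> * ?k \<omega>)"
    "integrable lborel (\<lambda>\<omega>. inverse (fst \<omega>) * ?k \<omega>)"
    using kern_integrable[OF n a b s, of x] by simp_all
  have kpos: "0 < integral\<^sup>L lborel ?k" by (rule kern_integral_pos[OF n a b s])
  have [measurable]: "case_prod F \<in> borel_measurable (lborel \<Otimes>\<^sub>M lborel)"
    unfolding F_def lborel_prod by (simp add: case_prod_beta) measurable
  have F0: "0 \<le> F \<theta> \<omega>" for \<theta> \<omega> by (simp add: F_def k0)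
  have fibre: "has_bochner_integral lborel (\<lambda>\<theta>. (1 + (norm (0 - \<theta>))\<^sup>2) * F \<theta> \<omega>)
      (?k \<omega> * (1 + (norm (0 - (1 - snd \<omega>) *\<^sub>R x))\<^sup>2 + real CARD('p) / (fst \<omega> / (1 - snd \<omega>))))
    \<and> has_bochner_integral lborel (\<lambda>\<theta>. F \<theta> \<omega>) (?k \<omega>)
    \<and> (LBINT \<theta>. F \<theta> \<omega> *\<^sub>R \<theta>) = (?k \<omega> * (1 - snd \<omega>)) *\<^sub>R x" for \<omega>
  proof (cases "0 < fst \<omega> \<and> 0 < snd \<omega> \<and> snd \<omega> < 1")
    case True
    let ?N = "normal_dens ((1 - snd \<omega>) *\<^sub>R x) (fst \<omega> / (1 - snd \<omega>))"
    have t: "0 < fst \<omega> / (1 - snd \<omega>)" using True by simp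
    have N1: "has_bochner_integral lborel ?N 1"
      using integrable_normal_dens[OF t, of "(1 - snd \<omega>) *\<^sub>R x"] by (simp add: has_bochner_integral_iff)
    have "has_bochner_integral lborel (\<lambda>\<theta>. ?k \<omega> * (?N \<theta> + (norm (0 - \<theta>))\<^sup>2 * ?N \<theta>))
      (?k \<omega> * (1 + ((norm (0 - (1 - snd \<omega>) *\<^sub>R x))\<^sup>2 + real CARD('p) / (fst \<omega> / (1 - snd \<omega>)))))"
      by (intro has_bochner_integral_mult_right has_bochner_integral_add N1 has_bochner_integral_normal_dens_sq t)
    then have "has_bochner_integral lborel (\<lambda>\<theta>. (1 + (norm (0 - \<theta>))\<^sup>2) * F \<theta> \<omega>)
      (?k \<omega> * (1 + (norm (0 - (1 - snd \<omega>) *\<^sub>R x))\<^sup>2 + real CARD('p) / (fst \<omega> / (1 - snd \<omega>))))"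
      by (simp add: F_def algebra_simps)
    moreover have "has_bochner_integral lborel (\<lambda>\<theta>. F \<theta> \<omega>) (?k \<omega>)"
      unfolding F_def using has_bochner_integral_mult_right[OF N1, of "?k \<omega>"] by simp
    moreover have "(LBINT \<theta>. F \<theta> \<omega> *\<^sub>R \<theta>) = (?k \<omega> * (1 - snd \<omega>)) *\<^sub>R x"
      using normal_mean[OF t, of "(1 - snd \<omega>) *\<^sub>R x"]
      by (simp add: F_def scaleR_scaleR[symmetric] del: scaleR_scaleR)
    ultimately show ?thesis by blast
  qed (simp add: F_def kz has_bochner_integral_zero)
  note fib = conjunct1[OF fibre] conjunct1[OF conjunct2[OF fibre]] conjunct2[OF conjunct2[OF fibre]]
  have dom: "integrable (lborel \<Otimes>\<^sub>M lborel) (case_prod (\<lambda>\<theta> \<omega>. (1 + (norm (0 - \<theta>))\<^sup>2) * F \<theta> \<omega>))"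
  proof (rule integrableI_nonneg)
    show "(\<integral>\<^sup>+z. ennreal (case z of (\<theta>, \<omega>) \<Rightarrow> (1 + (norm (0 - \<theta>))\<^sup>2) * F \<theta> \<omega>) \<partial>(lborel \<Otimes>\<^sub>M lborel)) < \<infinity>"
    proof -
      have "(\<integral>\<^sup>+z. ennreal (case z of (\<theta>, \<omega>) \<Rightarrow> (1 + (norm (0 - \<theta>))\<^sup>2) * F \<theta> \<omega>) \<partial>(lborel \<Otimes>\<^sub>M lborel))
        = (\<integral>\<^sup>+\<omega>. \<integral>\<^sup>+\<theta>. ennreal ((1 + (norm (0 - \<theta>))\<^sup>2) * F \<theta> \<omega>) \<partial>lborel \<partial>lborel)"
        by (subst lborel_pair.nn_integral_snd[symmetric]) auto
      also have "\<dots> = (\<integral>\<^sup>+\<omega>. ennreal (?k \<omega> * (1 + (norm (0 - (1 - snd \<omega>) *\<^sub>R x))\<^sup>2 + real CARD('p) / (fst \<omega> / (1 - snd \<omega>)))) \<partial>lborel)"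
        using fib(1) F0 by (intro nn_integral_cong, subst nn_integral_eq_integral) (auto simp: has_bochner_integral_iff)
      also have "\<dots> \<le> (\<integral>\<^sup>+\<omega>. ennreal ((1 + (norm x)\<^sup>2) * ?k \<omega> + real CARD('p) * (inverse (fst \<omega>) * ?k \<omega>)) \<partial>lborel)"
      proof (intro nn_integral_mono ennreal_leI)
        fix \<omega> :: "real \<times> real"
        show "?k \<omega> * (1 + (norm (0 - (1 - snd \<omega>) *\<^sub>R x))\<^sup>2 + real CARD('p) / (fst \<omega> / (1 - snd \<omega>)))
           \<le> (1 + (norm x)\<^sup>2) * ?k \<omega> + real CARD('p) * (inverse (fst \<omega>) * ?k \<omega>)"
        proof (cases "0 < fst \<omega> \<and> 0 < snd \<omega> \<and> snd \<omega> < 1")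
          case True
          have "norm (0 - (1 - snd \<omega>) *\<^sub>R x) \<le> norm x" using True by (simp add: mult_left_le_one_le)
          then have 1: "(norm (0 - (1 - snd \<omega>) *\<^sub>R x))\<^sup>2 \<le> (norm x)\<^sup>2" by (intro power_mono) auto
          have 2: "real CARD('p) / (fst \<omega> / (1 - snd \<omega>)) \<le> real CARD('p) * inverse (fst \<omega>)"
            using True by (simp add: field_simps)
          have "?k \<omega> * (1 + (norm (0 - (1 - snd \<omega>) *\<^sub>R x))\<^sup>2 + real CARD('p) / (fst \<omega> / (1 - snd \<omega>)))
             \<le> ?k \<omega> * (1 + (norm x)\<^sup>2 + real CARD('p) * inverse (fst \<omega>))"
            using 1 2 by (intro mult_left_mono add_mono k0) auto
          then show ?thesis by (simp only: distrib_left distrib_right mult_ac mult_1_left mult_1_right)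
        qed (simp add: kz)
      qed
      also have "\<dots> < \<infinity>"
      proof -
        have "integrable lborel (\<lambda>\<omega>. (1 + (norm x)\<^sup>2) * ?k \<omega> + real CARD('p) * (inverse (fst \<omega>) * ?k \<omega>))"
          by (intro Bochner_Integration.integrable_add integrable_mult_right ik)
        then show ?thesis by (subst nn_integral_eq_integral) (auto simp: k0 kern_def indicator_def mixing_dens_nonneg[OF a b] n)
      qed
      finally show ?thesis .
    qed
  qed (auto simp: F0)
  have iF: "integrable (lborel \<Otimes>\<^sub>M lborel) (case_prod F)"
    by (rule Bochner_Integration.integrable_bound[OF dom])
       (auto simp: F0 abs_mult distrib_right intro!: AE_I2)
  have iFv: "integrable (lborel \<Otimes>\<^sub>M lborel) (case_prod (\<lambda>\<theta> \<omega>. F \<theta> \<omega> *\<^sub>R \<theta>))"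
  proof (rule Bochner_Integration.integrable_bound[OF dom])
    show "AE z in lborel \<Otimes>\<^sub>M lborel. norm (case z of (\<theta>, \<omega>) \<Rightarrow> F \<theta> \<omega> *\<^sub>R \<theta>)
      \<le> norm (case z of (\<theta>, \<omega>) \<Rightarrow> (1 + (norm (0 - \<theta>))\<^sup>2) * F \<theta> \<omega>)"
    proof (intro AE_I2, clarify)
      fix \<theta> :: "real ^ 'p" and \<eta> l :: real
      have "norm \<theta> * F \<theta> (\<eta>, l) \<le> (1 + (norm \<theta>)\<^sup>2) * F \<theta> (\<eta>, l)"
        by (intro mult_right_mono F0 norm_le_one_plus_square)
      then show "norm (F \<theta> (\<eta>, l) *\<^sub>R \<theta>) \<le> norm ((1 + (norm (0 - \<theta>))\<^sup>2) * F \<theta> (\<eta>, l))"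
        using F0[of \<theta> "(\<eta>, l)"] by (simp add: abs_mult mult.commute)
    qed
  qed measurable
  define G where "G \<theta> = (LBINT \<eta>:{0<..}. \<eta> * normal_dens \<theta> \<eta> x * scaled_chisq_dens n \<eta> s * prior_dens a b \<theta> \<eta>)" for \<theta>
  have G: "G \<theta> = (LBINT \<eta>. LBINT l. F \<theta> (\<eta>, l))" for \<theta>
    unfolding G_def set_lebesgue_integral_def
  proof (intro Bochner_Integration.integral_cong refl)
    fix \<eta> :: real
    show "indicator {0<..} \<eta> *\<^sub>R (\<eta> * normal_dens \<theta> \<eta> x * scaled_chisq_dens n \<eta> s * prior_dens a b \<theta> \<eta>) = (LBINT l. F \<theta> (\<eta>, l))"
    proof (cases "0 < \<eta>")
      case True
      let ?A = "\<eta> * normal_dens \<theta> \<eta> x * scaled_chisq_dens n \<eta> s"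
      have "?A * prior_dens a b \<theta> \<eta> = (LBINT l. ?A * (indicator {0<..<1} l *\<^sub>R
          (normal_dens 0 (inverse (1 / \<eta> * ((1 - l) / l))) \<theta> * mixing_dens a b l * (1 / \<eta>))))"
        unfolding prior_dens_hierarchical[OF True] set_lebesgue_integral_def
        by (rule integral_mult_right_zero[symmetric])
      also have "\<dots> = (LBINT l. F \<theta> (\<eta>, l))"
      proof (intro Bochner_Integration.integral_cong refl)
        fix l :: real
        show "?A * (indicator {0<..<1} l *\<^sub>R (normal_dens 0 (inverse (1 / \<eta> * ((1 - l) / l))) \<theta> * mixing_dens a b l * (1 / \<eta>))) = F \<theta> (\<eta>, l)"
        proof (cases "0 < l \<and> l < 1")
          case l: True
          have "inverse (1 / \<eta> * ((1 - l) / l)) = \<eta> * (l / (1 - l))" using l True by (simp add: field_simps)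
          then have "?A * (normal_dens 0 (inverse (1 / \<eta> * ((1 - l) / l))) \<theta> * mixing_dens a b l * (1 / \<eta>))
            = mixing_dens a b l * scaled_chisq_dens n \<eta> s * (normal_dens \<theta> \<eta> x * normal_dens 0 (\<eta> * (l / (1 - l))) \<theta>)"
            using True by simp
          also have "\<dots> = F \<theta> (\<eta>, l)"
            unfolding hierarchical_joint_density[OF True conjunct1[OF l] conjunct2[OF l]]
            using True l s by (simp add: F_def kern_def chi_def)
          finally show ?thesis using l by simp
        qed (simp add: F_def kern_def)
      qed
      finally show ?thesis using True by simp
    qed (simp add: F_def kern_def)
  qed
  \<comment> \<open>Only almost everywhere: at \<open>\<theta> = 0\<close> the integral defining the prior density may diverge.\<close>
  have AEG: "AE \<theta> in lborel. G \<theta> = (LBINT \<omega>. F \<theta> \<omega>)"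
    using lborel_pair.AE_integrable_fst[OF iF]
  proof eventually_elim
    fix \<theta> assume "integrable lborel (F \<theta>)"
    then have "integrable (lborel \<Otimes>\<^sub>M lborel) (F \<theta>)" by (simp add: lborel_prod)
    from lborel_pair.integral_fst'[OF this] show "G \<theta> = (LBINT \<omega>. F \<theta> \<omega>)" by (simp add: G lborel_prod)
  qed
  have mF: "(\<lambda>\<theta>. LBINT \<omega>. F \<theta> \<omega>) \<in> borel_measurable lborel"
    using borel_measurable_integrable[OF lborel_pair.integrable_fst[OF iF]] .
  have mG: "G \<in> borel_measurable lborel"
    unfolding G[abs_def]
  proof -
    have "(\<lambda>((\<theta>, \<eta>), l). F \<theta> (\<eta>, l)) \<in> borel_measurable (borel \<Otimes>\<^sub>M borel)"
      unfolding F_def case_prod_beta borel_prod by measurable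
    then have "(\<lambda>(\<theta>, \<eta>). LBINT l. F \<theta> (\<eta>, l)) \<in> borel_measurable (borel \<Otimes>\<^sub>M borel)"
      unfolding F_def by measurable
    then show "(\<lambda>\<theta>. LBINT \<eta>. LBINT l. F \<theta> (\<eta>, l)) \<in> borel_measurable lborel"
      unfolding F_def by measurable
  qed
  have den: "(LBINT \<theta>. G \<theta>) = integral\<^sup>L lborel ?k"
  proof -
    have "(LBINT \<theta>. G \<theta>) = (LBINT \<theta>. LBINT \<omega>. F \<theta> \<omega>)"
      by (rule integral_cong_AE[OF mG mF AEG])
    also have "\<dots> = (LBINT \<omega>. LBINT \<theta>. F \<theta> \<omega>)"
      by (rule lborel_pair.Fubini_integral[OF iF, symmetric])
    also have "\<dots> = integral\<^sup>L lborel ?k" using fib(2) by (simp add: has_bochner_integral_iff)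
    finally show ?thesis .
  qed
  have num: "(LBINT \<theta>. G \<theta> *\<^sub>R \<theta>) = (integral\<^sup>L lborel ?k - (LBINT \<omega>. snd \<omega> * ?k \<omega>)) *\<^sub>R x"
  proof -
    have "(LBINT \<theta>. G \<theta> *\<^sub>R \<theta>) = (LBINT \<theta>. (LBINT \<omega>. F \<theta> \<omega>) *\<^sub>R \<theta>)"
      using AEG mF mG by (intro integral_cong_AE) auto
    also have "\<dots> = (LBINT \<theta>. LBINT \<omega>. F \<theta> \<omega> *\<^sub>R \<theta>)" by (simp only: integral_scaleR_left_all)
    also have "\<dots> = (LBINT \<omega>. LBINT \<theta>. F \<theta> \<omega> *\<^sub>R \<theta>)"
      by (rule lborel_pair.Fubini_integral[OF iFv, symmetric])
    also have "\<dots> = (LBINT \<omega>. ?k \<omega> * (1 - snd \<omega>)) *\<^sub>R x" by (simp only: fib(3) integral_scaleR_left_all)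
    also have "(LBINT \<omega>. ?k \<omega> * (1 - snd \<omega>)) = (LBINT \<omega>. ?k \<omega> - snd \<omega> * ?k \<omega>)"
      by (simp add: algebra_simps)
    also have "\<dots> = integral\<^sup>L lborel ?k - (LBINT \<omega>. snd \<omega> * ?k \<omega>)"
      using ik(1,2) by (rule Bochner_Integration.integral_diff)
    finally show ?thesis .
  qed
  have Gv: "(LBINT \<eta>:{0<..}. (\<eta> * normal_dens \<theta> \<eta> x * scaled_chisq_dens n \<eta> s * prior_dens a b \<theta> \<eta>) *\<^sub>R \<theta>) = G \<theta> *\<^sub>R \<theta>" for \<theta>
    unfolding G_def set_lebesgue_integral_def integral_scaleR_left_all[symmetric]
    by (simp only: scaleR_scaleR real_scaleR_def)
  have "gen_bayes n a b (x, s) = (LBINT \<theta>. G \<theta> *\<^sub>R \<theta>) /\<^sub>R (LBINT \<theta>. G \<theta>)"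
    unfolding gen_bayes_def prod.case Gv by (simp only: G_def)
  also have "\<dots> = (1 - post_mean n a b (x, s)) *\<^sub>R x"
  proof -
    have "inverse A * (A - B) = 1 - B / A" if "0 < A" for A B :: real
      using that by (simp add: field_simps)
    then show ?thesis unfolding num den post_mean_def scaleR_scaleR using kpos by simp
  qed
  finally show ?thesis .
qed

section \<open>Minimaxity\<close>

theorem gen_bayes_measurable:
  assumes "0 < n" "-1 < a" "-1 < b"
  shows "estimator (gen_bayes n a b :: (real ^ 'p::finite) \<times> real \<Rightarrow> real ^ 'p)"
proof -
  have "estimator (\<lambda>z::(real ^ 'p) \<times> real. (1 - post_mean n a b z) *\<^sub>R fst z)"
    by (rule estimator_borel) measurable
  then show ?thesis
    by (subst estimator_cong[of "gen_bayes n a b" "\<lambda>z::(real ^ 'p) \<times> real. (1 - post_mean n a b z) *\<^sub>R fst z"])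
       (simp_all add: gen_bayes_eq[OF assms])
qed

text \<open>In terms of \<open>P = p - 2\<close>, \<open>N = n + 2\<close> and \<open>c = a + 2\<close>, the assumption on \<open>a\<close> reads \<open>2 c (2 P + N) \<le> P N\<close>
  and \<open>tilt_ratio_bound\<close> gives \<open>(N/2 - c) \<phi> \<le> P/2 + c\<close>.\<close>

lemma shrinkage_upper_bound:
  assumes n: "3 \<le> n" and p: "2 < p" and a: "-1 < a" "a \<le> xi p n" and b: "0 \<le> b" and w: "0 \<le> w"
  shows "(real n + 2) * (w * shrink p n a b w) \<le> 2 * (real p - 2)"
proof -
  let ?\<alpha> = "real p / 2 + a" and ?q = "(real p + real n) / 2 + 1"
  let ?\<phi> = "w * (tilt (?\<alpha> + 1) b ?q w / tilt ?\<alpha> b ?q w)"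
  define c where "c = a + 2"
  define P where "P = real p - 2"
  define N where "N = real n + 2"
  have P: "0 < P" using p by (simp add: P_def)
  have N: "0 < N" by (simp add: N_def)
  have \<alpha>: "-1 < ?\<alpha>" using a by simp
  have T: "0 < tilt ?\<alpha> b ?q w" using \<alpha> b w by (intro tilt_pos) auto
  have "(?q - ?\<alpha> - 2) * (w * tilt (?\<alpha> + 1) b ?q w) \<le> (?\<alpha> + 1) * tilt ?\<alpha> b ?q w"
    using \<alpha> b w by (intro tilt_ratio_bound) auto
  then have f1: "((?q - ?\<alpha> - 2) * (w * tilt (?\<alpha> + 1) b ?q w)) / tilt ?\<alpha> b ?q w \<le> ?\<alpha> + 1"
    using T by (simp add: pos_divide_le_eq)
  have f2: "((?q - ?\<alpha> - 2) * (w * tilt (?\<alpha> + 1) b ?q w)) / tilt ?\<alpha> b ?q w = (N / 2 - c) * ?\<phi>"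
  proof -
    have "?q - ?\<alpha> - 2 = N / 2 - c" by (simp add: N_def c_def add_divide_distrib)
    then show ?thesis by simp
  qed
  have f3: "?\<alpha> + 1 = P / 2 + c" by (simp add: P_def c_def field_simps)
  have r: "(N / 2 - c) * ?\<phi> \<le> P / 2 + c" by (rule order_trans[OF f1[unfolded f2] eq_refl[OF f3]])
  have "c \<le> P * N / (2 * (2 * P + N))" using a by (simp add: xi_def c_def P_def N_def algebra_simps)
  then have c: "c * (2 * (2 * P + N)) \<le> P * N" using P N by (simp add: pos_le_divide_eq)
  have K: "0 < N / 2 - c"
  proof (rule ccontr)
    assume "\<not> 0 < N / 2 - c"
    then have "N / 2 * (2 * (2 * P + N)) \<le> c * (2 * (2 * P + N))" using P N by (intro mult_right_mono) auto
    moreover have "N / 2 * (2 * (2 * P + N)) = N * (2 * P + N)" by simp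
    ultimately have "N * (2 * P + N) \<le> P * N" using c by (simp only:)
    moreover have "0 < P * N" "0 < N * N" using P N by simp_all
    ultimately show False by (simp add: algebra_simps)
  qed
  have "(N / 2 - c) * (N * ?\<phi>) = N * ((N / 2 - c) * ?\<phi>)" by simp
  also have "\<dots> \<le> N * (P / 2 + c)" using r N by (intro mult_left_mono) auto
  also have "\<dots> \<le> (N / 2 - c) * (2 * P)" using c by (simp add: algebra_simps)
  finally have "N * ?\<phi> \<le> 2 * P" using K by (simp only: mult_le_cancel_left_pos)
  then show ?thesis by (simp add: N_def P_def shrink_def)
qed

lemma dimension_gt_2:
  assumes "3 \<le> n" "real p > 4 * real n / (real n - 2)"
  shows "2 < p"
proof -
  have "4 \<le> 4 * real n / (real n - 2)" using assms(1) by (simp add: pos_le_divide_eq)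
  then have "4 < real p" using assms(2) by linarith
  then show ?thesis by simp
qed

lemma shrink_bounds:
  assumes "-1 < a" "0 \<le> b" "0 \<le> w"
  shows "0 \<le> shrink p n a b w" "shrink p n a b w \<le> 1"
proof -
  have "0 < tilt (real p / 2 + a + 1) b ((real p + real n) / 2 + 1) w" "0 < tilt (real p / 2 + a) b ((real p + real n) / 2 + 1) w"
     "tilt (real p / 2 + a + 1) b ((real p + real n) / 2 + 1) w < tilt (real p / 2 + a) b ((real p + real n) / 2 + 1) w"
    using assms by (auto intro!: tilt_pos tilt_Suc_less)
  then show "0 \<le> shrink p n a b w" "shrink p n a b w \<le> 1" by (auto simp: shrink_def)
qed

lemma gen_bayes_shrink:
  fixes x :: "real ^ 'p::finite"
  assumes "0 < n" "-1 < a" "-1 < b" "0 < s"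
  shows "gen_bayes n a b (x, s) = (1 - shrink CARD('p) n a b ((norm x)\<^sup>2 / s)) *\<^sub>R x"
  unfolding gen_bayes_eq[OF assms] post_mean_eq_shrink[OF assms] ..

theorem gen_bayes_risk_le:
  fixes \<theta> :: "real ^ 'p::finite"
  assumes n: "3 \<le> n" and p: "2 < CARD('p)" and a: "-1 < a" "a \<le> xi CARD('p) n" and b: "0 \<le> b" and \<eta>: "0 < \<eta>"
  shows "risk n (gen_bayes n a b) \<theta> \<eta> \<le> ennreal (CARD('p))"
proof -
  let ?\<Psi> = "shrink CARD('p) n a b"
  have "risk n (gen_bayes n a b) = risk n (\<lambda>(x::real^'p, s). (1 - ?\<Psi> ((norm x)\<^sup>2 / s)) *\<^sub>R x)"
    using gen_bayes_shrink[of n a b] n a b by (intro risk_cong) auto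
  moreover have "risk n (\<lambda>(x, s). (1 - ?\<Psi> ((norm x)\<^sup>2 / s)) *\<^sub>R x) \<theta> \<eta> \<le> ennreal (CARD('p))"
  proof (rule baranchik_risk_bound[OF _ _ \<eta>])
    show "?\<Psi> \<in> borel_measurable borel" unfolding shrink_def[abs_def] tilt_def by measurable
    show "v * ?\<Psi> v \<le> w * ?\<Psi> w" if "0 \<le> v" "v \<le> w" for v w
      unfolding shrink_def using that a b by (intro tilt_ratio_mono) auto
    show "(real n + 2) * (w * ?\<Psi> w) \<le> 2 * (real CARD('p) - 2)" if "0 \<le> w" for w
      by (rule shrinkage_upper_bound[OF n p a b that])
  qed (use n p a b shrink_bounds in auto)
  ultimately show ?thesis by simp
qed

theorem gen_bayes_minimax:
  assumes n: "3 \<le> n" and p: "2 < CARD('p::finite)" and a: "-1 < a" "a \<le> xi CARD('p) n" and b: "0 \<le> b"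
  shows "minimax n (gen_bayes n a b :: (real ^ 'p) \<times> real \<Rightarrow> real ^ 'p)"
proof -
  let ?\<delta> = "gen_bayes n a b :: (real ^ 'p) \<times> real \<Rightarrow> real ^ 'p"
  let ?E = "{\<delta>' :: (real ^ 'p) \<times> real \<Rightarrow> real ^ 'p. estimator \<delta>'}"
  have est: "estimator ?\<delta>" using n a b by (intro gen_bayes_measurable) auto
  have "sup_risk n ?\<delta> \<le> ennreal (CARD('p))"
    unfolding sup_risk_def using gen_bayes_risk_le[OF n p a b] by (intro SUP_least) auto
  also have "ennreal (CARD('p)) \<le> (INF \<delta>' \<in> ?E. sup_risk n \<delta>')"
    using n by (intro INF_greatest sup_risk_lower_bound) auto
  finally have "sup_risk n ?\<delta> \<le> (INF \<delta>' \<in> ?E. sup_risk n \<delta>')" .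
  moreover have "(INF \<delta>' \<in> ?E. sup_risk n \<delta>') \<le> sup_risk n ?\<delta>"
    using est by (intro INF_lower) auto
  ultimately show ?thesis using est by (simp add: minimax_def)
qed

section \<open>Damped proper priors\<close>

text \<open>The density of a Cauchy law in \<open>ln \<eta>\<close> with scale \<open>i\<close>, up to the factor \<open>i \<pi>\<close>: this makes the total mass
  explicit, and the tails are heavy enough for \<open>damp_lipschitz\<close>.\<close>

definition damp :: "real \<Rightarrow> real \<Rightarrow> real" where
  "damp i \<eta> = i\<^sup>2 / (i\<^sup>2 + (ln \<eta>)\<^sup>2)"

lemma damp_measurable [measurable]: "damp i \<in> borel_measurable borel"
  unfolding damp_def[abs_def] by measurable

lemma damp_bounds: "0 < i \<Longrightarrow> 0 < damp i \<eta>" "0 < i \<Longrightarrow> damp i \<eta> \<le> 1"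
  by (auto simp: damp_def divide_le_eq_1 add_pos_nonneg intro!: divide_pos_pos)

lemma damp_mono: "0 < i \<Longrightarrow> i \<le> j \<Longrightarrow> damp i \<eta> \<le> damp j \<eta>"
proof -
  assume i: "0 < i" "i \<le> j"
  have q: "i\<^sup>2 \<le> j\<^sup>2" "0 < i\<^sup>2" "0 < j\<^sup>2" using i by (auto intro: power_mono)
  have "i\<^sup>2 * (ln \<eta>)\<^sup>2 \<le> j\<^sup>2 * (ln \<eta>)\<^sup>2" using q by (intro mult_right_mono) auto
  then have "i\<^sup>2 * (j\<^sup>2 + (ln \<eta>)\<^sup>2) \<le> j\<^sup>2 * (i\<^sup>2 + (ln \<eta>)\<^sup>2)" by (simp add: algebra_simps)
  then show ?thesis unfolding damp_def using q by (simp add: frac_le_eq add_pos_nonneg divide_le_eq pos_le_divide_eq mult.commute)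
qed

text \<open>The factor \<open>damp i s * damp i t\<close> on the right is essential: one of its two factors is absorbed by
  the damped prior, the other keeps the integral over the scale of the data finite.\<close>

lemma damp_lipschitz:
  assumes "0 < i"
  shows "(damp i s - damp i t)\<^sup>2 \<le> 4 / i\<^sup>2 * (damp i s * damp i t) * (ln s - ln t)\<^sup>2"
proof -
  define A where "A = ln s"
  define B where "B = ln t"
  define u where "u = i\<^sup>2 + A\<^sup>2"
  define v where "v = i\<^sup>2 + B\<^sup>2"
  have i: "0 < i\<^sup>2" using assms by simp
  have u: "0 < u" and v: "0 < v" using i by (auto simp: u_def v_def add_pos_nonneg)
  have key: "i\<^sup>2 * (A + B)\<^sup>2 \<le> 4 * (u * v)"
  proof -
    have "(A + B)\<^sup>2 \<le> 2 * A\<^sup>2 + 2 * B\<^sup>2" using zero_le_power2[of "A - B"] by (simp add: power2_eq_square algebra_simps)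
    then have "i\<^sup>2 * (A + B)\<^sup>2 \<le> i\<^sup>2 * (2 * A\<^sup>2 + 2 * B\<^sup>2)" using i by (intro mult_left_mono) auto
    also have "\<dots> \<le> 4 * (u * v)"
    proof -
      have "0 \<le> i\<^sup>2 * i\<^sup>2" "0 \<le> i\<^sup>2 * A\<^sup>2" "0 \<le> i\<^sup>2 * B\<^sup>2" "0 \<le> A\<^sup>2 * B\<^sup>2" by simp_all
      moreover have "4 * (u * v) = 4 * (i\<^sup>2 * i\<^sup>2) + 4 * (i\<^sup>2 * A\<^sup>2) + 4 * (i\<^sup>2 * B\<^sup>2) + 4 * (A\<^sup>2 * B\<^sup>2)"
        by (simp add: u_def v_def algebra_simps)
      moreover have "i\<^sup>2 * (2 * A\<^sup>2 + 2 * B\<^sup>2) = 2 * (i\<^sup>2 * A\<^sup>2) + 2 * (i\<^sup>2 * B\<^sup>2)" by (simp add: algebra_simps)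
      ultimately show ?thesis by linarith
    qed
    finally show ?thesis .
  qed
  have "i\<^sup>2 / u - i\<^sup>2 / v = i\<^sup>2 * ((B - A) * (A + B)) / (u * v)"
  proof -
    have "v - u = (B - A) * (A + B)" by (simp add: u_def v_def power2_eq_square algebra_simps)
    moreover have "i\<^sup>2 / u - i\<^sup>2 / v = i\<^sup>2 * (v - u) / (u * v)" using u v by (simp add: field_simps)
    ultimately show ?thesis by simp
  qed
  then have "(i\<^sup>2 / u - i\<^sup>2 / v)\<^sup>2 = (i\<^sup>2 * (B - A)\<^sup>2 / (u * v)\<^sup>2) * (i\<^sup>2 * (A + B)\<^sup>2)"
    by (simp add: power2_eq_square mult_ac)
  also have "\<dots> \<le> (i\<^sup>2 * (B - A)\<^sup>2 / (u * v)\<^sup>2) * (4 * (u * v))"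
    by (intro mult_left_mono key) auto
  also have "\<dots> = 4 / i\<^sup>2 * ((i\<^sup>2 / u) * (i\<^sup>2 / v)) * (A - B)\<^sup>2"
    using u v i by (simp add: power2_eq_square field_simps)
  finally show ?thesis by (simp add: damp_def u_def v_def A_def B_def)
qed

lemma ln_squared_le:
  assumes "0 < (t::real)"
  shows "(ln t)\<^sup>2 \<le> 4 * (t + inverse t)"
proof -
  have *: "(ln u)\<^sup>2 \<le> 4 * u" if "1 \<le> u" for u :: real
  proof -
    have "ln u = 2 * ln (sqrt u)" using that by (simp add: ln_sqrt)
    moreover have "ln (sqrt u) \<le> sqrt u" using that ln_le_minus_one[of "sqrt u"] by simp
    moreover have "0 \<le> ln (sqrt u)" using that by simp
    ultimately have "(ln u)\<^sup>2 \<le> (2 * sqrt u)\<^sup>2" by (intro power_mono) auto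
    then show ?thesis using that by (simp add: power_mult_distrib)
  qed
  show ?thesis
  proof (cases "1 \<le> t")
    case True
    have "0 \<le> inverse t" using assms by simp
    then show ?thesis using *[OF True] by (simp add: distrib_left add_increasing2)
  next
    case False
    then have "1 \<le> inverse t" using assms by (simp add: one_le_inverse)
    from *[OF this] show ?thesis using assms by (simp add: ln_inverse)
  qed
qed

lemma nn_integral_damp:
  assumes i: "0 < i"
  shows "(\<integral>\<^sup>+\<eta>. ennreal (indicator {0<..} \<eta> * (damp i \<eta> * inverse \<eta>)) \<partial>lborel) = ennreal (i * pi)"
proof -
  let ?F = "\<lambda>\<eta>. i * arctan (ln \<eta> / i)"
  let ?f = "\<lambda>\<eta>. damp i \<eta> * inverse \<eta>"
  have ex: "einterval 0 \<infinity> = {0<..}" by (auto simp: einterval_def)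
  have d: "(?F has_real_derivative ?f \<eta>) (at \<eta>)" if "0 < \<eta>" for \<eta>
  proof -
    have "(?F has_real_derivative (i * (inverse (1 + (ln \<eta> / i)\<^sup>2) * (inverse \<eta> / i)))) (at \<eta>)"
      using that i by (auto intro!: derivative_eq_intros simp: divide_inverse)
    moreover have "i * (inverse (1 + (ln \<eta> / i)\<^sup>2) * (inverse \<eta> / i)) = ?f \<eta>"
    proof -
      have "1 + (ln \<eta> / i)\<^sup>2 = (i\<^sup>2 + (ln \<eta>)\<^sup>2) / i\<^sup>2" using i by (simp add: field_simps)
      then show ?thesis using i by (simp add: damp_def)
    qed
    ultimately show ?thesis by simp
  qed
  have l0: "((?F \<circ> real_of_ereal) \<longlongrightarrow> i * (- (pi / 2))) (at_right 0)"
  proof -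
    have "filterlim (\<lambda>\<eta>. inverse i * ln \<eta>) at_bot (at_right (0::real))"
      using i by (intro filterlim_tendsto_pos_mult_at_bot[OF tendsto_const _ ln_at_0]) auto
    then have "(?F \<longlongrightarrow> i * (- (pi / 2))) (at_right 0)"
      by (intro tendsto_intros filterlim_compose[OF tendsto_arctan_at_bot]) (simp add: divide_inverse mult.commute)
    then show ?thesis unfolding zero_ereal_def by (simp only: ereal_tendsto_simps1)
  qed
  have l1: "((?F \<circ> real_of_ereal) \<longlongrightarrow> i * (pi / 2)) (at_left \<infinity>)"
  proof -
    have "filterlim (\<lambda>\<eta>. inverse i * ln \<eta>) at_top (at_top :: real filter)"
      using i by (intro filterlim_tendsto_pos_mult_at_top[OF tendsto_const _ ln_at_top]) auto
    then have "(?F \<longlongrightarrow> i * (pi / 2)) at_top"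
      by (intro tendsto_intros filterlim_compose[OF tendsto_arctan_at_top]) (simp add: divide_inverse mult.commute)
    then show ?thesis by (simp only: ereal_tendsto_simps1)
  qed
  have c: "isCont ?f \<eta>" if "0 < \<eta>" for \<eta>
    unfolding damp_def using that i by (intro continuous_intros) (auto simp: add_pos_nonneg intro: less_imp_neq[THEN not_sym])
  note FTC = interval_integral_FTC_nonneg[of 0 \<infinity> ?F ?f "i * (- (pi / 2))" "i * (pi / 2)"]
  have "set_integrable lborel (einterval 0 \<infinity>) ?f"
    by (rule FTC(1)) (use d c l0 l1 damp_bounds(1)[OF i] in \<open>auto simp: less_imp_le\<close>)
  moreover have "(LBINT \<eta>=0..\<infinity>. ?f \<eta>) = i * (pi / 2) - i * (- (pi / 2))"
    by (rule FTC(2)) (use d c l0 l1 damp_bounds(1)[OF i] in \<open>auto simp: less_imp_le\<close>)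
  ultimately have "has_bochner_integral lborel (\<lambda>\<eta>. indicator {0<..} \<eta> * ?f \<eta>) (i * pi)"
    unfolding ex set_integrable_def has_bochner_integral_iff
    by (simp add: interval_lebesgue_integral_def ex set_lebesgue_integral_def)
  then show ?thesis
    using damp_bounds(1)[OF i] by (subst nn_integral_eq_integral) (auto simp: has_bochner_integral_iff indicator_def less_imp_le)
qed

text \<open>Conditionally on \<open>\<eta>\<close> and \<open>\<lambda>\<close> the marginal law of \<open>X\<close> is \<open>N(0, I / (\<eta> \<lambda>))\<close>, and \<open>\<theta>\<close> has total
  posterior variance \<open>p (1 - \<lambda>) / \<eta>\<close>.\<close>

lemma prior_average_risk_given_variance:
  fixes d :: "(real ^ 'p::finite) \<times> real \<Rightarrow> real ^ 'p"
  assumes n: "0 < n" and \<eta>: "0 < \<eta>" and l: "0 < l" "l < 1" and [measurable]: "d \<in> borel_measurable borel"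
  shows "(\<integral>\<^sup>+\<theta>. ennreal (normal_dens 0 (\<eta> * (l / (1 - l))) \<theta>) * risk n d \<theta> \<eta> \<partial>lborel)
    = (\<integral>\<^sup>+z. ennreal (\<eta> * (normal_dens 0 (\<eta> * l) (fst z) * chi n \<eta> (snd z))
        * ((norm (d z - (1 - l) *\<^sub>R fst z))\<^sup>2 + real CARD('p) * (1 - l) / \<eta>)) \<partial>lborel)"
proof -
  let ?I = "\<lambda>\<theta> z. ennreal (normal_dens 0 (\<eta> * (l / (1 - l))) \<theta>
      * (\<eta> * (norm (d z - \<theta>))\<^sup>2 * (normal_dens \<theta> \<eta> (fst z) * chi n \<eta> (snd z))))"
  have "(\<integral>\<^sup>+\<theta>. ennreal (normal_dens 0 (\<eta> * (l / (1 - l))) \<theta>) * risk n d \<theta> \<eta> \<partial>lborel)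
      = (\<integral>\<^sup>+\<theta>. \<integral>\<^sup>+z. ?I \<theta> z \<partial>lborel \<partial>lborel)"
    using n \<eta> by (intro nn_integral_cong, subst risk_eq)
      (auto simp: nn_integral_cmult[symmetric] ennreal_mult)
  also have "\<dots> = (\<integral>\<^sup>+z. \<integral>\<^sup>+\<theta>. ?I \<theta> z \<partial>lborel \<partial>lborel)"
    by (rule lborel_pair.Fubini') (simp add: lborel_prod)
  also have "\<dots> = (\<integral>\<^sup>+z. ennreal (\<eta> * (normal_dens 0 (\<eta> * l) (fst z) * chi n \<eta> (snd z))
        * ((norm (d z - (1 - l) *\<^sub>R fst z))\<^sup>2 + real CARD('p) * (1 - l) / \<eta>)) \<partial>lborel)"
  proof (rule nn_integral_cong)
    fix z :: "(real ^ 'p) \<times> real"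
    let ?w = "\<eta> * (normal_dens 0 (\<eta> * l) (fst z) * chi n \<eta> (snd z))"
    let ?N = "normal_dens ((1 - l) *\<^sub>R fst z) (\<eta> / (1 - l))"
    have w: "0 \<le> ?w" using n \<eta> by simp
    have "(\<integral>\<^sup>+\<theta>. ?I \<theta> z \<partial>lborel) = (\<integral>\<^sup>+\<theta>. ennreal ?w * ennreal ((norm (d z - \<theta>))\<^sup>2 * ?N \<theta>) \<partial>lborel)"
    proof (rule nn_integral_cong)
      fix \<theta>
      have "normal_dens 0 (\<eta> * (l / (1 - l))) \<theta> * (\<eta> * (norm (d z - \<theta>))\<^sup>2 * (normal_dens \<theta> \<eta> (fst z) * chi n \<eta> (snd z)))
        = \<eta> * (norm (d z - \<theta>))\<^sup>2 * chi n \<eta> (snd z) * (normal_dens \<theta> \<eta> (fst z) * normal_dens 0 (\<eta> * (l / (1 - l))) \<theta>)"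
        by (simp only: mult_ac)
      also have "\<dots> = ?w * ((norm (d z - \<theta>))\<^sup>2 * ?N \<theta>)"
        unfolding hierarchical_joint_density[OF \<eta> l] by (simp only: mult_ac)
      finally have e: "normal_dens 0 (\<eta> * (l / (1 - l))) \<theta> * (\<eta> * (norm (d z - \<theta>))\<^sup>2 * (normal_dens \<theta> \<eta> (fst z) * chi n \<eta> (snd z)))
        = ?w * ((norm (d z - \<theta>))\<^sup>2 * ?N \<theta>)" .
      show "?I \<theta> z = ennreal ?w * ennreal ((norm (d z - \<theta>))\<^sup>2 * ?N \<theta>)"
        unfolding e by (rule ennreal_mult[OF w]) simp
    qed
    also have "\<dots> = ennreal ?w * ennreal ((norm (d z - (1 - l) *\<^sub>R fst z))\<^sup>2 + real CARD('p) / (\<eta> / (1 - l)))"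
    proof -
      have "(\<integral>\<^sup>+\<theta>. ennreal ((norm (d z - \<theta>))\<^sup>2 * ?N \<theta>) \<partial>lborel)
        = ennreal ((norm (d z - (1 - l) *\<^sub>R fst z))\<^sup>2 + real CARD('p) / (\<eta> / (1 - l)))"
        using \<eta> l by (intro nn_integral_normal_dens_sq) simp
      then show ?thesis by (subst nn_integral_cmult) auto
    qed
    also have "\<dots> = ennreal (?w * ((norm (d z - (1 - l) *\<^sub>R fst z))\<^sup>2 + real CARD('p) / (\<eta> / (1 - l))))"
      using \<eta> l by (intro ennreal_mult[symmetric] w) auto
    finally show "(\<integral>\<^sup>+\<theta>. ?I \<theta> z \<partial>lborel) = ennreal (?w * ((norm (d z - (1 - l) *\<^sub>R fst z))\<^sup>2 + real CARD('p) * (1 - l) / \<eta>))"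
      by simp
  qed
  finally show ?thesis .
qed

definition hyper_weight :: "real \<Rightarrow> real \<Rightarrow> (real \<Rightarrow> real) \<Rightarrow> real \<times> real \<Rightarrow> real" where
  "hyper_weight a b h \<omega> = indicator {0<..} (fst \<omega>) * indicator {0<..<1} (snd \<omega>)
     * (mixing_dens a b (snd \<omega>) * (h (fst \<omega>) * inverse (fst \<omega>)))"

lemma hyper_weight_measurable [measurable]:
  assumes [measurable]: "h \<in> borel_measurable borel" "f \<in> borel_measurable M"
  shows "(\<lambda>z. hyper_weight a b h (f z)) \<in> borel_measurable M"
  unfolding hyper_weight_def by measurable

lemma hyper_weight_nonneg:
  "-1 < a \<Longrightarrow> -1 < b \<Longrightarrow> (\<And>\<eta>. 0 \<le> h \<eta>) \<Longrightarrow> 0 \<le> hyper_weight a b h \<omega>"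
  by (auto simp: hyper_weight_def indicator_def mixing_dens_nonneg)

text \<open>The weight is indexed by \<open>\<lambda>\<close> as well, so that \<open>\<theta>\<close> keeps its conditionally normal prior; the risk
  itself does not depend on \<open>\<lambda>\<close>.\<close>

definition bayes_risk :: "nat \<Rightarrow> real \<Rightarrow> real \<Rightarrow> (real \<Rightarrow> real) \<Rightarrow> ((real ^ 'p::finite) \<times> real \<Rightarrow> real ^ 'p) \<Rightarrow> ennreal" where
  "bayes_risk n a b h d = (\<integral>\<^sup>+\<omega>. ennreal (hyper_weight a b h \<omega>) *
     (\<integral>\<^sup>+\<theta>. ennreal (normal_dens 0 (fst \<omega> * (snd \<omega> / (1 - snd \<omega>))) \<theta>) * risk n d \<theta> (fst \<omega>) \<partial>lborel) \<partial>lborel)"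

text \<open>The mean of \<open>|d - \<theta>|\<^sup>2\<close> given \<open>x\<close>, \<open>\<eta>\<close> and \<open>\<lambda>\<close>.\<close>

definition cond_loss :: "real ^ 'p::finite \<Rightarrow> real ^ 'p \<Rightarrow> real \<times> real \<Rightarrow> real" where
  "cond_loss x d \<omega> = (norm (d - (1 - snd \<omega>) *\<^sub>R x))\<^sup>2 + real CARD('p) * (1 - snd \<omega>) * inverse (fst \<omega>)"

lemma cond_loss_measurable [measurable]:
  fixes f g :: "'b \<Rightarrow> real ^ 'p::finite"
  assumes [measurable]: "f \<in> borel_measurable M" "g \<in> borel_measurable M" "h \<in> borel_measurable M"
  shows "(\<lambda>u. cond_loss (f u) (g u) (h u)) \<in> borel_measurable M"
  unfolding cond_loss_def by measurable

lemma bayes_risk_posterior: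
  fixes d :: "(real ^ 'p::finite) \<times> real \<Rightarrow> real ^ 'p"
  assumes n: "0 < n" and a: "-1 < a" and b: "-1 < b"
    and [measurable]: "h \<in> borel_measurable borel" "d \<in> borel_measurable borel" and h: "\<And>\<eta>. 0 \<le> h \<eta>"
  shows "bayes_risk n a b h d = (\<integral>\<^sup>+z. \<integral>\<^sup>+\<omega>. ennreal (h (fst \<omega>) * kern n a b z \<omega>
       * cond_loss (fst z) (d z) \<omega>) \<partial>lborel \<partial>lborel)"
proof -
  have "bayes_risk n a b h d = (\<integral>\<^sup>+\<omega>. \<integral>\<^sup>+z. ennreal (h (fst \<omega>) * kern n a b z \<omega>
       * cond_loss (fst z) (d z) \<omega>) \<partial>lborel \<partial>lborel)"
    unfolding bayes_risk_def
  proof (rule nn_integral_cong)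
    fix \<omega> :: "real \<times> real"
    let ?\<eta> = "fst \<omega>" and ?l = "snd \<omega>"
    let ?g = "\<lambda>z. ?\<eta> * (normal_dens 0 (?\<eta> * ?l) (fst z) * chi n ?\<eta> (snd z))
        * ((norm (d z - (1 - ?l) *\<^sub>R fst z))\<^sup>2 + real CARD('p) * (1 - ?l) / ?\<eta>)"
    show "ennreal (hyper_weight a b h \<omega>) *
       (\<integral>\<^sup>+\<theta>. ennreal (normal_dens 0 (?\<eta> * (?l / (1 - ?l))) \<theta>) * risk n d \<theta> ?\<eta> \<partial>lborel)
      = (\<integral>\<^sup>+z. ennreal (h ?\<eta> * kern n a b z \<omega>
       * cond_loss (fst z) (d z) \<omega>) \<partial>lborel)"
    proof (cases "0 < ?\<eta> \<and> 0 < ?l \<and> ?l < 1")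
      case True
      have "ennreal (hyper_weight a b h \<omega>) *
         (\<integral>\<^sup>+\<theta>. ennreal (normal_dens 0 (?\<eta> * (?l / (1 - ?l))) \<theta>) * risk n d \<theta> ?\<eta> \<partial>lborel)
        = ennreal (hyper_weight a b h \<omega>) * (\<integral>\<^sup>+z. ennreal (?g z) \<partial>lborel)"
        using True by (subst prior_average_risk_given_variance[OF n]) auto
      also have "\<dots> = (\<integral>\<^sup>+z. ennreal (hyper_weight a b h \<omega>) * ennreal (?g z) \<partial>lborel)"
        by (rule nn_integral_cmult[symmetric]) measurable
      also have "\<dots> = (\<integral>\<^sup>+z. ennreal (h ?\<eta> * kern n a b z \<omega>
         * cond_loss (fst z) (d z) \<omega>) \<partial>lborel)"
      proof (rule nn_integral_cong)
        fix z :: "(real ^ 'p) \<times> real"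
        have "0 \<le> ?g z" using True n by simp
        then have "ennreal (hyper_weight a b h \<omega>) * ennreal (?g z) = ennreal (hyper_weight a b h \<omega> * ?g z)"
          by (rule ennreal_mult[OF hyper_weight_nonneg[OF a b h], symmetric])
        also have "hyper_weight a b h \<omega> * ?g z = h ?\<eta> * kern n a b z \<omega>
         * cond_loss (fst z) (d z) \<omega>"
          using True by (simp add: hyper_weight_def kern_def cond_loss_def divide_inverse mult_ac)
        finally show "ennreal (hyper_weight a b h \<omega>) * ennreal (?g z) = ennreal (h ?\<eta> * kern n a b z \<omega>
         * cond_loss (fst z) (d z) \<omega>)" .
      qed
      finally show ?thesis .
    qed (auto simp: hyper_weight_def kern_def)
  qed
  also have "\<dots> = (\<integral>\<^sup>+z. \<integral>\<^sup>+\<omega>. ennreal (h (fst \<omega>) * kern n a b z \<omega>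
       * cond_loss (fst z) (d z) \<omega>) \<partial>lborel \<partial>lborel)"
    by (rule lborel_pair.Fubini') (simp add: lborel_prod)
  finally show ?thesis .
qed

lemma nn_integral_mixing_dens:
  assumes "-1 < a" "-1 < b"
  shows "(\<integral>\<^sup>+l. ennreal (indicator {0<..<1} l * mixing_dens a b l) \<partial>lborel) = 1"
proof -
  have B: "0 < Beta (a + 1) (b + 1)" using assms by (intro Beta_pos_real) auto
  have "has_bochner_integral lborel (\<lambda>l. indicator {0<..<1} l * (l powr a * (1 - l) powr b) / Beta (a + 1) (b + 1))
     (Beta (a + 1) (b + 1) / Beta (a + 1) (b + 1))"
    using beta_integrable[OF assms] by (intro has_bochner_integral_divide_zero) (simp add: has_bochner_integral_iff)
  then have "has_bochner_integral lborel (\<lambda>l. indicator {0<..<1} l * mixing_dens a b l) 1"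
    using B by (simp add: mixing_dens_def)
  then show ?thesis
    by (subst nn_integral_eq_integral) (auto simp: has_bochner_integral_iff mixing_dens_nonneg[OF assms])
qed

lemma hyper_weight_mass:
  assumes "-1 < a" "-1 < b" "0 < i"
  shows "(\<integral>\<^sup>+\<omega>. ennreal (hyper_weight a b (damp i) \<omega>) \<partial>lborel) = ennreal (i * pi)"
proof -
  have "(\<integral>\<^sup>+\<omega>. ennreal (hyper_weight a b (damp i) \<omega>) \<partial>lborel)
    = (\<integral>\<^sup>+\<eta>. \<integral>\<^sup>+l. ennreal (indicator {0<..} \<eta> * (damp i \<eta> * inverse \<eta>)) * ennreal (indicator {0<..<1} l * mixing_dens a b l) \<partial>lborel \<partial>lborel)"
    using mixing_dens_nonneg[OF assms(1,2)] damp_bounds(1)[OF assms(3)]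
    by (subst nn_integral_lborel_pair(1))
       (auto intro!: nn_integral_cong simp: hyper_weight_def ennreal_mult[symmetric] indicator_def mult_ac less_imp_le)
  also have "\<dots> = (\<integral>\<^sup>+\<eta>. ennreal (indicator {0<..} \<eta> * (damp i \<eta> * inverse \<eta>)) \<partial>lborel)"
    using assms by (simp add: nn_integral_cmult nn_integral_mixing_dens)
  finally show ?thesis using nn_integral_damp[OF assms(3)] by simp
qed

lemma bayes_risk_le:
  fixes d :: "(real ^ 'p::finite) \<times> real \<Rightarrow> real ^ 'p"
  assumes a: "-1 < a" and b: "-1 < b" and i: "0 < i"
    and r: "\<And>\<theta> \<eta>. 0 < \<eta> \<Longrightarrow> risk n d \<theta> \<eta> \<le> ennreal K"
  shows "bayes_risk n a b (damp i) d \<le> ennreal K * ennreal (i * pi)"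
proof -
  have "bayes_risk n a b (damp i) d \<le> (\<integral>\<^sup>+\<omega>. ennreal K * ennreal (hyper_weight a b (damp i) \<omega>) \<partial>lborel)"
    unfolding bayes_risk_def
  proof (rule nn_integral_mono)
    fix \<omega> :: "real \<times> real"
    let ?N = "\<lambda>\<theta>::real^'p. normal_dens 0 (fst \<omega> * (snd \<omega> / (1 - snd \<omega>))) \<theta>"
    show "ennreal (hyper_weight a b (damp i) \<omega>) * (\<integral>\<^sup>+\<theta>. ennreal (?N \<theta>) * risk n d \<theta> (fst \<omega>) \<partial>lborel)
        \<le> ennreal K * ennreal (hyper_weight a b (damp i) \<omega>)"
    proof (cases "0 < fst \<omega> \<and> 0 < snd \<omega> \<and> snd \<omega> < 1")
      case True
      have "(\<integral>\<^sup>+\<theta>. ennreal (?N \<theta>) * risk n d \<theta> (fst \<omega>) \<partial>lborel) \<le> (\<integral>\<^sup>+\<theta>. ennreal (?N \<theta>) * ennreal K \<partial>lborel)"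
        using True by (intro nn_integral_mono mult_left_mono r) auto
      also have "\<dots> = ennreal K"
        using True by (subst nn_integral_multc) (auto simp: nn_integral_normal_dens)
      finally show ?thesis by (subst mult.commute) (rule mult_right_mono, auto)
    qed (auto simp: hyper_weight_def)
  qed
  also have "\<dots> = ennreal K * ennreal (i * pi)"
    using hyper_weight_mass[OF a b i] by (subst nn_integral_cmult) auto
  finally show ?thesis .
qed

lemma bayes_risk_mono:
  assumes "\<And>\<theta> \<eta>. 0 < \<eta> \<Longrightarrow> risk n d \<theta> \<eta> \<le> risk n d' \<theta> \<eta>"
  shows "bayes_risk n a b h d \<le> bayes_risk n a b h d'"
  unfolding bayes_risk_def
proof (rule nn_integral_mono)
  fix \<omega> :: "real \<times> real"
  show "ennreal (hyper_weight a b h \<omega>) * (\<integral>\<^sup>+\<theta>. ennreal (normal_dens 0 (fst \<omega> * (snd \<omega> / (1 - snd \<omega>))) \<theta>) * risk n d \<theta> (fst \<omega>) \<partial>lborel)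
    \<le> ennreal (hyper_weight a b h \<omega>) * (\<integral>\<^sup>+\<theta>. ennreal (normal_dens 0 (fst \<omega> * (snd \<omega> / (1 - snd \<omega>))) \<theta>) * risk n d' \<theta> (fst \<omega>) \<partial>lborel)"
    by (cases "0 < fst \<omega>") (auto intro!: mult_left_mono nn_integral_mono assms simp: hyper_weight_def)
qed

section \<open>Admissibility\<close>

text \<open>The error made when \<open>H\<^sub>i(1/s)\<close> takes the place of \<open>H\<^sub>i(\<eta>)\<close>; note \<open>H\<^sub>i(1/s) = H\<^sub>i(s)\<close>. The constant \<open>16\<close>
  is the product of the \<open>4\<close> in \<open>damp_lipschitz\<close> and the \<open>4\<close> in \<open>ln_squared_le\<close>, which turns
  \<open>ln\<^sup>2 (\<eta> s)\<close> into powers of \<open>\<eta> s\<close> that gamma integrals can handle.\<close>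

definition excess :: "nat \<Rightarrow> real \<Rightarrow> real \<Rightarrow> real \<Rightarrow> (real ^ 'p::finite) \<times> real \<Rightarrow> real \<times> real \<Rightarrow> real" where
  "excess n a b i z \<omega> = 16 / i\<^sup>2 * damp i (snd z) * (kern n a b z \<omega> * (norm (fst z))\<^sup>2 * (snd \<omega> - post_mean n a b z)\<^sup>2
     * (fst \<omega> * snd z + inverse (fst \<omega> * snd z)))"

lemma excess_measurable [measurable]:
  assumes [measurable]: "f \<in> borel_measurable M" "g \<in> borel_measurable M"
  shows "(\<lambda>u. excess n a b i (f u) (g u)) \<in> borel_measurable M"
  unfolding excess_def using damp_measurable post_mean_measurable
  by measurable

text \<open>Put \<open>e = (1 - \<psi>) x - d\<close>. The difference of the two quadratic losses is \<open>|e|\<^sup>2 - 2 (\<lambda> - \<psi>) (x \<bullet> e)\<close>. Its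
  linear part integrates to \<open>0\<close> against the undamped posterior, so under the damped one only
  \<open>H\<^sub>i(\<eta>) - H\<^sub>i(1/s)\<close> contributes; the inequality \<open>2 u v \<le> u\<^sup>2/2 + 2 v\<^sup>2\<close> splits that contribution into half of the
  \<open>|e|\<^sup>2\<close> term and twice the excess.\<close>

lemma posterior_excess_inequality:
  fixes x :: "real ^ 'p::finite" and d :: "real ^ 'p"
  assumes n: "0 < n" and a: "-1 < a" and b: "-1 < b" and s: "0 < s" and i: "0 < i"
  defines "\<psi> \<equiv> post_mean n a b (x, s)" and "V \<equiv> \<lambda>\<omega>. real CARD('p) * (1 - snd \<omega>) * inverse (fst \<omega>)"
  shows "(\<integral>\<^sup>+\<omega>. ennreal (damp i (fst \<omega>) * kern n a b (x, s) \<omega> * ((norm ((1 - \<psi>) *\<^sub>R x - (1 - snd \<omega>) *\<^sub>R x))\<^sup>2 + V \<omega>)) \<partial>lborel)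
      + (\<integral>\<^sup>+\<omega>. ennreal (damp i (fst \<omega>) * kern n a b (x, s) \<omega> * ((norm ((1 - \<psi>) *\<^sub>R x - d))\<^sup>2 / 2)) \<partial>lborel)
    \<le> (\<integral>\<^sup>+\<omega>. ennreal (damp i (fst \<omega>) * kern n a b (x, s) \<omega> * ((norm (d - (1 - snd \<omega>) *\<^sub>R x))\<^sup>2 + V \<omega>)) \<partial>lborel)
      + (\<integral>\<^sup>+\<omega>. ennreal (2 * excess n a b i (x, s) \<omega>) \<partial>lborel)"
    (is "?L1 + ?L2 \<le> ?R1 + ?R2")
proof (cases "?R2 = \<infinity>")
  case False
  let ?k = "kern n a b (x, s)"
  let ?H = "\<lambda>\<omega>::real \<times> real. damp i (fst \<omega>)"
  let ?Hs = "damp i s"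
  let ?c = "excess n a b i (x, s)"
  define e where "e = (1 - \<psi>) *\<^sub>R x - d"
  define C where "C = integral\<^sup>L lborel ?k"
  have ik: "integrable lborel ?k" "integrable lborel (\<lambda>\<omega>. snd \<omega> * ?k \<omega>)"
      "integrable lborel (\<lambda>\<omega>. inverse (fst \<omega>) * ?k \<omega>)"
    using kern_integrable[OF n a b s, of x] by simp_all
  have C: "0 < C" using kern_integral_pos[OF n a b s, of x] by (simp add: C_def)
  have k0: "0 \<le> ?k \<omega>" for \<omega> using kern_nonneg[OF n a b] .
  have kz: "?k \<omega> = 0" if "\<not> (0 < fst \<omega> \<and> 0 < snd \<omega> \<and> snd \<omega> < 1)" for \<omega>
    using that by (auto simp: kern_def)
  have H: "0 < ?H \<omega>" "?H \<omega> \<le> 1" for \<omega> using damp_bounds[OF i] by auto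
  have c0: "0 \<le> ?c \<omega>" for \<omega>
  proof (cases "0 < fst \<omega>")
    case True
    then show ?thesis using k0[of \<omega>] s i damp_bounds(1)[OF i, of s] by (simp add: excess_def)
  qed (simp add: excess_def kz)
  have ic: "integrable lborel (\<lambda>\<omega>. 2 * ?c \<omega>)"
    using False c0 by (intro integrableI_nonneg) (auto simp: top.not_eq_extremum)
  have dom: "integrable lborel (\<lambda>\<omega>. ?H \<omega> * ?k \<omega> * (g \<omega> + B * V \<omega>))"
    if [measurable]: "g \<in> borel_measurable borel" and g: "\<And>\<omega>. 0 < snd \<omega> \<Longrightarrow> snd \<omega> < 1 \<Longrightarrow> \<bar>g \<omega>\<bar> \<le> A" and B: "0 \<le> B" for g A B
  proof (rule Bochner_Integration.integrable_bound)
    show "integrable lborel (\<lambda>\<omega>. A * ?k \<omega> + B * real CARD('p) * (inverse (fst \<omega>) * ?k \<omega>))"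
      by (intro Bochner_Integration.integrable_add integrable_mult_right ik)
    show "AE \<omega> in lborel. norm (?H \<omega> * ?k \<omega> * (g \<omega> + B * V \<omega>)) \<le> norm (A * ?k \<omega> + B * real CARD('p) * (inverse (fst \<omega>) * ?k \<omega>))"
    proof (intro AE_I2)
      fix \<omega> :: "real \<times> real"
      show "norm (?H \<omega> * ?k \<omega> * (g \<omega> + B * V \<omega>)) \<le> norm (A * ?k \<omega> + B * real CARD('p) * (inverse (fst \<omega>) * ?k \<omega>))"
      proof (cases "0 < fst \<omega> \<and> 0 < snd \<omega> \<and> snd \<omega> < 1")
        case True
        have V: "0 \<le> V \<omega>" "V \<omega> \<le> real CARD('p) * 1 * inverse (fst \<omega>)"
          unfolding V_def using True by (auto intro!: mult_right_mono mult_left_mono)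
        have "\<bar>g \<omega> + B * V \<omega>\<bar> \<le> \<bar>g \<omega>\<bar> + \<bar>B * V \<omega>\<bar>" by (rule abs_triangle_ineq)
        also have "\<dots> \<le> A + B * (real CARD('p) * 1 * inverse (fst \<omega>))"
          using V B g[of \<omega>] True by (intro add_mono) (auto simp: abs_mult intro!: mult_left_mono)
        finally have "(?H \<omega> * ?k \<omega>) * \<bar>g \<omega> + B * V \<omega>\<bar> \<le> (1 * ?k \<omega>) * (A + B * (real CARD('p) * 1 * inverse (fst \<omega>)))"
          using H[of \<omega>] k0[of \<omega>] by (intro mult_mono mult_nonneg_nonneg) auto
        also have "\<dots> = A * ?k \<omega> + B * real CARD('p) * (inverse (fst \<omega>) * ?k \<omega>)" by (simp add: algebra_simps)
        finally show ?thesis using H(1)[of \<omega>] k0[of \<omega>] by (simp add: abs_mult)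
      qed (simp add: kz)
    qed
    show "(\<lambda>\<omega>. ?H \<omega> * ?k \<omega> * (g \<omega> + B * V \<omega>)) \<in> borel_measurable lborel"
      unfolding V_def using damp_measurable by measurable
  qed
  let ?u1 = "\<lambda>\<omega>. ?H \<omega> * ?k \<omega> * ((norm ((1 - \<psi>) *\<^sub>R x - (1 - snd \<omega>) *\<^sub>R x))\<^sup>2 + V \<omega>)"
  let ?u2 = "\<lambda>\<omega>. ?H \<omega> * ?k \<omega> * ((norm e)\<^sup>2 / 2)"
  let ?v1 = "\<lambda>\<omega>. ?H \<omega> * ?k \<omega> * ((norm (d - (1 - snd \<omega>) *\<^sub>R x))\<^sup>2 + V \<omega>)"
  \<comment> \<open>The linear part with the constant weight \<open>H\<^sub>i(1/s)\<close>; its integral is \<open>0\<close> by definition of the posterior mean.\<close>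
  let ?r = "\<lambda>\<omega>. 2 * ?Hs * (x \<bullet> e) * (snd \<omega> * ?k \<omega> - \<psi> * ?k \<omega>)"
  have nb: "(norm (w - (1 - t) *\<^sub>R x))\<^sup>2 \<le> (norm w + norm x)\<^sup>2" if "0 < t" "t < 1" for w and t :: real
  proof (rule power_mono)
    have "norm (w - (1 - t) *\<^sub>R x) \<le> norm w + norm ((1 - t) *\<^sub>R x)" by (rule norm_triangle_ineq4)
    also have "norm ((1 - t) *\<^sub>R x) \<le> norm x" using that by (simp add: mult_left_le_one_le)
    finally show "norm (w - (1 - t) *\<^sub>R x) \<le> norm w + norm x" by simp
  qed simp
  have iu1: "integrable lborel ?u1"
    using dom[of "\<lambda>\<omega>. (norm ((1 - \<psi>) *\<^sub>R x - (1 - snd \<omega>) *\<^sub>R x))\<^sup>2" "(norm ((1 - \<psi>) *\<^sub>R x) + norm x)\<^sup>2" 1] nb[of _ "(1 - \<psi>) *\<^sub>R x"] by simp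
  have iu2: "integrable lborel ?u2"
    using dom[of "\<lambda>\<omega>. (norm e)\<^sup>2 / 2" "(norm e)\<^sup>2 / 2" 0] by simp
  have iv1: "integrable lborel ?v1"
    using dom[of "\<lambda>\<omega>. (norm (d - (1 - snd \<omega>) *\<^sub>R x))\<^sup>2" "(norm d + norm x)\<^sup>2" 1] nb[of _ d] by simp
  have ir: "integrable lborel ?r"
    by (intro integrable_mult_right Bochner_Integration.integrable_diff ik)
  have r0: "integral\<^sup>L lborel ?r = 0"
  proof -
    have "integral\<^sup>L lborel ?r = 2 * ?Hs * (x \<bullet> e) * (LBINT \<omega>. snd \<omega> * ?k \<omega> - \<psi> * ?k \<omega>)"
      by (rule integral_mult_right_zero)
    also have "(LBINT \<omega>. snd \<omega> * ?k \<omega> - \<psi> * ?k \<omega>) = (LBINT \<omega>. snd \<omega> * ?k \<omega>) - (LBINT \<omega>. \<psi> * ?k \<omega>)"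
      by (intro Bochner_Integration.integral_diff integrable_mult_right ik)
    also have "(LBINT \<omega>. \<psi> * ?k \<omega>) = \<psi> * C" by (simp add: C_def)
    also have "(LBINT \<omega>. snd \<omega> * ?k \<omega>) = \<psi> * C"
      using C unfolding \<psi>_def post_mean_def C_def by simp
    finally show ?thesis by simp
  qed
  have pt: "?u1 \<omega> + ?u2 \<omega> \<le> ?v1 \<omega> + 2 * ?c \<omega> + ?r \<omega>" for \<omega>
  proof (cases "0 < fst \<omega> \<and> 0 < snd \<omega> \<and> snd \<omega> < 1")
    case True
    let ?A = "snd \<omega> - \<psi>"
    let ?X = "4 / i\<^sup>2 * ?Hs * (ln (fst \<omega>) - ln (inverse s))\<^sup>2 * (?A\<^sup>2 * (norm x)\<^sup>2)"
    have H0: "damp i (inverse s) = ?Hs" using s by (simp add: damp_def ln_inverse)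
    have sq1: "(norm ((1 - \<psi>) *\<^sub>R x - (1 - snd \<omega>) *\<^sub>R x))\<^sup>2 = ?A\<^sup>2 * (norm x)\<^sup>2"
    proof -
      have "(1 - \<psi>) *\<^sub>R x - (1 - snd \<omega>) *\<^sub>R x = ?A *\<^sub>R x" by (simp add: scaleR_diff_left[symmetric])
      then show ?thesis by (simp add: power_mult_distrib)
    qed
    have sq2: "(norm (d - (1 - snd \<omega>) *\<^sub>R x))\<^sup>2 = ?A\<^sup>2 * (norm x)\<^sup>2 - 2 * ?A * (x \<bullet> e) + (norm e)\<^sup>2"
    proof -
      have "(norm (t *\<^sub>R x - v))\<^sup>2 = t\<^sup>2 * (norm x)\<^sup>2 - 2 * t * (x \<bullet> v) + (norm v)\<^sup>2" for t v
        unfolding power2_norm_eq_inner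
        by (simp add: inner_diff_left inner_diff_right inner_commute power2_eq_square algebra_simps)
      moreover have "d - (1 - snd \<omega>) *\<^sub>R x = ?A *\<^sub>R x - e" by (simp add: e_def scaleR_diff_left)
      ultimately show ?thesis by (simp only:)
    qed
    have cross: "2 * (?H \<omega> - ?Hs) * ?A * (x \<bullet> e) \<le> ?H \<omega> * (norm e)\<^sup>2 / 2 + 2 * ?X"
    proof -
      let ?D = "\<bar>?H \<omega> - ?Hs\<bar> * (\<bar>?A\<bar> * norm x)"
      have D2: "?D\<^sup>2 \<le> ?H \<omega> * ?X"
      proof -
        have "?D\<^sup>2 = (?H \<omega> - ?Hs)\<^sup>2 * (?A\<^sup>2 * (norm x)\<^sup>2)" by (simp add: power_mult_distrib)
        also have "\<dots> \<le> (4 / i\<^sup>2 * (?H \<omega> * ?Hs) * (ln (fst \<omega>) - ln (inverse s))\<^sup>2) * (?A\<^sup>2 * (norm x)\<^sup>2)"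
          using damp_lipschitz[OF i, of "fst \<omega>" "inverse s"] unfolding H0 by (intro mult_right_mono) auto
        finally show ?thesis by (simp only: mult_ac)
      qed
      have "2 * (?H \<omega> - ?Hs) * ?A * (x \<bullet> e) \<le> 2 * \<bar>?H \<omega> - ?Hs\<bar> * \<bar>?A\<bar> * \<bar>x \<bullet> e\<bar>"
        by (rule order_trans[OF abs_ge_self]) (simp only: abs_mult abs_numeral order_refl)
      also have "\<dots> \<le> 2 * \<bar>?H \<omega> - ?Hs\<bar> * \<bar>?A\<bar> * (norm x * norm e)"
        by (intro mult_left_mono Cauchy_Schwarz_ineq2) auto
      also have "\<dots> = 2 * (?D * norm e)" by simp
      also have "\<dots> \<le> ?H \<omega> * (norm e)\<^sup>2 / 2 + 2 * ?X"
      proof -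
        have "0 \<le> (?H \<omega> * norm e - 2 * ?D)\<^sup>2" by simp
        then have "?H \<omega> * (4 * (?D * norm e)) \<le> ?H \<omega> * (?H \<omega> * (norm e)\<^sup>2) + 4 * ?D\<^sup>2"
          by (simp add: power2_eq_square algebra_simps)
        also have "\<dots> \<le> ?H \<omega> * (?H \<omega> * (norm e)\<^sup>2) + 4 * (?H \<omega> * ?X)" by (intro add_left_mono mult_left_mono D2) simp
        also have "\<dots> = ?H \<omega> * (?H \<omega> * (norm e)\<^sup>2 + 4 * ?X)" by (simp only: distrib_left mult_ac)
        finally have "4 * (?D * norm e) \<le> ?H \<omega> * (norm e)\<^sup>2 + 4 * ?X"
          using H(1)[of \<omega>] by (simp only: mult_le_cancel_left_pos)
        then show ?thesis by simp
      qed
      finally show ?thesis .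
    qed
    have lnb: "(ln (fst \<omega>) - ln (inverse s))\<^sup>2 \<le> 4 * (fst \<omega> * s + inverse (fst \<omega> * s))"
      using ln_squared_le[of "fst \<omega> * s"] True s by (simp add: ln_mult ln_inverse)
    have "?k \<omega> * ?X \<le> ?c \<omega>"
    proof -
      have "(4 / i\<^sup>2 * ?Hs * (?k \<omega> * (?A\<^sup>2 * (norm x)\<^sup>2))) * (ln (fst \<omega>) - ln (inverse s))\<^sup>2
        \<le> (4 / i\<^sup>2 * ?Hs * (?k \<omega> * (?A\<^sup>2 * (norm x)\<^sup>2))) * (4 * (fst \<omega> * s + inverse (fst \<omega> * s)))"
        using damp_bounds(1)[OF i, of s] k0[of \<omega>] by (intro mult_left_mono lnb) auto
      also have "\<dots> = ?c \<omega>" unfolding excess_def \<psi>_def by simp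
      finally show ?thesis by (simp only: mult_ac)
    qed
    moreover have "?k \<omega> * (2 * (?H \<omega> - ?Hs) * ?A * (x \<bullet> e)) \<le> ?k \<omega> * (?H \<omega> * (norm e)\<^sup>2 / 2 + 2 * ?X)"
      by (intro mult_left_mono cross k0)
    ultimately have fin: "?k \<omega> * (2 * (?H \<omega> - ?Hs) * ?A * (x \<bullet> e)) \<le> ?k \<omega> * (?H \<omega> * (norm e)\<^sup>2 / 2) + 2 * ?c \<omega>"
      by (simp only: distrib_left)
    have "?v1 \<omega> + 2 * ?c \<omega> + ?r \<omega> - (?u1 \<omega> + ?u2 \<omega>)
       = ?k \<omega> * (?H \<omega> * (norm e)\<^sup>2 / 2) + 2 * ?c \<omega> - ?k \<omega> * (2 * (?H \<omega> - ?Hs) * ?A * (x \<bullet> e))"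
      unfolding sq1 sq2 by (simp add: algebra_simps)
    then show ?thesis using fin by linarith
  qed (simp add: kz excess_def)
  have V0: "0 \<le> ?H \<omega> * ?k \<omega> * (y + V \<omega>)" if "0 \<le> y" for y \<omega>
  proof (cases "0 < fst \<omega> \<and> 0 < snd \<omega> \<and> snd \<omega> < 1")
    case True
    then show ?thesis using H(1)[of \<omega>] k0[of \<omega>] that by (intro mult_nonneg_nonneg add_nonneg_nonneg) (auto simp: V_def)
  qed (simp add: kz)
  have u20: "0 \<le> ?u2 \<omega>" for \<omega> using H(1)[of \<omega>] k0[of \<omega>] by simp
  have "?L1 + ?L2 = ennreal (integral\<^sup>L lborel ?u1) + ennreal (integral\<^sup>L lborel ?u2)"
    using iu1 iu2 V0 u20 unfolding e_def[symmetric] by (simp add: nn_integral_eq_integral)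
  also have "\<dots> = ennreal (integral\<^sup>L lborel ?u1 + integral\<^sup>L lborel ?u2)"
    using V0 u20 by (intro ennreal_plus[symmetric] integral_nonneg_AE) auto
  also have "integral\<^sup>L lborel ?u1 + integral\<^sup>L lborel ?u2 = (LBINT \<omega>. ?u1 \<omega> + ?u2 \<omega>)"
    using iu1 iu2 by (rule Bochner_Integration.integral_add[symmetric])
  also have "ennreal \<dots> \<le> ennreal (LBINT \<omega>. ?v1 \<omega> + 2 * ?c \<omega> + ?r \<omega>)"
    by (intro ennreal_leI integral_mono pt Bochner_Integration.integrable_add iu1 iu2 iv1 ic ir)
  also have "(LBINT \<omega>. ?v1 \<omega> + 2 * ?c \<omega> + ?r \<omega>) = (LBINT \<omega>. ?v1 \<omega> + 2 * ?c \<omega>) + integral\<^sup>L lborel ?r"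
    by (intro Bochner_Integration.integral_add Bochner_Integration.integrable_add iv1 ic ir)
  also have "(LBINT \<omega>. ?v1 \<omega> + 2 * ?c \<omega>) = integral\<^sup>L lborel ?v1 + (LBINT \<omega>. 2 * ?c \<omega>)"
    by (intro Bochner_Integration.integral_add iv1 ic)
  also have "ennreal (integral\<^sup>L lborel ?v1 + (LBINT \<omega>. 2 * ?c \<omega>) + integral\<^sup>L lborel ?r)
    = ennreal (integral\<^sup>L lborel ?v1) + ennreal (LBINT \<omega>. 2 * ?c \<omega>)"
    unfolding r0 add_0_right using V0 c0 by (intro ennreal_plus integral_nonneg_AE) auto
  also have "\<dots> = ?R1 + ?R2"
    using iv1 ic V0 c0 by (simp add: nn_integral_eq_integral)
  finally show ?thesis .
qed simp

text \<open>The substitution \<open>\<eta> = t / s\<close> removes \<open>s\<close> from the integrand. The lowest power of \<open>t\<close> that occurs is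
  \<open>t powr (n/2 - 2)\<close>, integrable at \<open>0\<close> because \<open>n \<ge> 3\<close>.\<close>

lemma scale_free_gamma_moment:
  assumes n: "3 \<le> n" and A: "0 \<le> A" and B: "0 \<le> B"
  obtains K where "0 \<le> K"
    "\<And>s. 0 < s \<Longrightarrow> (\<integral>\<^sup>+\<eta>. ennreal (indicator {0<..} \<eta> * (chi n \<eta> s * (\<eta> * s + inverse (\<eta> * s)) * (A / \<eta> + B * s))) \<partial>lborel)
        = ennreal (K / s)"
proof -
  let ?N = "real n / 2"
  define c where "c = 1 / (Gamma ?N * 2 powr ?N)"
  have c: "0 \<le> c" using n by (simp add: c_def Gamma_real_pos less_imp_le)
  define F where "F t = indicator {0<..} t * (chi n t 1 * (t + inverse t) * (A / t + B))" for t
  have F0: "0 \<le> F t" for t using n A B by (auto simp: F_def indicator_def)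
  let ?g = "\<lambda>(k::real) t. indicator {0<..} t * (t powr (k - 1) * exp (- (1/2 * t)))"
  have F: "F t = c * (A * ?g (?N + 1) t + B * ?g (?N + 2) t + A * ?g (?N - 1) t + B * ?g ?N t)" for t
  proof (cases "0 < t")
    case True
    have p: "t powr (?N + 1 - 1) = t powr (?N - 2) * t\<^sup>2" "t powr (?N + 2 - 1) = t powr (?N - 2) * (t\<^sup>2 * t)"
      "t powr (?N - 1 - 1) = t powr (?N - 2)" "t powr (?N - 1) = t powr (?N - 2) * t" "t powr ?N = t powr (?N - 2) * t\<^sup>2"
    proof -
      have q: "t powr (?N - 2) * t powr 2 = t powr ?N" "t powr (?N - 2) * t powr 3 = t powr (?N + 1)"
        "t powr (?N - 2) * t powr 1 = t powr (?N - 1)"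
        unfolding powr_add[symmetric] by (simp_all add: add.commute)
      then show "t powr (?N + 1 - 1) = t powr (?N - 2) * t\<^sup>2" "t powr (?N + 2 - 1) = t powr (?N - 2) * (t\<^sup>2 * t)"
      "t powr (?N - 1 - 1) = t powr (?N - 2)" "t powr (?N - 1) = t powr (?N - 2) * t" "t powr ?N = t powr (?N - 2) * t\<^sup>2"
        using True by (simp_all add: powr_numeral power3_eq_cube power2_eq_square add.commute)
    qed
    have "F t = c * (t powr ?N * exp (- (1/2 * t))) * (t + inverse t) * (A / t + B)"
      using True by (simp add: F_def chi_def scaled_chisq_dens_def c_def mult_ac)
    also have "\<dots> = c * (t powr (?N - 2) * exp (- (1/2 * t))) * (A * t\<^sup>2 + B * (t\<^sup>2 * t) + A + B * t)"
      unfolding p(5) using True by (simp add: field_simps power2_eq_square)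
    also have "\<dots> = c * (A * ?g (?N + 1) t + B * ?g (?N + 2) t + A * ?g (?N - 1) t + B * ?g ?N t)"
      unfolding p(1-4) using True by (simp add: algebra_simps)
    finally show ?thesis .
  qed (simp add: F_def)
  have iF: "integrable lborel F"
  proof -
    have g: "integrable lborel (?g k)" if "0 < k" for k :: real
      using has_bochner_integral_gamma[OF that, of "1/2"] by (simp add: has_bochner_integral_iff)
    show ?thesis
      unfolding F[abs_def]
      by (intro integrable_mult_right Bochner_Integration.integrable_add g) (use n in auto)
  qed
  have NF: "(\<integral>\<^sup>+t. ennreal (F t) \<partial>lborel) = ennreal (integral\<^sup>L lborel F)"
    by (intro nn_integral_eq_integral iF AE_I2 F0)
  show thesis
  proof (rule that)
    show "0 \<le> integral\<^sup>L lborel F" using F0 by (intro integral_nonneg_AE) auto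
    fix s :: real assume s: "0 < s"
    let ?f = "\<lambda>\<eta>. indicator {0<..} \<eta> * (chi n \<eta> s * (\<eta> * s + inverse (\<eta> * s)) * (A / \<eta> + B * s))"
    have "(\<integral>\<^sup>+\<eta>. ennreal (?f \<eta>) \<partial>lborel) = ennreal (inverse s) * (\<integral>\<^sup>+t. ennreal (?f (0 + inverse s * t)) \<partial>lborel)"
      using s by (subst nn_integral_real_affine[where c = "inverse s" and t = 0]) auto
    also have "(\<integral>\<^sup>+t. ennreal (?f (0 + inverse s * t)) \<partial>lborel) = (\<integral>\<^sup>+t. ennreal (F t) \<partial>lborel)"
    proof (intro nn_integral_cong arg_cong[where f = ennreal])
      fix t :: real
      show "?f (0 + inverse s * t) = F t"
      proof (cases "0 < t")
        case True
        have "s * chi n (inverse s * t) s = chi n t 1"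
        proof -
          have "(inverse s * t) powr ?N * (s * s powr (?N - 1)) = t powr ?N"
          proof -
            have "s * s powr (?N - 1) = s powr ?N" using powr_mult_base[of s "?N - 1"] s by simp
            moreover have "(inverse s * t) powr ?N = s powr (- ?N) * t powr ?N"
              using s by (simp add: powr_mult powr_minus inverse_powr)
            ultimately have "(inverse s * t) powr ?N * (s * s powr (?N - 1)) = (s powr (- ?N) * s powr ?N) * t powr ?N"
              by simp
            also have "s powr (- ?N) * s powr ?N = 1" using s by (simp add: powr_minus)
            finally show ?thesis by simp
          qed
          moreover have "inverse s * t * s = t" using s by simp
          moreover have "chi n t 1 = t powr ?N / (Gamma ?N * 2 powr ?N) * exp (- (t / 2))"
            by (simp add: chi_def scaled_chisq_dens_def)
          moreover have "s * chi n (inverse s * t) s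
              = ((inverse s * t) powr ?N * (s * s powr (?N - 1))) / (Gamma ?N * 2 powr ?N) * exp (- (inverse s * t * s / 2))"
            using s by (simp add: chi_def scaled_chisq_dens_def)
          ultimately show ?thesis by (simp only:)
        qed
        moreover have "?f (0 + inverse s * t) = (s * chi n (inverse s * t) s) * (t + inverse t) * (A / t + B)"
          using True s by (simp add: field_simps)
        ultimately show ?thesis using True by (simp add: F_def)
      qed (use s in \<open>auto simp: F_def zero_less_mult_iff\<close>)
    qed
    also have "ennreal (inverse s) * \<dots> = ennreal (integral\<^sup>L lborel F / s)"
      unfolding NF using s F0 by (subst ennreal_mult[symmetric]) (auto simp: divide_inverse mult.commute intro!: integral_nonneg_AE)
    finally show "(\<integral>\<^sup>+\<eta>. ennreal (?f \<eta>) \<partial>lborel) = ennreal (integral\<^sup>L lborel F / s)" .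
  qed
qed

text \<open>Since \<open>w \<Psi>(w) \<le> C\<close> and \<open>\<lambda>\<^sup>2 \<le> \<lambda>\<close>, the factor \<open>|x|\<^sup>2 (\<lambda> - \<psi>)\<^sup>2\<close> is at most \<open>2 \<lambda> |x|\<^sup>2 + 2 C s\<close>, and the \<open>x\<close> integral
  of this bound is \<open>2 p / \<eta> + 2 C s\<close>, free of \<open>\<lambda>\<close>. Integrating out \<open>\<lambda>\<close> and \<open>\<eta>\<close> leaves a multiple of
  \<open>i\<^sup>-\<^sup>2 H\<^sub>i(s) / s\<close>, whose integral is \<open>\<pi> / i\<close>.\<close>

lemma total_excess_bound:
  assumes n: "3 \<le> n" and a: "-1 < a" and b: "0 \<le> b"
    and upper: "\<And>w. 0 \<le> w \<Longrightarrow> w * shrink CARD('p::finite) n a b w \<le> C"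
  obtains K where "\<And>i. 0 < i \<Longrightarrow>
    (\<integral>\<^sup>+z. \<integral>\<^sup>+\<omega>. ennreal (2 * excess n a b i (z :: (real ^ 'p) \<times> real) \<omega>) \<partial>lborel \<partial>lborel) \<le> ennreal (K / i)"
proof -
  let ?p = "real CARD('p)"
  have b': "-1 < b" and n': "0 < n" using b n by auto
  have C: "0 \<le> C" using upper[of 0] by simp
  obtain K0 where K0: "0 \<le> K0" "\<And>s. 0 < s \<Longrightarrow>
      (\<integral>\<^sup>+\<eta>. ennreal (indicator {0<..} \<eta> * (chi n \<eta> s * (\<eta> * s + inverse (\<eta> * s)) * (2 * ?p / \<eta> + 2 * C * s))) \<partial>lborel) = ennreal (K0 / s)"
    using scale_free_gamma_moment[OF n, of "2 * ?p" "2 * C"] C by auto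
  show thesis
  proof (rule that)
    fix i :: real assume i: "0 < i"
    let ?c = "32 / i\<^sup>2"
    define W where "W s \<omega> = indicator {0<..} s * (?c * damp i s) * (indicator {0<..} (fst \<omega>) * (chi n (fst \<omega>) s * (fst \<omega> * s + inverse (fst \<omega> * s))))
       * (indicator {0<..<1} (snd \<omega>) * mixing_dens a b (snd \<omega>))" for s \<omega>
    have [measurable]: "(\<lambda>u. W (f u) (g u)) \<in> borel_measurable M"
      if [measurable]: "f \<in> borel_measurable M" "g \<in> borel_measurable M" for f g and M :: "'z measure"
      unfolding W_def using damp_measurable by measurable
    have W0: "0 \<le> W s \<omega>" for s \<omega>
      using i n' damp_bounds(1)[OF i, of s] mixing_dens_nonneg[OF a b', of "snd \<omega>"]
      by (auto simp: W_def indicator_def)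
    define Y where "Y x s \<omega> = W s \<omega> * ((2 * snd \<omega> * (norm x)\<^sup>2 + 2 * C * s) * normal_dens 0 (fst \<omega> * snd \<omega>) x)"
      for x :: "real ^ 'p" and s \<omega>
    have dominated: "2 * excess n a b i (x, s) \<omega> \<le> Y x s \<omega>" for x :: "real ^ 'p" and s \<omega>
    proof (cases "0 < s \<and> 0 < fst \<omega> \<and> 0 < snd \<omega> \<and> snd \<omega> < 1")
      case True
      let ?\<psi> = "post_mean n a b (x, s)"
      let ?w = "(norm x)\<^sup>2 / s"
      have w: "0 \<le> ?w" using True by simp
      have \<psi>: "?\<psi> = shrink CARD('p) n a b ?w"
        using True by (simp add: post_mean_eq_shrink[OF n' a b'])
      have \<psi>b: "0 \<le> ?\<psi>" "?\<psi> \<le> 1" unfolding \<psi> by (rule shrink_bounds[OF a b w])+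
      have "(norm x)\<^sup>2 * ?\<psi>\<^sup>2 = s * ((?w * ?\<psi>) * ?\<psi>)" using True by (simp add: power2_eq_square)
      also have "\<dots> \<le> s * (C * 1)"
        using True \<psi>b upper[OF w] C by (intro mult_left_mono mult_mono) (auto simp: \<psi>)
      finally have 1: "(norm x)\<^sup>2 * ?\<psi>\<^sup>2 \<le> C * s" by (simp add: mult.commute)
      have 2: "(norm x)\<^sup>2 * (snd \<omega>)\<^sup>2 \<le> (norm x)\<^sup>2 * snd \<omega>"
        using True by (intro mult_left_mono) (auto simp: power2_eq_square mult_left_le)
      have "(norm x)\<^sup>2 * (snd \<omega> - ?\<psi>)\<^sup>2 \<le> (norm x)\<^sup>2 * (2 * (snd \<omega>)\<^sup>2 + 2 * ?\<psi>\<^sup>2)"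
        using zero_le_power2[of "snd \<omega> + ?\<psi>"] by (intro mult_left_mono) (auto simp: power2_eq_square algebra_simps)
      also have "\<dots> \<le> 2 * snd \<omega> * (norm x)\<^sup>2 + 2 * C * s" using 1 2 by (simp add: algebra_simps)
      finally have 3: "(norm x)\<^sup>2 * (snd \<omega> - ?\<psi>)\<^sup>2 \<le> 2 * snd \<omega> * (norm x)\<^sup>2 + 2 * C * s" .
      have "2 * excess n a b i (x, s) \<omega> = (W s \<omega> * normal_dens 0 (fst \<omega> * snd \<omega>) x) * ((norm x)\<^sup>2 * (snd \<omega> - ?\<psi>)\<^sup>2)"
        using True by (simp add: excess_def W_def kern_def mult_ac)
      also have "\<dots> \<le> (W s \<omega> * normal_dens 0 (fst \<omega> * snd \<omega>) x) * (2 * snd \<omega> * (norm x)\<^sup>2 + 2 * C * s)"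
        by (intro mult_left_mono 3 mult_nonneg_nonneg W0) auto
      also have "\<dots> = Y x s \<omega>" by (simp only: Y_def mult_ac)
      finally show ?thesis .
    qed (auto simp: excess_def Y_def W_def kern_def chi_def)
    have "(\<integral>\<^sup>+z. \<integral>\<^sup>+\<omega>. ennreal (2 * excess n a b i (z :: (real ^ 'p) \<times> real) \<omega>) \<partial>lborel \<partial>lborel)
       \<le> (\<integral>\<^sup>+z. \<integral>\<^sup>+\<omega>. ennreal (Y (fst z) (snd z) \<omega>) \<partial>lborel \<partial>lborel)"
    proof (intro nn_integral_mono ennreal_leI)
      fix z :: "(real ^ 'p) \<times> real" and \<omega>
      show "2 * excess n a b i z \<omega> \<le> Y (fst z) (snd z) \<omega>" using dominated[of "fst z" "snd z" \<omega>] by simp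
    qed
    also have "\<dots> = (\<integral>\<^sup>+s. \<integral>\<^sup>+x. \<integral>\<^sup>+\<omega>. ennreal (Y x s \<omega>) \<partial>lborel \<partial>lborel \<partial>lborel)"
      unfolding Y_def by (subst nn_integral_lborel_pair(2)) auto
    also have "\<dots> = (\<integral>\<^sup>+s. \<integral>\<^sup>+\<omega>. \<integral>\<^sup>+x. ennreal (Y x s \<omega>) \<partial>lborel \<partial>lborel \<partial>lborel)"
      unfolding Y_def by (intro nn_integral_cong lborel_pair.Fubini') (simp add: lborel_prod)
    also have "\<dots> = (\<integral>\<^sup>+s. \<integral>\<^sup>+\<omega>. ennreal (W s \<omega> * (2 * ?p / fst \<omega> + 2 * C * s)) \<partial>lborel \<partial>lborel)"
    proof (intro nn_integral_cong)
      fix s :: real and \<omega> :: "real \<times> real"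
      show "(\<integral>\<^sup>+x. ennreal (Y x s \<omega>) \<partial>lborel) = ennreal (W s \<omega> * (2 * ?p / fst \<omega> + 2 * C * s))"
      proof (cases "0 < s \<and> 0 < fst \<omega> \<and> 0 < snd \<omega> \<and> snd \<omega> < 1")
        case True
        let ?N = "normal_dens (0 :: real ^ 'p) (fst \<omega> * snd \<omega>)"
        have t: "0 < fst \<omega> * snd \<omega>" using True by simp
        have 0: "has_bochner_integral lborel ?N 1"
          using integrable_normal_dens[OF t, of "0 :: real ^ 'p"] by (simp add: has_bochner_integral_iff)
        have "has_bochner_integral lborel (\<lambda>x. W s \<omega> * (2 * snd \<omega> * ((norm (0 - x))\<^sup>2 * ?N x) + 2 * C * s * ?N x))
            (W s \<omega> * (2 * snd \<omega> * ((norm (0 - (0 :: real ^ 'p)))\<^sup>2 + ?p / (fst \<omega> * snd \<omega>)) + 2 * C * s * 1))"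
          by (intro has_bochner_integral_mult_right has_bochner_integral_add 0 has_bochner_integral_normal_dens_sq t)
        then have "has_bochner_integral lborel (\<lambda>x. Y x s \<omega>) (W s \<omega> * (2 * ?p / fst \<omega> + 2 * C * s))"
          using True by (simp add: Y_def distrib_right mult.assoc)
        moreover have "0 \<le> Y x s \<omega>" for x using W0[of s \<omega>] True C by (simp add: Y_def)
        ultimately show ?thesis by (subst nn_integral_eq_integral) (auto simp: has_bochner_integral_iff)
      qed (auto simp: Y_def W_def chi_def)
    qed
    also have "\<dots> = (\<integral>\<^sup>+s. ennreal (?c * K0) * ennreal (indicator {0<..} s * (damp i s * inverse s)) \<partial>lborel)"
    proof (intro nn_integral_cong)
      fix s :: real
      show "(\<integral>\<^sup>+\<omega>. ennreal (W s \<omega> * (2 * ?p / fst \<omega> + 2 * C * s)) \<partial>lborel)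
         = ennreal (?c * K0) * ennreal (indicator {0<..} s * (damp i s * inverse s))"
      proof (cases "0 < s")
        case True
        let ?h = "\<lambda>\<eta>. indicator {0<..} \<eta> * (chi n \<eta> s * (\<eta> * s + inverse (\<eta> * s)) * (2 * ?p / \<eta> + 2 * C * s))"
        have h0: "0 \<le> ?h \<eta>" for \<eta> using True n' C by (auto simp: indicator_def)
        have d0: "0 \<le> ?c * damp i s" using damp_bounds(1)[OF i, of s] by simp
        have m0: "0 \<le> indicator {0<..<1} l * mixing_dens a b l" for l using mixing_dens_nonneg[OF a b'] by simp
        have "(\<integral>\<^sup>+\<omega>. ennreal (W s \<omega> * (2 * ?p / fst \<omega> + 2 * C * s)) \<partial>lborel)
          = (\<integral>\<^sup>+\<eta>. \<integral>\<^sup>+l. ennreal (W s (\<eta>, l) * (2 * ?p / \<eta> + 2 * C * s)) \<partial>lborel \<partial>lborel)"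
          by (subst nn_integral_lborel_pair(1)) auto
        also have "\<dots> = (\<integral>\<^sup>+\<eta>. \<integral>\<^sup>+l. ennreal (?c * damp i s) * ennreal (?h \<eta>) * ennreal (indicator {0<..<1} l * mixing_dens a b l) \<partial>lborel \<partial>lborel)"
        proof (intro nn_integral_cong)
          fix \<eta> l :: real
          have "W s (\<eta>, l) * (2 * ?p / \<eta> + 2 * C * s) = ?c * damp i s * ?h \<eta> * (indicator {0<..<1} l * mixing_dens a b l)"
          proof -
            have s1: "indicator {0<..} s = (1 :: real)" using True by simp
            show ?thesis by (simp only: W_def s1 fst_conv snd_conv mult_1_left mult_ac)
          qed
          then show "ennreal (W s (\<eta>, l) * (2 * ?p / \<eta> + 2 * C * s))
            = ennreal (?c * damp i s) * ennreal (?h \<eta>) * ennreal (indicator {0<..<1} l * mixing_dens a b l)"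
            using d0 h0[of \<eta>] m0[of l] by (simp only: ennreal_mult mult_nonneg_nonneg)
        qed
        also have "\<dots> = (\<integral>\<^sup>+\<eta>. ennreal (?c * damp i s) * ennreal (?h \<eta>) \<partial>lborel)"
          by (intro nn_integral_cong, subst nn_integral_cmult) (use nn_integral_mixing_dens[OF a b'] in auto)
        also have "\<dots> = ennreal (?c * damp i s) * ennreal (K0 / s)"
          by (subst nn_integral_cmult) (use K0(2)[OF True] in auto)
        also have "\<dots> = ennreal (?c * damp i s * (K0 / s))"
          using d0 K0(1) True by (intro ennreal_mult[symmetric]) auto
        also have "?c * damp i s * (K0 / s) = (?c * K0) * (indicator {0<..} s * (damp i s * inverse s))"
          using True by (simp add: divide_inverse)
        also have "ennreal \<dots> = ennreal (?c * K0) * ennreal (indicator {0<..} s * (damp i s * inverse s))"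
          using K0(1) True damp_bounds(1)[OF i, of s] by (intro ennreal_mult) auto
        finally show ?thesis .
      qed (simp add: W_def)
    qed
    also have "\<dots> = ennreal (?c * K0) * ennreal (i * pi)"
      using damp_measurable nn_integral_damp[OF i] by (subst nn_integral_cmult) auto
    also have "\<dots> = ennreal (32 * pi * K0 / i)"
      using i K0(1) by (subst ennreal_mult[symmetric]) (auto simp: power2_eq_square field_simps)
    finally show "(\<integral>\<^sup>+z. \<integral>\<^sup>+\<omega>. ennreal (2 * excess n a b i (z :: (real ^ 'p) \<times> real) \<omega>) \<partial>lborel \<partial>lborel)
       \<le> ennreal (32 * pi * K0 / i)" .
  qed
qed

text \<open>A competitor that is nowhere worse agrees with the estimator almost everywhere, hence has the same
  risk function and cannot be strictly better anywhere.\<close>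

theorem gen_bayes_admissible:
  assumes n: "3 \<le> n" and p: "2 < CARD('p::finite)" and a: "-1 < a" "a \<le> xi CARD('p) n" and b: "0 \<le> b"
  shows "admissible n (gen_bayes n a b :: (real ^ 'p) \<times> real \<Rightarrow> real ^ 'p)"
proof -
  have n': "0 < n" and b': "-1 < b" using n b by auto
  let ?g = "gen_bayes n a b :: (real ^ 'p) \<times> real \<Rightarrow> real ^ 'p"
  define \<delta> where "\<delta> z = (1 - post_mean n a b z) *\<^sub>R fst z" for z :: "(real ^ 'p) \<times> real"
  have [measurable]: "\<delta> \<in> borel_measurable borel" unfolding \<delta>_def by measurable
  have g\<delta>: "risk n ?g = risk n \<delta>"
    by (rule risk_cong) (simp add: gen_bayes_eq[OF n' a(1) b'] \<delta>_def)
  have r\<delta>: "risk n \<delta> \<theta> \<eta> \<le> ennreal (CARD('p))" if "0 < \<eta>" for \<theta> \<eta>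
    using gen_bayes_risk_le[OF n p a b that, of \<theta>] unfolding g\<delta> .
  have "w * shrink CARD('p) n a b w \<le> 2 * (real CARD('p) - 2) / (real n + 2)" if "0 \<le> w" for w
    using shrinkage_upper_bound[OF n p a b that] by (simp add: pos_le_divide_eq mult.commute)
  from total_excess_bound[where 'p = 'p, OF n a(1) b this]
  obtain K where K: "\<And>i. 0 < i \<Longrightarrow>
    (\<integral>\<^sup>+z. \<integral>\<^sup>+\<omega>. ennreal (2 * excess n a b i (z :: (real ^ 'p) \<times> real) \<omega>) \<partial>lborel \<partial>lborel) \<le> ennreal (K / i)" by blast
  have no_improvement: "risk n \<delta>' \<theta> \<eta> = risk n ?g \<theta> \<eta>"
    if est: "estimator \<delta>'" and dom: "\<And>\<theta> \<eta>. 0 < \<eta> \<Longrightarrow> risk n \<delta>' \<theta> \<eta> \<le> risk n ?g \<theta> \<eta>" and \<eta>: "0 < \<eta>"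
    for \<delta>' :: "(real ^ 'p) \<times> real \<Rightarrow> real ^ 'p" and \<theta> \<eta>
  proof -
    obtain d where d[measurable]: "d \<in> borel_measurable borel" and d': "\<And>x s. 0 < s \<Longrightarrow> \<delta>' (x, s) = d (x, s)"
      using estimator_borel_version[OF est] by metis
    have rd: "risk n \<delta>' = risk n d" using d' by (rule risk_cong)
    define Q where "Q i z = (\<integral>\<^sup>+\<omega>. ennreal (damp i (fst \<omega>) * kern n a b z \<omega> * ((norm (\<delta> z - d z))\<^sup>2 / 2)) \<partial>lborel)" for i z
    have [measurable]: "Q i \<in> borel_measurable borel" for i
      unfolding Q_def using damp_measurable by measurable
    \<comment> \<open>Integrate the posterior inequality over the data and cancel the finite Bayes risk.\<close>
    have Q: "(\<integral>\<^sup>+z. Q i z \<partial>lborel) \<le> ennreal (K / i)" if i: "0 < i" for i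
    proof -
      let ?B = "bayes_risk n a b (damp i)"
      let ?L = "\<lambda>f z. \<integral>\<^sup>+\<omega>. ennreal (damp i (fst \<omega>) * kern n a b z \<omega> * cond_loss (fst z) (f z) \<omega>) \<partial>lborel"
      let ?R = "\<lambda>z :: (real ^ 'p) \<times> real. \<integral>\<^sup>+\<omega>. ennreal (2 * excess n a b i z \<omega>) \<partial>lborel"
      have damp0: "0 \<le> damp i \<eta>" for \<eta> using damp_bounds(1)[OF i, of \<eta>] by simp
      have B: "?B f = (\<integral>\<^sup>+z. ?L f z \<partial>lborel)" if "f \<in> borel_measurable borel" for f :: "(real ^ 'p) \<times> real \<Rightarrow> real ^ 'p"
        by (rule bayes_risk_posterior[OF n' a(1) b' damp_measurable that damp0])
      have mL: "?L f \<in> borel_measurable borel" if [measurable]: "f \<in> borel_measurable borel" for f :: "(real ^ 'p) \<times> real \<Rightarrow> real ^ 'p"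
        using damp_measurable by measurable
      have fin: "?B \<delta> < \<infinity>"
      proof -
        have "?B \<delta> \<le> ennreal (CARD('p)) * ennreal (i * pi)"
          by (rule bayes_risk_le[OF a(1) b' i r\<delta>])
        also have "\<dots> < \<infinity>" by (simp add: ennreal_mult_less_top)
        finally show ?thesis .
      qed
      have "?B \<delta> + (\<integral>\<^sup>+z. Q i z \<partial>lborel) = (\<integral>\<^sup>+z. ?L \<delta> z + Q i z \<partial>lborel)"
        unfolding B[OF \<open>\<delta> \<in> borel_measurable borel\<close>] using mL by (intro nn_integral_add[symmetric]) auto
      also have "\<dots> \<le> (\<integral>\<^sup>+z. ?L d z + ?R z \<partial>lborel)"
      proof (rule nn_integral_mono)
        fix z :: "(real ^ 'p) \<times> real"
        show "?L \<delta> z + Q i z \<le> ?L d z + ?R z"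
        proof (cases "0 < snd z")
          case True
          then show ?thesis
            using posterior_excess_inequality[OF n' a(1) b' True i, of "fst z" "d z"] by (simp add: Q_def \<delta>_def cond_loss_def)
        next
          case False
          then have "kern n a b z \<omega> = 0" for \<omega> by (simp add: kern_def chi_def)
          then show ?thesis by (simp add: Q_def)
        qed
      qed
      also have "\<dots> = ?B d + (\<integral>\<^sup>+z. ?R z \<partial>lborel)"
        unfolding B[OF d] by (rule nn_integral_add) (use mL[OF d] in simp_all)
      also have "\<dots> \<le> ?B \<delta> + ennreal (K / i)"
        using dom unfolding g\<delta> rd by (intro add_mono bayes_risk_mono K[OF i])
      finally show ?thesis using fin by (auto simp: ennreal_add_left_cancel_le)
    qed
    \<comment> \<open>\<open>Q i\<close> increases with \<open>i\<close>, while its integral is at most \<open>K / i\<close>.\<close>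
    have "(\<integral>\<^sup>+z. Q 1 z \<partial>lborel) \<le> ennreal 0"
    proof (rule LIMSEQ_le_const)
      have "(\<lambda>k. K * inverse (real (Suc k))) \<longlonglongrightarrow> K * 0"
        by (intro tendsto_intros LIMSEQ_inverse_real_of_nat)
      then show "(\<lambda>k. ennreal (K * inverse (real (Suc k)))) \<longlonglongrightarrow> ennreal 0"
        by (intro tendsto_ennrealI) simp
      have "(\<integral>\<^sup>+z. Q 1 z \<partial>lborel) \<le> ennreal (K * inverse (real (Suc k)))" for k
      proof -
        have "(\<integral>\<^sup>+z. Q 1 z \<partial>lborel) \<le> (\<integral>\<^sup>+z. Q (real (Suc k)) z \<partial>lborel)"
          unfolding Q_def
          by (intro nn_integral_mono ennreal_leI mult_right_mono damp_mono kern_nonneg[OF n' a(1) b']) auto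
        also have "\<dots> \<le> ennreal (K / real (Suc k))" by (rule Q) simp
        finally show ?thesis by (simp add: divide_inverse)
      qed
      then show "\<exists>N. \<forall>k\<ge>N. (\<integral>\<^sup>+z. Q 1 z \<partial>lborel) \<le> ennreal (K * inverse (real (Suc k)))" by blast
    qed
    then have "AE z in lborel. Q 1 z = 0" by (subst nn_integral_0_iff_AE[symmetric]) auto
    then have AE: "AE z in lborel. 0 < snd z \<longrightarrow> \<delta> z = d z"
    proof eventually_elim
      fix z :: "(real ^ 'p) \<times> real" assume Q0: "Q 1 z = 0"
      show "0 < snd z \<longrightarrow> \<delta> z = d z"
      proof (rule impI, rule ccontr)
        assume s: "0 < snd z" and ne: "\<delta> z \<noteq> d z"
        have "AE \<omega> in lborel. ennreal (damp 1 (fst \<omega>) * kern n a b z \<omega> * ((norm (\<delta> z - d z))\<^sup>2 / 2)) = 0"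
          using Q0 unfolding Q_def using damp_measurable by (subst (asm) nn_integral_0_iff_AE) auto
        then have "AE \<omega> in lborel. kern n a b z \<omega> = 0"
        proof eventually_elim
          fix \<omega> assume "ennreal (damp 1 (fst \<omega>) * kern n a b z \<omega> * ((norm (\<delta> z - d z))\<^sup>2 / 2)) = 0"
          then have "kern n a b z \<omega> \<le> 0"
            using ne damp_bounds(1)[of 1 "fst \<omega>"] by (simp add: ennreal_eq_0_iff mult_le_0_iff)
          then show "kern n a b z \<omega> = 0" using kern_nonneg[OF n' a(1) b', of z \<omega>] by simp
        qed
        then have "(LBINT \<omega>. kern n a b z \<omega>) = (LBINT \<omega>::real \<times> real. 0)"
          by (intro integral_cong_AE) auto
        moreover have "0 < (LBINT \<omega>. kern n a b (fst z, snd z) \<omega>)"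
          by (rule kern_integral_pos[OF n' a(1) b' s])
        ultimately show False by simp
      qed
    qed
    have "risk n d \<theta> \<eta> = risk n \<delta> \<theta> \<eta>"
      unfolding risk_eq[OF n' \<eta> d] risk_eq[OF n' \<eta> \<open>\<delta> \<in> borel_measurable borel\<close>]
    proof (rule nn_integral_cong_AE, use AE in eventually_elim)
      fix z :: "(real ^ 'p) \<times> real" assume "0 < snd z \<longrightarrow> \<delta> z = d z"
      then show "ennreal (\<eta> * (norm (d z - \<theta>))\<^sup>2 * (normal_dens \<theta> \<eta> (fst z) * chi n \<eta> (snd z)))
        = ennreal (\<eta> * (norm (\<delta> z - \<theta>))\<^sup>2 * (normal_dens \<theta> \<eta> (fst z) * chi n \<eta> (snd z)))"
        by (cases "0 < snd z") (auto simp: chi_def)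
    qed
    then show ?thesis unfolding g\<delta> rd .
  qed
  show ?thesis
    unfolding admissible_def
    using gen_bayes_measurable[OF n' a(1) b', where 'p = 'p] no_improvement by (metis order_less_irrefl)
qed

theorem theorem3p1:
  fixes n :: nat and a b :: real
  assumes "n \<ge> 3"
    and "real CARD('p::finite) > 4 * real n / (real n - 2)"
    and "-1 < a" and "a \<le> xi CARD('p) n"
    and "b \<ge> 0"
  shows "minimax n (gen_bayes n a b :: (real ^ 'p) \<times> real \<Rightarrow> real ^ 'p)
       \<and> admissible n (gen_bayes n a b :: (real ^ 'p) \<times> real \<Rightarrow> real ^ 'p)"
  using gen_bayes_minimax[of n a b, where 'p = 'p] gen_bayes_admissible[of n a b, where 'p = 'p]
    dimension_gt_2[of n "CARD('p)"] assms by blast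

end
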